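(* Let $d\ge1$ be an integer, let $X$ and $Y$ be two independent $d$-dimensional Brownian motions, and let $Z(s,t)=X(s)+Y(t)$ for $(s,t)\in[0,\infty)^2$. Fix some $M>0$, a compact set $E\subset[0,\infty)^2$, and $a\in[-M,M]^d$. Then there exist constants $A_5$ and $A_6$, which depend only on $c_1(E)$, $c_2(E)$, $M$ and $d$, such that $$A_5\,\mathrm{Cap}_{d/2}(E)\le\mathbb{P}\big(a\in Z(E)\big)\le A_6\,\mathrm{Cap}_{d/2}(E).$$
   Context: Brownian motions are standard, started at $0$, with continuous sample paths, and $Z(E)=\{Z(s,t):(s,t)\in E\}$. For $x\in\mathbb{R}^k$, $|x|=\max_{1\le i\le k}|x^{(i)}|$. For compact $E\subset[0,\infty)^2$, $c_1(E)=\inf\{|\mathbf{t}|:\mathbf{t}\in E\}$ and $c_2(E)=\sup\{|\mathbf{t}|:\mathbf{t}\in E\}$. $\mathcal{P}(E)$ is the set of all probability measures on $E$. For $\beta>0$ and $\sigma\in\mathcal{P}(E)$, $\mathcal{E}_\beta(\sigma)=\iint|\mathbf{s}-\mathbf{t}|^{-\beta}\,\sigma(d\mathbf{s})\,\sigma(d\mathbf{t})$, and $\mathrm{Cap}_\beta(E)=\big[\inf_{\sigma\in\mathcal{P}(E)}\mathcal{E}_\beta(\sigma)\big]^{-1}$, with $1/\infty=0$ and $\inf\varnothing=\infty$.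
   Formalization: Proved for c_1(E)>0, i.e. (0,0) not in E: if E={(0,0)} and a=0 the probability is 1 but the capacity is 0. The constants are chosen per type of sample points; passing to the law of (X,Y) on path space gives constants valid for all probability spaces. *)

theory Defs
  imports "HOL-Probability.Probability"
begin

text \<open>Standard Brownian motion in \<open>\<real>\<^sup>d\<close> with \<open>d = CARD('d)\<close>, indexed by \<open>[0,\<infinity>)\<close>; the values at
  negative times are irrelevant. The product density below is that of \<open>N(0, (t - s) I)\<close>; recall
  that the second argument of \<open>normal_density\<close> is the standard deviation.\<close>

definition brownian_motion :: "'w measure \<Rightarrow> (real \<Rightarrow> 'w \<Rightarrow> real ^ 'd::finite) \<Rightarrow> bool" where
  "brownian_motion P X \<longleftrightarrow>
     prob_space P \<and>
     (\<forall>t\<ge>0. X t \<in> borel_measurable P) \<and>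
     (\<forall>\<omega>\<in>space P. X 0 \<omega> = 0) \<and>
     (\<forall>\<omega>\<in>space P. continuous_on {0..} (\<lambda>t. X t \<omega>)) \<and>
     (\<forall>s t. 0 \<le> s \<longrightarrow> s < t \<longrightarrow>
        distributed P lborel (\<lambda>\<omega>. X t \<omega> - X s \<omega>)
          (\<lambda>x. ennreal (\<Prod>i\<in>UNIV. normal_density 0 (sqrt (t - s)) (x $ i)))) \<and>
     (\<forall>(n::nat) \<tau>. 0 \<le> \<tau> 0 \<longrightarrow> (\<forall>k<n. \<tau> k < \<tau> (Suc k)) \<longrightarrow>
        prob_space.indep_vars P (\<lambda>_. borel) (\<lambda>k \<omega>. X (\<tau> (Suc k)) \<omega> - X (\<tau> k) \<omega>) {..<n})"

text \<open>Independence of the whole processes, as random elements of the space of functions on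
  \<open>[0,\<infinity>)\<close> with the product sigma-algebra.\<close>

definition indep_processes ::
  "'w measure \<Rightarrow> (real \<Rightarrow> 'w \<Rightarrow> real ^ 'd::finite) \<Rightarrow> (real \<Rightarrow> 'w \<Rightarrow> real ^ 'd) \<Rightarrow> bool" where
  "indep_processes P X Y \<longleftrightarrow>
     prob_space.indep_var P
       (\<Pi>\<^sub>M t\<in>{0..}. borel) (\<lambda>\<omega>. \<lambda>t\<in>{0..}. X t \<omega>)
       (\<Pi>\<^sub>M t\<in>{0..}. borel) (\<lambda>\<omega>. \<lambda>t\<in>{0..}. Y t \<omega>)"

definition additive_process ::
  "(real \<Rightarrow> 'w \<Rightarrow> real ^ 'd::finite) \<Rightarrow> (real \<Rightarrow> 'w \<Rightarrow> real ^ 'd) \<Rightarrow> real \<times> real \<Rightarrow> 'w \<Rightarrow> real ^ 'd" where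
  "additive_process X Y = (\<lambda>(s, t) \<omega>. X s \<omega> + Y t \<omega>)"

text \<open>The norm \<open>|x| = max\<^sub>i |x\<^sub>i|\<close> is the library's \<open>infnorm\<close>. With values in \<open>ennreal\<close>,
  \<open>c1 {} = \<infinity>\<close> and \<open>c2 {} = 0\<close>.\<close>

definition c1 :: "(real \<times> real) set \<Rightarrow> ennreal" where
  "c1 E = (INF t\<in>E. ennreal (infnorm t))"

definition c2 :: "(real \<times> real) set \<Rightarrow> ennreal" where
  "c2 E = (SUP t\<in>E. ennreal (infnorm t))"

definition prob_measures_on :: "'a::topological_space set \<Rightarrow> 'a measure set" where
  "prob_measures_on E = {\<sigma>. sets \<sigma> = sets (restrict_space borel E) \<and> prob_space \<sigma>}"

text \<open>The reciprocal is taken in \<open>ennreal\<close>, where \<open>inverse 0 = \<infinity>\<close>; since \<open>0 powr \<beta> = 0\<close>, the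
  kernel \<open>|s - t|\<^sup>-\<^sup>\<beta>\<close> is thus \<open>\<infinity>\<close> on the diagonal. (In contrast, \<open>0 powr - \<beta>\<close> would be \<open>0\<close>.)\<close>

definition energy :: "real \<Rightarrow> 'a::euclidean_space measure \<Rightarrow> ennreal" where
  "energy \<beta> \<sigma> = (\<integral>\<^sup>+ s. \<integral>\<^sup>+ t. inverse (ennreal (infnorm (s - t) powr \<beta>)) \<partial>\<sigma> \<partial>\<sigma>)"

definition capacity :: "real \<Rightarrow> 'a::euclidean_space set \<Rightarrow> ennreal" where
  "capacity \<beta> E = inverse (INF \<sigma>\<in>prob_measures_on E. energy \<beta> \<sigma>)"

text \<open>The two-sided capacity estimate is stated for \<open>c1 E > 0\<close>, that is, for compact \<open>E\<close> with
  \<open>(0,0) \<notin> E\<close>: no constants can serve for \<open>c1 E = 0\<close>. If \<open>E = {(0,0)}\<close> and \<open>a = 0\<close>, the hitting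
  probability is \<open>1\<close> while the capacity is \<open>0\<close>. If \<open>d \<le> 3\<close>,
  \<open>E = {(0,0)} \<union> [0,\<epsilon>]\<^sup>2 \<union> {(1,1)}\<close> and \<open>a \<noteq> 0\<close>, then \<open>c1 E = 0\<close> and \<open>c2 E = 1\<close> for all small \<open>\<epsilon>\<close>,
  the capacity is at least of order \<open>\<epsilon>\<close> to the power \<open>d/2\<close>, and the hitting probability is
  exponentially small in \<open>1/\<epsilon>\<close>.\<close>

end

theory Submission
  imports Defs
begin

text \<open>The lower bound is the second moment method, applied to the integrals of the heat kernel
  \<open>heat r (Z q - a)\<close> against a measure \<open>\<sigma>\<close> on \<open>E\<close> as \<open>r \<rightarrow> 0\<close>.

  For the upper bound one may assume \<open>s \<ge> m = c1 E\<close> on \<open>E\<close>. Reweighting the probability by the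
  inverse density of \<open>X m\<close> turns the law of \<open>X m\<close> into Lebesgue measure, and under this
  \<open>\<sigma>\<close>-finite measure the field \<open>Z\<close> is Markov in both time directions in each parameter. Let \<open>\<sigma>\<close> be
  the law, given a hit, of a measurably selected hitting point \<open>U\<close>. For each of the four quadrants
  at \<open>U\<close>, the conditional expectation of \<open>\<integral> heat r (Z q - a) d\<sigma>(q)\<close> given the past opposite to this
  quadrant is bounded below by the potential of \<open>\<sigma>\<close> on the quadrant. The dual form of Doob's \<open>L\<^sup>2\<close>
  inequality, applied in each parameter, compares their sum with the energy of \<open>\<sigma>\<close>.
  It suffices to treat finitely many times, since \<open>U\<close> can be rounded to a grid.\<close>

subsection \<open>The heat kernel\<close>

text \<open>The obstacle is that points of the plane have no total order, so there is no first
  hitting point at which a strong Markov property could be used. The argument never conditions at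
  \<open>U\<close>: it splits the hit according to the value of \<open>U\<close> and pairs the
  pieces with conditional expectations at deterministic points. Duality makes this a substitute for
  evaluating a maximal function at \<open>U\<close>. All four quadrants are used because \<sigma>
  may put little mass into any single quadrant at a given point. Under \<open>P\<close> itself the
  reversed pasts would have a different transition law, since a Brownian path run backwards is drawn
  to the origin; with a Lebesgue distributed start, the step away from a point has the same Gaussian
  law in every direction. The price is an infinite measure: each past must be shown to be
  \<sigma>-finite before conditioning. The estimate closes on itself: up to constants, the square of
  the unnormalized energy is at most this energy times the hitting probability, and one factor
  cancels. Smoothing with \<open>r > 0\<close> keeps the energy finite until then.\<close>

definition heat :: "real \<Rightarrow> real ^ 'd::finite \<Rightarrow> real" where
  "heat r x = (\<Prod>i\<in>UNIV. normal_density 0 (sqrt r) (x $ i))"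

text \<open>\<open>nn_integral_lborel_prod\<close> and the measurability proofs work along
  \<open>Basis\<close>, whereas densities of Brownian increments are written with
  components.\<close>

lemma heat_Basis: "heat r (x :: real ^ 'd::finite) = (\<Prod>b\<in>Basis. normal_density 0 (sqrt r) (x \<bullet> b))"
proof -
  have "(Basis :: (real ^ 'd) set) = (\<lambda>i. axis i 1) ` UNIV"
    by (auto simp: Basis_vec_def)
  moreover have "inj (\<lambda>i::'d. axis i (1::real))"
    by (auto simp: inj_def axis_eq_axis)
  ultimately have "(\<Prod>b\<in>Basis. normal_density 0 (sqrt r) (x \<bullet> b)) = (\<Prod>i\<in>UNIV. normal_density 0 (sqrt r) (x \<bullet> axis i 1))"
    by (metis (no_types, lifting) prod.reindex_cong)
  then show ?thesis
    by (simp add: heat_def cart_eq_inner_axis)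
qed

lemma heat_nonneg [simp]: "0 \<le> heat r x"
  by (simp add: heat_def prod_nonneg)

lemma heat_pos: "0 < r \<Longrightarrow> 0 < heat r x"
  by (simp add: heat_def prod_pos normal_density_pos)

lemma borel_measurable_heat [measurable]: "heat r \<in> borel_measurable borel"
  unfolding heat_Basis[abs_def] by measurable

lemma heat_minus: "heat r (- x) = heat r x"
  by (simp add: heat_def normal_density_def)

lemma heat_le_zero: "0 < r \<Longrightarrow> heat r (x :: real ^ 'd::finite) \<le> heat r (0 :: real ^ 'd)"
  unfolding heat_def by (rule prod_mono) (auto simp: normal_density_def divide_right_mono)

lemma heat_zero: "0 < r \<Longrightarrow> heat r (0 :: real ^ 'd::finite) = 1 / sqrt (2 * pi * r) ^ CARD('d)"
  by (simp add: heat_def normal_density_def power_one_over)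

lemma heat_zero_powr:
  assumes "0 < r"
  shows "heat r (0 :: real ^ 'd::finite) = 1 / (2 * pi * r) powr (real CARD('d) / 2)"
proof -
  have "(2 * pi * r) powr (real CARD('d) / 2) = ((2 * pi * r) powr (1 / 2)) powr real CARD('d)"
    by (simp add: powr_powr)
  also have "\<dots> = sqrt (2 * pi * r) ^ CARD('d)"
    using assms by (subst powr_half_sqrt) (auto intro: powr_realpow)
  finally show ?thesis using heat_zero[OF assms, where 'd='d] by simp
qed

lemma heat_zero_antimono: "0 < r \<Longrightarrow> r \<le> q \<Longrightarrow> heat q (0 :: real ^ 'd::finite) \<le> heat r (0 :: real ^ 'd)"
  by (simp add: heat_zero frac_le power_mono)

text \<open>Each Gaussian factor is at least its smallest prefactor, at the largest variance
  \<open>R\<close>, times its smallest exponential, at the smallest variance \<open>q\<close>. The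
  constant of the lower bound for the hitting probability originates here.\<close>

lemma heat_ge:
  fixes x :: "real ^ 'd::finite"
  assumes "0 < q" "q \<le> r" "r \<le> R" "\<And>i. \<bar>x $ i\<bar> \<le> M"
  shows "(1 / sqrt (2 * pi * R) * exp (- M\<^sup>2 / (2 * q))) ^ CARD('d) \<le> heat r x"
proof -
  have "1 / sqrt (2 * pi * R) * exp (- M\<^sup>2 / (2 * q)) \<le> normal_density 0 (sqrt r) (x $ i)" for i
  proof -
    have "(x $ i)\<^sup>2 \<le> M\<^sup>2"
      using assms(4)[of i] by (metis abs_ge_zero power2_abs power_mono)
    then have "(x $ i)\<^sup>2 / (2 * r) \<le> M\<^sup>2 / (2 * q)"
      using assms by (intro frac_le) auto
    then have "exp (- M\<^sup>2 / (2 * q)) \<le> exp (- (x $ i)\<^sup>2 / (2 * r))"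
      by simp
    moreover have "1 / sqrt (2 * pi * R) \<le> 1 / sqrt (2 * pi * r)"
      using assms by (intro divide_left_mono) auto
    ultimately show ?thesis
      using assms mult_mono[of "1 / sqrt (2 * pi * R)" "1 / sqrt (2 * pi * r)" "exp (- M\<^sup>2 / (2 * q))"
        "exp (- (x $ i)\<^sup>2 / (2 * r))"] by (simp add: normal_density_def)
  qed
  then have "(\<Prod>i\<in>(UNIV::'d set). 1 / sqrt (2 * pi * R) * exp (- M\<^sup>2 / (2 * q))) \<le> heat r x"
    unfolding heat_def using assms by (intro prod_mono) auto
  then show ?thesis by simp
qed

text \<open>Coordinatewise this is the convolution of two centred normal laws. The argument
  \<open>z + y\<close> instead of \<open>z - y\<close> fits increments; the density is even, so the
  two forms agree.\<close>

lemma heat_convolution: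
  fixes z :: "real ^ 'd::finite"
  assumes "0 < r" "0 < q"
  shows "(\<integral>\<^sup>+y. ennreal (heat r (z + y)) * ennreal (heat q y) \<partial>lborel) = ennreal (heat (r + q) z)"
proof -
  have *: "(\<integral>\<^sup>+y. ennreal (normal_density 0 (sqrt r) (c + y) * normal_density 0 (sqrt q) y) \<partial>lborel)
    = ennreal (normal_density 0 (sqrt (r + q)) c)" for c
  proof -
    have "normal_density 0 (sqrt r) (c + y) = normal_density 0 (sqrt r) (- c - y)" for y
      by (simp add: normal_density_def power2_eq_square algebra_simps)
    then have "(\<integral>\<^sup>+y. ennreal (normal_density 0 (sqrt r) (c + y) * normal_density 0 (sqrt q) y) \<partial>lborel)
      = ennreal (normal_density 0 (sqrt ((sqrt r)\<^sup>2 + (sqrt q)\<^sup>2)) (- c))"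
      using fun_cong[OF conv_normal_density_zero_mean[of "sqrt r" "sqrt q"], of "- c"] assms by simp
    then show ?thesis using assms by (simp add: normal_density_def)
  qed
  have "ennreal (heat r (z + y)) * ennreal (heat q y) = (\<Prod>b\<in>Basis. ennreal (normal_density 0 (sqrt r) (z \<bullet> b + y \<bullet> b)
        * normal_density 0 (sqrt q) (y \<bullet> b)))" for y
    by (subst prod_ennreal) (simp_all add: heat_Basis inner_add_left prod.distrib ennreal_mult prod_nonneg)
  then have "(\<integral>\<^sup>+y. ennreal (heat r (z + y)) * ennreal (heat q y) \<partial>lborel)
    = (\<integral>\<^sup>+y. (\<Prod>b\<in>Basis. ennreal (normal_density 0 (sqrt r) (z \<bullet> b + y \<bullet> b)
        * normal_density 0 (sqrt q) (y \<bullet> b))) \<partial>lborel)"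
    by simp
  also have "\<dots> = (\<Prod>b\<in>Basis. (\<integral>\<^sup>+y. ennreal (normal_density 0 (sqrt r) (z \<bullet> b + y)
        * normal_density 0 (sqrt q) y) \<partial>lborel))"
    by (rule nn_integral_lborel_prod) auto
  also have "\<dots> = ennreal (heat (r + q) z)"
    by (simp add: * heat_Basis prod_ennreal)
  finally show ?thesis .
qed

lemma tendsto_heat:
  assumes "(f \<longlongrightarrow> r) F" "(g \<longlongrightarrow> x) F" "0 < r"
  shows "((\<lambda>n. heat (f n) (g n)) \<longlongrightarrow> heat r x) F"
proof -
  have "((\<lambda>n. normal_density 0 (sqrt (f n)) (g n $ i)) \<longlongrightarrow> normal_density 0 (sqrt r) (x $ i)) F" for i
  proof -
    have s: "((\<lambda>n. (sqrt (f n))\<^sup>2) \<longlongrightarrow> (sqrt r)\<^sup>2) F"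
      using assms(1) by (intro tendsto_power tendsto_real_sqrt)
    have "((\<lambda>n. (g n $ i - 0)\<^sup>2) \<longlongrightarrow> (x $ i - 0)\<^sup>2) F"
      using assms(2) by (intro tendsto_power tendsto_diff tendsto_vec_nth tendsto_const)
    from tendsto_exp[OF tendsto_divide[OF tendsto_minus[OF this] tendsto_mult[OF tendsto_const s, of 2]]]
    have "((\<lambda>n. exp (- (g n $ i - 0)\<^sup>2 / (2 * (sqrt (f n))\<^sup>2))) \<longlongrightarrow> exp (- (x $ i - 0)\<^sup>2 / (2 * (sqrt r)\<^sup>2))) F"
      using assms(3) by simp
    moreover from tendsto_real_sqrt[OF tendsto_mult[OF tendsto_const s, of "2 * pi"]]
    have "((\<lambda>n. 1 / sqrt (2 * pi * (sqrt (f n))\<^sup>2)) \<longlongrightarrow> 1 / sqrt (2 * pi * (sqrt r)\<^sup>2)) F"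
      by (rule tendsto_divide[OF tendsto_const]) (use assms(3) in simp)
    ultimately show ?thesis
      unfolding normal_density_def by (rule tendsto_mult[rotated])
  qed
  then show ?thesis
    unfolding heat_def by (rule tendsto_prod)
qed

section \<open>Integration tools: translation, decoupling, duality\<close>

lemma nn_integral_lborel_translation:
  fixes f :: "'a::euclidean_space \<Rightarrow> ennreal"
  assumes [measurable]: "f \<in> borel_measurable borel"
  shows "(\<integral>\<^sup>+x. f (x + t) \<partial>lborel) = (\<integral>\<^sup>+x. f x \<partial>lborel)"
proof -
  have "(\<integral>\<^sup>+x. f x \<partial>lborel) = (\<integral>\<^sup>+x. f x \<partial>distr lborel borel ((+) t))"
    by (simp add: lborel_distr_plus)
  also have "\<dots> = (\<integral>\<^sup>+x. f (x + t) \<partial>lborel)"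
    by (subst nn_integral_distr) (auto simp: add.commute)
  finally show ?thesis by simp
qed

text \<open>The joint law is a product, so \<open>Y\<close> may be replaced by an independent copy,
  written as a second integration over the same space. Conditioning on one of two independent
  variables is done in this form below.\<close>

lemma (in prob_space) indep_var_nn_integral:
  assumes ind: "indep_var S X T Y" and [measurable]: "case_prod g \<in> borel_measurable (S \<Otimes>\<^sub>M T)"
  shows "(\<integral>\<^sup>+w. g (X w) (Y w) \<partial>M) = (\<integral>\<^sup>+w. \<integral>\<^sup>+w'. g (X w) (Y w') \<partial>M \<partial>M)"
proof -
  have [measurable]: "X \<in> measurable M S" "Y \<in> measurable M T"
    using indep_var_rv1[OF ind] indep_var_rv2[OF ind] by auto
  interpret Y: prob_space "distr M T Y" by (rule prob_space_distr) simp
  interpret X: prob_space "distr M S X" by (rule prob_space_distr) simp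
  interpret XY: pair_sigma_finite "distr M S X" "distr M T Y" ..
  have "(\<integral>\<^sup>+w. g (X w) (Y w) \<partial>M) = (\<integral>\<^sup>+z. case_prod g z \<partial>distr M (S \<Otimes>\<^sub>M T) (\<lambda>w. (X w, Y w)))"
    by (subst nn_integral_distr) auto
  also have "\<dots> = (\<integral>\<^sup>+z. case_prod g z \<partial>(distr M S X \<Otimes>\<^sub>M distr M T Y))"
    using ind unfolding indep_var_distribution_eq by simp
  also have "\<dots> = (\<integral>\<^sup>+x. \<integral>\<^sup>+y. g x y \<partial>distr M T Y \<partial>distr M S X)"
    by (subst Y.nn_integral_fst[symmetric]) auto
  also have "\<dots> = (\<integral>\<^sup>+w. \<integral>\<^sup>+y. g (X w) y \<partial>distr M T Y \<partial>M)"
    using Y.borel_measurable_nn_integral_fst[of "case_prod g" S] by (intro nn_integral_distr) simp_all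
  also have "\<dots> = (\<integral>\<^sup>+w. \<integral>\<^sup>+w'. g (X w) (Y w') \<partial>M \<partial>M)"
  proof (rule nn_integral_cong)
    fix w assume "w \<in> space M"
    then have "X w \<in> space S" by (rule measurable_space[rotated]) simp
    from measurable_Pair2[OF assms(2) this]
    show "(\<integral>\<^sup>+y. g (X w) y \<partial>distr M T Y) = (\<integral>\<^sup>+w'. g (X w) (Y w') \<partial>M)"
      by (intro nn_integral_distr) simp_all
  qed
  finally show ?thesis .
qed

text \<open>Doob's inequality bounds the maximal function of a martingale in L2 by twice its
  terminal value; the adjoint statement bounds a sum of conditional expectations by twice the sum of
  the \<open>A i\<close>, whence 4 for squares. The direct proof expands the square: in each product
  the factor with the smaller \<sigma>-algebra is measurable for the larger one, so the other
  conditional expectation may be replaced by \<open>A i\<close> itself. \<open>R\<close> need not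
  separate indices, because pairs of times will be compared in one coordinate only. The last two
  conclusions make a second application, to the conditional expectations, possible.\<close>

lemma dual_doob_L2:
  fixes A :: "'i \<Rightarrow> 'a \<Rightarrow> ennreal" and c :: ennreal
  assumes fin: "finite I"
    and sigma_fin: "\<And>i. i \<in> I \<Longrightarrow> sigma_finite_subalgebra M (F i)"
    and total: "\<And>i j. i \<in> I \<Longrightarrow> j \<in> I \<Longrightarrow> R i j \<or> R j i"
    and mono: "\<And>i j. i \<in> I \<Longrightarrow> j \<in> I \<Longrightarrow> R i j \<Longrightarrow> sets (F i) \<subseteq> sets (F j)"
    and A [measurable]: "\<And>i. i \<in> I \<Longrightarrow> A i \<in> borel_measurable M"
    and bounded: "\<And>i. i \<in> I \<Longrightarrow> AE x in M. A i x \<le> c" "c < \<infinity>"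
    and int: "\<And>i. i \<in> I \<Longrightarrow> (\<integral>\<^sup>+x. A i x \<partial>M) < \<infinity>"
  shows "(\<integral>\<^sup>+x. (\<Sum>i\<in>I. nn_cond_exp M (F i) (A i) x)\<^sup>2 \<partial>M) \<le> 4 * (\<integral>\<^sup>+x. (\<Sum>i\<in>I. A i x)\<^sup>2 \<partial>M)"
    and "i \<in> I \<Longrightarrow> AE x in M. nn_cond_exp M (F i) (A i) x \<le> c"
    and "i \<in> I \<Longrightarrow> (\<integral>\<^sup>+x. nn_cond_exp M (F i) (A i) x \<partial>M) = (\<integral>\<^sup>+x. A i x \<partial>M)"
proof -
  define B where "B i = nn_cond_exp M (F i) (A i)" for i
  have [measurable]: "B i \<in> borel_measurable M" for i
    by (simp add: B_def)
  show B_le: "AE x in M. nn_cond_exp M (F i) (A i) x \<le> c" if i: "i \<in> I" for i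
  proof -
    interpret sigma_finite_subalgebra M "F i" by (rule sigma_fin[OF i])
    have "AE x in M. nn_cond_exp M (F i) (A i) x \<le> nn_cond_exp M (F i) (\<lambda>_. c) x"
      by (rule nn_cond_exp_mono) (use bounded i in auto)
    moreover have "AE x in M. c = nn_cond_exp M (F i) (\<lambda>_. c) x"
      by (rule nn_cond_exp_F_meas) simp
    ultimately show ?thesis by eventually_elim simp
  qed
  show int_B: "(\<integral>\<^sup>+x. nn_cond_exp M (F i) (A i) x \<partial>M) = (\<integral>\<^sup>+x. A i x \<partial>M)" if i: "i \<in> I" for i
  proof -
    interpret sigma_finite_subalgebra M "F i" by (rule sigma_fin[OF i])
    show ?thesis using nn_cond_exp_intg[of "\<lambda>_. 1" "A i"] i by simp
  qed
  \<comment> \<open>Finite mixed moments make \<open>q\<close> finite, which is what permits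
    cancelling it at the end.\<close>
  have BB: "(\<integral>\<^sup>+x. B i x * B j x \<partial>M) < \<infinity>" if i: "i \<in> I" and j: "j \<in> I" for i j
  proof -
    have "(\<integral>\<^sup>+x. B i x * B j x \<partial>M) \<le> (\<integral>\<^sup>+x. c * B j x \<partial>M)"
      using B_le[OF i] unfolding B_def by (intro nn_integral_mono_AE) (auto elim!: eventually_mono intro!: mult_right_mono)
    also have "\<dots> = c * (\<integral>\<^sup>+x. A j x \<partial>M)"
      using int_B[OF j] by (simp add: nn_integral_cmult B_def)
    also have "\<dots> < \<infinity>"
      using int[OF j] bounded(2) by (simp add: ennreal_mult_less_top)
    finally show ?thesis .
  qed
  have BA: "(\<integral>\<^sup>+x. B j x * B i x \<partial>M) = (\<integral>\<^sup>+x. B j x * A i x \<partial>M)"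
    if i: "i \<in> I" and j: "j \<in> I" and R: "R j i" for i j
  proof -
    interpret sigma_finite_subalgebra M "F i" by (rule sigma_fin[OF i])
    interpret j: sigma_finite_subalgebra M "F j" by (rule sigma_fin[OF j])
    have "subalgebra (F i) (F j)"
      using mono[OF j i R] subalg j.subalg by (auto simp: subalgebra_def)
    then have "B j \<in> borel_measurable (F i)"
      unfolding B_def by (rule measurable_from_subalg) simp
    then show ?thesis
      using nn_cond_exp_intg[of "B j" "A i"] i unfolding B_def by simp
  qed
  have square_sum: "(\<Sum>i\<in>I. h i)\<^sup>2 = (\<Sum>i\<in>I. \<Sum>j\<in>I. h i * h j)" for h :: "'i \<Rightarrow> ennreal"
    by (simp add: power2_eq_square sum_product)
  define Q where "Q x = (\<Sum>i\<in>I. B i x)" for x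
  define S where "S x = (\<Sum>i\<in>I. A i x)" for x
  have [measurable]: "Q \<in> borel_measurable M" "S \<in> borel_measurable M"
    unfolding Q_def[abs_def] S_def[abs_def] by measurable
  define q where "q = (\<integral>\<^sup>+x. (Q x)\<^sup>2 \<partial>M)"
  have q: "q = (\<Sum>i\<in>I. \<Sum>j\<in>I. \<integral>\<^sup>+x. B i x * B j x \<partial>M)"
    unfolding q_def Q_def square_sum by (simp add: nn_integral_sum)
  have "q < \<infinity>"
    unfolding q using fin BB by (simp add: less_top)
  let ?T = "\<Sum>i\<in>I. \<Sum>j\<in>I. if R j i then \<integral>\<^sup>+x. B j x * B i x \<partial>M else 0"
  \<comment> \<open>Pairs related both ways, in particular diagonal ones, are counted twice; hence
    an inequality.\<close>
  have "q \<le> (\<Sum>i\<in>I. \<Sum>j\<in>I. (if R j i then \<integral>\<^sup>+x. B j x * B i x \<partial>M else 0)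
      + (if R i j then \<integral>\<^sup>+x. B i x * B j x \<partial>M else 0))"
    unfolding q using total by (intro sum_mono) (auto simp: mult.commute)
  also have "\<dots> = ?T
      + (\<Sum>i\<in>I. \<Sum>j\<in>I. if R i j then \<integral>\<^sup>+x. B i x * B j x \<partial>M else 0)"
    by (simp add: sum.distrib)
  also have "(\<Sum>i\<in>I. \<Sum>j\<in>I. if R i j then \<integral>\<^sup>+x. B i x * B j x \<partial>M else 0)
      = ?T"
    by (rule sum.swap)
  also have "?T + \<dots>
      = 2 * ?T"
    by (simp only: mult_2)
  also have "\<dots> \<le> 2 * (\<Sum>i\<in>I. \<Sum>j\<in>I. \<integral>\<^sup>+x. A i x * B j x \<partial>M)"
    using BA by (intro mult_left_mono sum_mono) (auto simp: mult.commute)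
  also have "\<dots> = 2 * (\<integral>\<^sup>+x. S x * Q x \<partial>M)"
    unfolding S_def Q_def by (simp add: sum_product nn_integral_sum)
  finally have le: "q \<le> 2 * (\<integral>\<^sup>+x. S x * Q x \<partial>M)" .
  have "q * q \<le> 4 * (\<integral>\<^sup>+x. S x * Q x \<partial>M)\<^sup>2"
    using mult_mono[OF le le] by (simp add: power2_eq_square algebra_simps)
  also have "\<dots> \<le> 4 * ((\<integral>\<^sup>+x. (S x)\<^sup>2 \<partial>M) * q)"
    unfolding q_def by (intro mult_left_mono Cauchy_Schwarz_nn_integral) auto
  finally have "q * q \<le> (4 * (\<integral>\<^sup>+x. (S x)\<^sup>2 \<partial>M)) * q"
    by (simp only: mult.assoc)
  then have "q * q \<le> q * (4 * (\<integral>\<^sup>+x. (S x)\<^sup>2 \<partial>M))"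
    by (metis mult.commute)
  then have "q \<le> 4 * (\<integral>\<^sup>+x. (S x)\<^sup>2 \<partial>M)"
    using \<open>q < \<infinity>\<close> ennreal_mult_le_mult_iff[of q q] by (cases "q = 0") auto
  then show "(\<integral>\<^sup>+x. (\<Sum>i\<in>I. nn_cond_exp M (F i) (A i) x)\<^sup>2 \<partial>M) \<le> 4 * (\<integral>\<^sup>+x. (\<Sum>i\<in>I. A i x)\<^sup>2 \<partial>M)"
    by (simp add: q_def Q_def S_def B_def)
qed

subsection \<open>Brownian motion\<close>

abbreviation paths :: "'i set \<Rightarrow> ('i \<Rightarrow> 'b::topological_space) measure" where
  "paths I \<equiv> Pi\<^sub>M I (\<lambda>_. borel)"

lemma brownian_motionD:
  fixes X :: "real \<Rightarrow> 'w \<Rightarrow> real ^ 'd::finite"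
  assumes "brownian_motion P X"
  shows "prob_space P" "0 \<le> t \<Longrightarrow> X t \<in> borel_measurable P"
    and "w \<in> space P \<Longrightarrow> X 0 w = 0"
    and "w \<in> space P \<Longrightarrow> continuous_on {0..} (\<lambda>t. X t w)"
    and "0 \<le> s \<Longrightarrow> s < t \<Longrightarrow> distributed P lborel (\<lambda>w. X t w - X s w) (\<lambda>x. ennreal (heat (t - s) x))"
  using assms by (auto simp: brownian_motion_def heat_def[abs_def])

text \<open>Increments will be followed in both time directions; evenness of the kernel reduces
  \<open>t < s\<close> to a forward increment.\<close>

lemma brownian_heat:
  fixes X :: "real \<Rightarrow> 'w \<Rightarrow> real ^ 'd::finite"
  assumes B: "brownian_motion P X" and "0 \<le> s" "0 \<le> t" "0 < r"
  shows "(\<integral>\<^sup>+w. heat r (z + (X t w - X s w)) \<partial>P) = heat (r + \<bar>t - s\<bar>) z"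
proof -
  interpret prob_space P by (rule brownian_motionD[OF B])
  have *: "(\<integral>\<^sup>+w. heat r (z + (X t w - X s w)) \<partial>P) = heat (r + \<bar>t - s\<bar>) z"
    if "0 \<le> s" "s < t" for s t and z :: "real ^ 'd"
  proof -
    have "(\<integral>\<^sup>+w. heat r (z + (X t w - X s w)) \<partial>P)
      = (\<integral>\<^sup>+y. ennreal (heat (t - s) y) * ennreal (heat r (z + y)) \<partial>lborel)"
      by (rule distributed_nn_integral[OF brownian_motionD(5)[OF B that], symmetric]) simp
    also have "\<dots> = heat (r + (t - s)) z"
      using heat_convolution[of r "t - s" z] that assms by (simp add: mult.commute)
    finally show ?thesis using that by simp
  qed
  consider "s < t" | "s = t" | "t < s" by linarith
  then show ?thesis
  proof cases
    case 3
    have "heat r (z + (X t w - X s w)) = heat r (- z + (X s w - X t w))" for w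
      using heat_minus[of r "z + (X t w - X s w)"] by (simp add: algebra_simps)
    then show ?thesis
      using *[of t s "- z"] 3 assms by (simp add: heat_minus abs_minus_commute)
  qed (use * assms emeasure_space_1 in auto)
qed

text \<open>Everything is measured relative to the dividing time \<open>s\<close>, so past and
  future enter symmetrically, and the result can be used in both time directions. All times are
  sorted into one list; each difference telescopes into consecutive increments, and those before and
  after \<open>s\<close> are disjoint blocks of an independent family.\<close>

lemma brownian_increments_indep:
  fixes X :: "real \<Rightarrow> 'w \<Rightarrow> real ^ 'd::finite"
  assumes B: "brownian_motion P X" and fin: "finite A" "finite C"
    and A: "A \<subseteq> {0..s}" and C: "C \<subseteq> {s..}" and s: "0 \<le> s"
  shows "prob_space.indep_var P
    (paths A) (\<lambda>w. \<lambda>r\<in>A. X r w - X s w)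
    (paths C) (\<lambda>w. \<lambda>r\<in>C. X r w - X s w)"
proof -
  interpret prob_space P by (rule brownian_motionD[OF B])
  define L where "L = sorted_list_of_set (insert s (A \<union> C))"
  define n where "n = length L - 1"
  define \<tau> where "\<tau> k = L ! k" for k
  have set_L: "set L = insert s (A \<union> C)" and sd: "sorted_wrt (<) L"
    unfolding L_def using fin by (auto simp only: set_sorted_list_of_set finite_insert finite_Un sorted_list_of_set.strict_sorted_key_list_of_set)
  have len: "length L = Suc n"
    using set_L by (cases L) (auto simp: n_def)
  have less: "\<tau> j < \<tau> k" if "j < k" "k \<le> n" for j k
    using sorted_wrt_nth_less[OF sd that(1)] that len by (simp add: \<tau>_def)
  have ex: "\<exists>j\<le>n. r = \<tau> j" if "r \<in> insert s (A \<union> C)" for r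
    using that unfolding set_L[symmetric] in_set_conv_nth \<tau>_def len by (metis less_Suc_eq_le)
  define ix where "ix r = (SOME j. j \<le> n \<and> r = \<tau> j)" for r
  have ix: "ix r \<le> n" "\<tau> (ix r) = r" if "r \<in> insert s (A \<union> C)" for r
    using someI_ex[of "\<lambda>j. j \<le> n \<and> r = \<tau> j"] ex[OF that] unfolding ix_def by auto
  have ix_mono: "ix r \<le> ix r'" if "r \<le> r'" "r \<in> insert s (A \<union> C)" "r' \<in> insert s (A \<union> C)" for r r'
    using less[of "ix r'" "ix r"] ix[OF that(2)] ix[OF that(3)] that(1) by (simp add: not_le[symmetric]) (meson leI not_le)
  define \<Delta> where "\<Delta> k w = X (\<tau> (Suc k)) w - X (\<tau> k) w" for k w
  have meas_A: "(\<lambda>v. \<lambda>r\<in>A. - (\<Sum>k=ix r..<ix s. v k))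
      \<in> paths {..<ix s} \<rightarrow>\<^sub>M Pi\<^sub>M A (\<lambda>_. borel :: (real ^ 'd) measure)"
    by (intro measurable_restrict borel_measurable_uminus borel_measurable_sum measurable_component_singleton) auto
  have meas_C: "(\<lambda>v. \<lambda>r\<in>C. \<Sum>k=ix s..<ix r. v k)
      \<in> paths {ix s..<n} \<rightarrow>\<^sub>M Pi\<^sub>M C (\<lambda>_. borel :: (real ^ 'd) measure)"
    using ix(1) by (intro measurable_restrict borel_measurable_sum measurable_component_singleton) force
  have "0 \<le> \<tau> 0"
    using set_L A C s nth_mem[of 0 L] len by (auto simp: \<tau>_def)
  then have "indep_vars (\<lambda>_. borel) \<Delta> {..<n}"
    using B less unfolding brownian_motion_def \<Delta>_def by simp
  then have "indep_var (PiM {..<ix s} (\<lambda>_. borel)) (\<lambda>w. restrict (\<lambda>k. \<Delta> k w) {..<ix s})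
      (PiM {ix s..<n} (\<lambda>_. borel)) (\<lambda>w. restrict (\<lambda>k. \<Delta> k w) {ix s..<n})"
    using ix(1)[of s] by (intro indep_var_restrict) auto
  then have "indep_var (paths A) (\<lambda>w. \<lambda>r\<in>A. - (\<Sum>k=ix r..<ix s. restrict (\<lambda>k. \<Delta> k w) {..<ix s} k))
      (paths C) (\<lambda>w. \<lambda>r\<in>C. (\<Sum>k=ix s..<ix r. restrict (\<lambda>k. \<Delta> k w) {ix s..<n} k))"
    using indep_var_compose[OF _ meas_A meas_C] by (simp only: comp_def)
  moreover have "(\<lambda>r\<in>A. - (\<Sum>k=ix r..<ix s. restrict (\<lambda>k. \<Delta> k w) {..<ix s} k)) = (\<lambda>r\<in>A. X r w - X s w)" for w
  proof (rule restrict_ext)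
    fix r assume r: "r \<in> A"
    then have "ix r \<le> ix s" using A by (intro ix_mono) auto
    have "(\<Sum>k=ix r..<ix s. restrict (\<lambda>k. \<Delta> k w) {..<ix s} k) = (\<Sum>k=ix r..<ix s. X (\<tau> (Suc k)) w - X (\<tau> k) w)"
      by (intro sum.cong) (auto simp: \<Delta>_def)
    also have "\<dots> = X s w - X r w"
      using sum_Suc_diff'[OF \<open>ix r \<le> ix s\<close>, of "\<lambda>k. X (\<tau> k) w"] ix(2) r by simp
    finally show "- (\<Sum>k=ix r..<ix s. restrict (\<lambda>k. \<Delta> k w) {..<ix s} k) = X r w - X s w" by simp
  qed
  moreover have "(\<lambda>r\<in>C. (\<Sum>k=ix s..<ix r. restrict (\<lambda>k. \<Delta> k w) {ix s..<n} k)) = (\<lambda>r\<in>C. X r w - X s w)" for w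
  proof (rule restrict_ext)
    fix r assume r: "r \<in> C"
    then have "ix s \<le> ix r" using C by (intro ix_mono) auto
    have "ix r \<le> n" using ix(1) r by simp
    then have "(\<Sum>k=ix s..<ix r. restrict (\<lambda>k. \<Delta> k w) {ix s..<n} k) = (\<Sum>k=ix s..<ix r. X (\<tau> (Suc k)) w - X (\<tau> k) w)"
      by (intro sum.cong) (auto simp: \<Delta>_def)
    also have "\<dots> = X r w - X s w"
      using sum_Suc_diff'[OF \<open>ix s \<le> ix r\<close>, of "\<lambda>k. X (\<tau> k) w"] ix(2) r by simp
    finally show "(\<Sum>k=ix s..<ix r. restrict (\<lambda>k. \<Delta> k w) {ix s..<n} k) = X r w - X s w" .
  qed
  ultimately show ?thesis by simp
qed

lemma indep_processes_restrict:
  assumes "indep_processes P X Y" "G \<subseteq> {0..}" "G' \<subseteq> {0..}" "prob_space P"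
  shows "prob_space.indep_var P
    (paths G) (\<lambda>w. \<lambda>r\<in>G. X r w) (paths G') (\<lambda>w. \<lambda>t\<in>G'. Y t w)"
proof -
  interpret prob_space P by fact
  have "(\<lambda>w. restrict (\<lambda>t\<in>{0..}. X t w) G) = (\<lambda>w. \<lambda>r\<in>G. X r w)"
    "(\<lambda>w. restrict (\<lambda>t\<in>{0..}. Y t w) G') = (\<lambda>w. \<lambda>r\<in>G'. Y r w)"
    using assms by (auto simp: fun_eq_iff restrict_def)
  then show ?thesis
    using indep_var_compose[OF assms(1)[unfolded indep_processes_def]
      measurable_restrict_subset[OF assms(2)] measurable_restrict_subset[OF assms(3)]]
    by (simp add: comp_def)
qed

lemma (in prob_space) indep_var_sym:
  assumes "indep_var S X T Y"
  shows "indep_var T Y S X"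
proof -
  have rv: "random_variable S X" "random_variable T Y"
    using assms by (rule indep_var_rv1, rule indep_var_rv2)
  interpret X: prob_space "distr M S X" by (rule prob_space_distr[OF rv(1)])
  interpret Y: prob_space "distr M T Y" by (rule prob_space_distr[OF rv(2)])
  interpret pair_sigma_finite "distr M T Y" "distr M S X" ..
  have "distr M T Y \<Otimes>\<^sub>M distr M S X = distr (distr M S X \<Otimes>\<^sub>M distr M T Y) (T \<Otimes>\<^sub>M S) (\<lambda>(x, y). (y, x))"
    by (subst distr_pair_swap) (intro distr_cong sets_pair_measure_cong, simp_all)
  also have "\<dots> = distr (distr M (S \<Otimes>\<^sub>M T) (\<lambda>w. (X w, Y w))) (T \<Otimes>\<^sub>M S) (\<lambda>(x, y). (y, x))"
    using assms unfolding indep_var_distribution_eq by simp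
  also have "\<dots> = distr M (T \<Otimes>\<^sub>M S) (\<lambda>w. (Y w, X w))"
    using rv by (subst distr_distr) (auto simp: comp_def)
  finally show ?thesis
    unfolding indep_var_distribution_eq using rv by blast
qed

text \<open>For \<open>R = (\<ge>)\<close> the times after \<open>s\<close> are the known ones and
  \<open>s'\<close> lies before \<open>s\<close>. In either direction the increment towards
  \<open>s'\<close> is independent of the known ones, and integrating it out convolves the kernel
  with its density.\<close>

lemma brownian_increment_heat:
  fixes X :: "real \<Rightarrow> 'w \<Rightarrow> real ^ 'd::finite" and f :: "(real \<Rightarrow> real ^ 'd) \<Rightarrow> ennreal"
  assumes B: "brownian_motion P X" and G: "finite G" "G \<subseteq> {0..}"
    and s: "0 \<le> s" "0 \<le> s'" and R: "R = (\<le>) \<or> R = (\<ge>)" and "R s s'"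
    and f [measurable]: "f \<in> borel_measurable (paths {r\<in>G. R r s})" and r: "0 < r"
  shows "(\<integral>\<^sup>+w. f (\<lambda>r\<in>{r\<in>G. R r s}. X r w - X s w) * heat r (z + (X s' w - X s w)) \<partial>P)
    = (\<integral>\<^sup>+w. f (\<lambda>r\<in>{r\<in>G. R r s}. X r w - X s w) \<partial>P) * heat (r + \<bar>s' - s\<bar>) z"
proof -
  interpret prob_space P by (rule brownian_motionD[OF B])
  have X [measurable]: "0 \<le> t \<Longrightarrow> X t \<in> borel_measurable P" for t by (rule brownian_motionD[OF B])
  let ?W = "\<lambda>w. \<lambda>r\<in>{r\<in>G. R r s}. X r w - X s w" and ?D = "\<lambda>w. \<lambda>r\<in>{s'}. X r w - X s w"
  have ind: "indep_var (paths {r\<in>G. R r s}) ?W (paths {s'}) ?D"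
    using R
  proof
    assume "R = (\<le>)"
    then show ?thesis using \<open>R s s'\<close> G s by (intro brownian_increments_indep[OF B]) auto
  next
    assume "R = (\<ge>)"
    then show ?thesis using \<open>R s s'\<close> G s by (intro indep_var_sym[OF brownian_increments_indep[OF B]]) auto
  qed
  have [measurable]: "?W \<in> measurable P (paths {r\<in>G. R r s})"
    by (rule indep_var_rv1[OF ind])
  have "(\<integral>\<^sup>+w. f (?W w) * heat r (z + ?D w s') \<partial>P)
    = (\<integral>\<^sup>+w. \<integral>\<^sup>+w'. f (?W w) * heat r (z + ?D w' s') \<partial>P \<partial>P)"
    by (rule indep_var_nn_integral[OF ind, of "\<lambda>\<theta> d. f \<theta> * heat r (z + d s')"]) measurable
  also have "\<dots> = (\<integral>\<^sup>+w. f (?W w) * heat (r + \<bar>s' - s\<bar>) z \<partial>P)"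
  proof (rule nn_integral_cong)
    fix w
    have "(\<integral>\<^sup>+w'. f (?W w) * heat r (z + ?D w' s') \<partial>P) = f (?W w) * (\<integral>\<^sup>+w'. heat r (z + (X s' w' - X s w')) \<partial>P)"
      using s by (simp add: nn_integral_cmult)
    then show "(\<integral>\<^sup>+w'. f (?W w) * heat r (z + ?D w' s') \<partial>P) = f (?W w) * heat (r + \<bar>s' - s\<bar>) z"
      using brownian_heat[OF B s r] by simp
  qed
  also have "\<dots> = (\<integral>\<^sup>+w. f (?W w) \<partial>P) * heat (r + \<bar>s' - s\<bar>) z"
    by (simp add: nn_integral_multc)
  finally show ?thesis by simp
qed

subsection \<open>Fields with a Lebesgue distributed starting point\<close>

text \<open>The two Brownian motions are reduced to the properties that the quadrant estimates use,
  so that exchanging the parameters gives an instance again. By \<open>law\<close>, the triple of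
  \<open>V\<close>, \<open>\<xi>\<close> and \<open>\<eta>\<close> has under \<open>M\<close> the
  product law of Lebesgue measure and the two path laws under \<open>P\<close>; in particular
  \<open>M\<close> has infinite mass.\<close>

locale lebesgue_field =
  fixes P M :: "'w measure" and V :: "'w \<Rightarrow> real ^ 'd::finite"
    and \<xi> \<eta> :: "real \<Rightarrow> 'w \<Rightarrow> real ^ 'd" and G G' :: "real set"
  assumes prob_P: "prob_space P" and sets_M [measurable_cong]: "sets M = sets P"
    and V [measurable]: "V \<in> borel_measurable P"
    and \<xi> [measurable]: "\<And>s. s \<in> G \<Longrightarrow> \<xi> s \<in> borel_measurable P"
    and \<eta> [measurable]: "\<And>t. t \<in> G' \<Longrightarrow> \<eta> t \<in> borel_measurable P"
    and finite_G: "finite G" "finite G'"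
    and law: "\<And>g :: (real ^ 'd) \<times> (real \<Rightarrow> real ^ 'd) \<times> (real \<Rightarrow> real ^ 'd) \<Rightarrow> ennreal.
      g \<in> borel_measurable (borel \<Otimes>\<^sub>M paths G \<Otimes>\<^sub>M paths G') \<Longrightarrow>
      (\<integral>\<^sup>+w. g (V w, \<lambda>r\<in>G. \<xi> r w, \<lambda>t\<in>G'. \<eta> t w) \<partial>M)
        = (\<integral>\<^sup>+x. \<integral>\<^sup>+w. \<integral>\<^sup>+w'. g (x, \<lambda>r\<in>G. \<xi> r w, \<lambda>t\<in>G'. \<eta> t w') \<partial>P \<partial>P \<partial>lborel)"
    and increment_\<xi>: "\<And>R s s' (f :: (real \<Rightarrow> real ^ 'd) \<Rightarrow> ennreal) z r.
      R = (\<le>) \<or> R = (\<ge>) \<Longrightarrow> s \<in> G \<Longrightarrow> s' \<in> G \<Longrightarrow> R s s' \<Longrightarrow>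
      f \<in> borel_measurable (paths {r\<in>G. R r s}) \<Longrightarrow> 0 < r \<Longrightarrow>
      (\<integral>\<^sup>+w. f (\<lambda>r\<in>{r\<in>G. R r s}. \<xi> r w - \<xi> s w) * heat r (z + (\<xi> s' w - \<xi> s w)) \<partial>P)
        = (\<integral>\<^sup>+w. f (\<lambda>r\<in>{r\<in>G. R r s}. \<xi> r w - \<xi> s w) \<partial>P) * heat (r + \<bar>s' - s\<bar>) z"
    and increment_\<eta>: "\<And>R s s' (f :: (real \<Rightarrow> real ^ 'd) \<Rightarrow> ennreal) z r.
      R = (\<le>) \<or> R = (\<ge>) \<Longrightarrow> s \<in> G' \<Longrightarrow> s' \<in> G' \<Longrightarrow> R s s' \<Longrightarrow>
      f \<in> borel_measurable (paths {r\<in>G'. R r s}) \<Longrightarrow> 0 < r \<Longrightarrow>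
      (\<integral>\<^sup>+w. f (\<lambda>r\<in>{r\<in>G'. R r s}. \<eta> r w - \<eta> s w) * heat r (z + (\<eta> s' w - \<eta> s w)) \<partial>P)
        = (\<integral>\<^sup>+w. f (\<lambda>r\<in>{r\<in>G'. R r s}. \<eta> r w - \<eta> s w) \<partial>P) * heat (r + \<bar>s' - s\<bar>) z"
begin

sublocale P: prob_space P by (rule prob_P)
sublocale PP: pair_sigma_finite P P ..
sublocale LP: pair_sigma_finite lborel P ..

text \<open>Statements proved for the first parameter thereby hold for the second, which allows
  conditioning on the two parameters one after the other.\<close>

lemma swap: "lebesgue_field P M V \<eta> \<xi> G' G"
proof
  fix g :: "(real ^ 'd) \<times> (real \<Rightarrow> real ^ 'd) \<times> (real \<Rightarrow> real ^ 'd) \<Rightarrow> ennreal"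
  assume [measurable]: "g \<in> borel_measurable (borel \<Otimes>\<^sub>M paths G' \<Otimes>\<^sub>M paths G)"
  have "(\<integral>\<^sup>+w. g (V w, \<lambda>t\<in>G'. \<eta> t w, \<lambda>r\<in>G. \<xi> r w) \<partial>M)
    = (\<integral>\<^sup>+x. \<integral>\<^sup>+w. \<integral>\<^sup>+w'. g (x, \<lambda>t\<in>G'. \<eta> t w', \<lambda>r\<in>G. \<xi> r w) \<partial>P \<partial>P \<partial>lborel)"
    using law[of "\<lambda>(x, u, v). g (x, v, u)"] by simp
  also have "\<dots> = (\<integral>\<^sup>+x. \<integral>\<^sup>+w'. \<integral>\<^sup>+w. g (x, \<lambda>t\<in>G'. \<eta> t w', \<lambda>r\<in>G. \<xi> r w) \<partial>P \<partial>P \<partial>lborel)"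
    by (intro nn_integral_cong PP.Fubini') measurable
  finally show "(\<integral>\<^sup>+w. g (V w, \<lambda>t\<in>G'. \<eta> t w, \<lambda>r\<in>G. \<xi> r w) \<partial>M)
    = (\<integral>\<^sup>+x. \<integral>\<^sup>+w'. \<integral>\<^sup>+w. g (x, \<lambda>t\<in>G'. \<eta> t w', \<lambda>r\<in>G. \<xi> r w) \<partial>P \<partial>P \<partial>lborel)" .
qed (use sets_M finite_G increment_\<xi> increment_\<eta> in auto)

text \<open>Lebesgue measure is invariant under the random translation by \<open>\<xi> s\<close>. So
  \<open>V + \<xi> s\<close> is Lebesgue distributed too and, in the product sense, independent of
  the increments relative to \<open>s\<close>: every time \<open>s\<close> can serve as the starting
  time. The Fubini steps bring the integral over \<open>x\<close> innermost, translate it, and move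
  it out again.\<close>

lemma law_shift:
  fixes g :: "real ^ 'd \<Rightarrow> (real \<Rightarrow> real ^ 'd) \<Rightarrow> (real \<Rightarrow> real ^ 'd) \<Rightarrow> ennreal"
  assumes s [measurable]: "s \<in> G"
    and [measurable]: "(\<lambda>(x, u, v). g x u v) \<in> borel_measurable (borel \<Otimes>\<^sub>M paths G \<Otimes>\<^sub>M paths G')"
  shows "(\<integral>\<^sup>+w. g (V w + \<xi> s w) (\<lambda>r\<in>G. \<xi> r w - \<xi> s w) (\<lambda>t\<in>G'. \<eta> t w) \<partial>M)
    = (\<integral>\<^sup>+w'. \<integral>\<^sup>+x. \<integral>\<^sup>+w. g x (\<lambda>r\<in>G. \<xi> r w - \<xi> s w) (\<lambda>t\<in>G'. \<eta> t w') \<partial>P \<partial>lborel \<partial>P)"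
proof -
  let ?u = "\<lambda>w. \<lambda>r\<in>G. \<xi> r w - \<xi> s w" and ?v = "\<lambda>w. \<lambda>t\<in>G'. \<eta> t w"
  let ?g = "\<lambda>(x, u, v). g (x + u s) (\<lambda>r\<in>G. u r - u s) v"
  have meas_g: "(\<lambda>\<theta>. g (a \<theta>) (b \<theta>) (c \<theta>)) \<in> borel_measurable N"
    if "a \<in> borel_measurable N" "b \<in> measurable N (paths G)" "c \<in> measurable N (paths G')"
    for a b c and N :: "'x measure"
    using measurable_compose[OF measurable_Pair[OF that(1) measurable_Pair[OF that(2,3)]] assms(2)] by simp
  have g': "?g \<in> borel_measurable (borel \<Otimes>\<^sub>M paths G \<Otimes>\<^sub>M paths G')"
    unfolding split_beta using s
    by (intro meas_g borel_measurable_add measurable_restrict borel_measurable_diff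
        measurable_compose[OF measurable_compose[OF measurable_snd measurable_fst] measurable_component_singleton]) measurable
  have 1: "(\<lambda>r\<in>G. (\<lambda>r\<in>G. \<xi> r w) r - (\<lambda>r\<in>G. \<xi> r w) s) = (?u w)" for w
    using s by (auto intro: restrict_ext)
  have "(\<integral>\<^sup>+w. g (V w + \<xi> s w) (?u w) (?v w) \<partial>M)
    = (\<integral>\<^sup>+x. \<integral>\<^sup>+w. \<integral>\<^sup>+w'. g (x + \<xi> s w) (?u w) (?v w') \<partial>P \<partial>P \<partial>lborel)"
    using law[OF g'] s unfolding split_beta fst_conv snd_conv 1 by simp
  also have "\<dots> = (\<integral>\<^sup>+x. \<integral>\<^sup>+w'. \<integral>\<^sup>+w. g (x + \<xi> s w) (?u w) (?v w') \<partial>P \<partial>P \<partial>lborel)"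
    by (rule nn_integral_cong, rule PP.Fubini')
      (unfold split_beta, use s in \<open>intro meas_g borel_measurable_add measurable_restrict borel_measurable_diff; measurable\<close>)
  also have "\<dots> = (\<integral>\<^sup>+w'. \<integral>\<^sup>+x. \<integral>\<^sup>+w. g (x + \<xi> s w) (?u w) (?v w') \<partial>P \<partial>lborel \<partial>P)"
    by (rule LP.Fubini'[symmetric])
      (unfold split_beta, intro P.borel_measurable_nn_integral, unfold split_beta, use s in \<open>intro meas_g borel_measurable_add measurable_restrict borel_measurable_diff; measurable\<close>)
  also have "\<dots> = (\<integral>\<^sup>+w'. \<integral>\<^sup>+w. \<integral>\<^sup>+x. g (x + \<xi> s w) (?u w) (?v w') \<partial>lborel \<partial>P \<partial>P)"
    by (rule nn_integral_cong, rule LP.Fubini'[symmetric])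
      (unfold split_beta, use s in \<open>intro meas_g borel_measurable_add measurable_restrict borel_measurable_diff; measurable\<close>)
  also have "\<dots> = (\<integral>\<^sup>+w'. \<integral>\<^sup>+w. \<integral>\<^sup>+x. g x (?u w) (?v w') \<partial>lborel \<partial>P \<partial>P)"
    by (rule nn_integral_cong, rule nn_integral_cong, rule nn_integral_lborel_translation)
      (use s in \<open>intro meas_g borel_measurable_add measurable_restrict borel_measurable_diff; measurable\<close>)
  also have "\<dots> = (\<integral>\<^sup>+w'. \<integral>\<^sup>+x. \<integral>\<^sup>+w. g x (?u w) (?v w') \<partial>P \<partial>lborel \<partial>P)"
    by (rule nn_integral_cong, rule LP.Fubini')
      (unfold split_beta, use s in \<open>intro meas_g borel_measurable_add measurable_restrict borel_measurable_diff; measurable\<close>)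
  finally show ?thesis .
qed

definition Z :: "real \<Rightarrow> real \<Rightarrow> 'w \<Rightarrow> real ^ 'd" where
  "Z s t w = V w + \<xi> s w + \<eta> t w"

lemma borel_measurable_Z [measurable]: "s \<in> G \<Longrightarrow> t \<in> G' \<Longrightarrow> Z s t \<in> borel_measurable P"
  unfolding Z_def[abs_def] by measurable

text \<open>The whole path of the second motion is included. Hence \<open>Z s t'\<close> is known at
  \<open>s\<close> for every \<open>t'\<close> in \<open>G'\<close>, which lets the two parameters
  be treated in succession. With \<open>R = (\<ge>)\<close> the known times are those from
  \<open>s\<close> on.\<close>

definition past :: "(real \<Rightarrow> real \<Rightarrow> bool) \<Rightarrow> real \<Rightarrow> 'w \<Rightarrow> (real \<Rightarrow> real ^ 'd) \<times> (real \<Rightarrow> real ^ 'd)" where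
  "past R s w = (\<lambda>r\<in>{r\<in>G. R r s}. V w + \<xi> r w, \<lambda>t\<in>G'. \<eta> t w)"

definition F :: "(real \<Rightarrow> real \<Rightarrow> bool) \<Rightarrow> real \<Rightarrow> 'w measure" where
  "F R s = vimage_algebra (space M) (past R s) (paths {r\<in>G. R r s} \<Otimes>\<^sub>M paths G')"

lemma measurable_past: "past R s \<in> measurable M (paths {r\<in>G. R r s} \<Otimes>\<^sub>M paths G')"
  unfolding past_def[abs_def] by measurable

lemma measurable_F_past: "past R s \<in> measurable (F R s) (paths {r\<in>G. R r s} \<Otimes>\<^sub>M paths G')"
  unfolding F_def using measurable_past[of R s] by (intro measurable_vimage_algebra1) (auto dest: measurable_space)

lemma sets_F: "sets (F R s) = {past R s -` A \<inter> space M | A. A \<in> sets (paths {r\<in>G. R r s} \<Otimes>\<^sub>M paths G')}"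
  unfolding F_def using measurable_past[of R s] by (intro sets_vimage_algebra2) (auto dest: measurable_space)

lemma subalgebra_F: "subalgebra M (F R s)"
  using measurable_past[of R s] unfolding subalgebra_def sets_F by (auto simp: F_def dest: measurable_sets)

lemma Z_measurable_F:
  assumes "s \<in> G" "R s s" "t \<in> G'"
  shows "Z s t \<in> borel_measurable (F R s)"
proof -
  have "(\<lambda>w. fst (past R s w) s + snd (past R s w) t) \<in> borel_measurable (F R s)"
    using assms
    by (intro borel_measurable_add
        measurable_compose[OF measurable_compose[OF measurable_F_past measurable_fst] measurable_component_singleton]
        measurable_compose[OF measurable_compose[OF measurable_F_past measurable_snd] measurable_component_singleton]) auto
  then show ?thesis using assms by (simp add: past_def Z_def[abs_def])
qed

lemma F_mono:
  assumes "R s s'" "transp R"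
  shows "sets (F R s) \<subseteq> sets (F R s')"
proof -
  have past': "past R s' \<in> measurable (F R s') (paths {r\<in>G. R r s'} \<Otimes>\<^sub>M paths G')"
    by (rule measurable_F_past)
  have sub: "{r\<in>G. R r s} \<subseteq> {r\<in>G. R r s'}"
    using assms by (auto dest: transpD)
  have "past R s = (\<lambda>w. (restrict (fst (past R s' w)) {r\<in>G. R r s}, snd (past R s' w)))"
    using sub by (auto simp: past_def fun_eq_iff restrict_def)
  also have "\<dots> \<in> measurable (F R s') (paths {r\<in>G. R r s} \<Otimes>\<^sub>M paths G')"
    by (rule measurable_Pair[OF measurable_compose[OF measurable_fst'[OF past'] measurable_restrict_subset[OF sub]]
          measurable_snd'[OF past']])
  finally show ?thesis
    unfolding F_def[of R s] by (intro sets_image_in_sets) (simp_all add: F_def)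
qed

text \<open>In the coordinates \<open>x = V + \<xi> s\<close>, increments \<open>u\<close> relative
  to \<open>s\<close>, and \<open>v = \<eta>\<close>, the past is a function of \<open>x\<close>, of
  \<open>v\<close> and of the \<open>u r\<close> with \<open>R r s\<close>, while the step from
  \<open>s\<close> to \<open>s'\<close> only adds \<open>u s'\<close>. For fixed \<open>x\<close>
  and \<open>v\<close> this increment is integrated out.\<close>

lemma markov_past:
  fixes \<psi> :: "(real \<Rightarrow> real ^ 'd) \<times> (real \<Rightarrow> real ^ 'd) \<Rightarrow> ennreal"
  assumes R: "R = (\<le>) \<or> R = (\<ge>)" and s: "s \<in> G" "s' \<in> G" "R s s'" and t: "t \<in> G'" and r: "0 < r"
    and \<psi>: "\<psi> \<in> borel_measurable (paths {r\<in>G. R r s} \<Otimes>\<^sub>M paths G')"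
  shows "(\<integral>\<^sup>+w. \<psi> (past R s w) * heat r (Z s' t w - a) \<partial>M)
    = (\<integral>\<^sup>+w. \<psi> (past R s w) * heat (r + \<bar>s' - s\<bar>) (Z s t w - a) \<partial>M)"
proof -
  let ?u = "\<lambda>w. \<lambda>r\<in>G. \<xi> r w - \<xi> s w" and ?v = "\<lambda>w. \<lambda>t\<in>G'. \<eta> t w"
  let ?p = "\<lambda>x u. \<lambda>r\<in>{r\<in>G. R r s}. x + u r"
  have meas_\<psi>: "(\<lambda>\<theta>. \<psi> (b \<theta>, c \<theta>)) \<in> borel_measurable N"
    if "b \<in> measurable N (paths {r\<in>G. R r s})" "c \<in> measurable N (paths G')"
    for b c and N :: "'x measure"
    using measurable_compose[OF measurable_Pair[OF that] \<psi>] .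
  have comp: "(\<lambda>\<theta>. fst (snd \<theta>) q) \<in> borel_measurable (borel \<Otimes>\<^sub>M Pi\<^sub>M G (\<lambda>_. borel :: (real ^ 'd) measure) \<Otimes>\<^sub>M N)"
    "(\<lambda>\<theta>. snd (snd \<theta>) q') \<in> borel_measurable (borel \<Otimes>\<^sub>M N' \<Otimes>\<^sub>M Pi\<^sub>M G' (\<lambda>_. borel :: (real ^ 'd) measure))"
    if "q \<in> G" "q' \<in> G'" for q q' :: real and N :: "'x measure" and N' :: "'y measure"
    using that
    by (auto intro!: measurable_compose[OF measurable_compose[OF measurable_snd measurable_fst] measurable_component_singleton]
        measurable_compose[OF measurable_compose[OF measurable_snd measurable_snd] measurable_component_singleton])
  define g1 where "g1 x u v = \<psi> (?p x u, v) * ennreal (heat r (x + u s' + v t - a))" for x u v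
  define g2 where "g2 x u v = \<psi> (?p x u, v) * ennreal (heat (r + \<bar>s' - s\<bar>) (x + v t - a))"
    for x and u v :: "real \<Rightarrow> real ^ 'd"
  have Z_eq: "V w + \<xi> s w + (\<xi> s' w - \<xi> s w) + \<eta> t w - a = Z s' t w - a" for w
    by (simp add: Z_def)
  have p_eq: "?p (V w + \<xi> s w) (?u w) = fst (past R s w)" for w
    by (auto simp: past_def intro!: restrict_ext)
  have snd_past: "(?v w) = snd (past R s w)" for w
    by (simp add: past_def)
  have snd_t: "snd (past R s w) t = \<eta> t w" for w
    using t by (simp add: past_def)
  have g1m: "(\<lambda>(x, u, v). g1 x u v) \<in> borel_measurable (borel \<Otimes>\<^sub>M paths G \<Otimes>\<^sub>M paths G')"
    unfolding g1_def split_beta using s t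
    by (intro borel_measurable_times_ennreal meas_\<psi> measurable_restrict borel_measurable_add measurable_compose[OF _ measurable_ennreal]
        measurable_compose[OF _ borel_measurable_heat] borel_measurable_diff comp) (auto intro: measurable_compose[OF measurable_snd measurable_snd])
  have g2m: "(\<lambda>(x, u, v). g2 x u v) \<in> borel_measurable (borel \<Otimes>\<^sub>M paths G \<Otimes>\<^sub>M paths G')"
    unfolding g2_def split_beta using s t
    by (intro borel_measurable_times_ennreal meas_\<psi> measurable_restrict borel_measurable_add measurable_compose[OF _ measurable_ennreal]
        measurable_compose[OF _ borel_measurable_heat] borel_measurable_diff comp) (auto intro: measurable_compose[OF measurable_snd measurable_snd])
  have rest: "?p x (?u w) = ?p x (\<lambda>r\<in>{r\<in>G. R r s}. \<xi> r w - \<xi> s w)" for x w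
    by (auto intro!: restrict_ext)
  have inner: "(\<integral>\<^sup>+w. g1 x (?u w) (?v w') \<partial>P)
      = (\<integral>\<^sup>+w. g2 x (?u w) (?v w') \<partial>P)" if "w' \<in> space P" for x w'
  proof -
    define f where "f u = \<psi> (?p x u, \<lambda>t\<in>G'. \<eta> t w')" for u
    have f: "f \<in> borel_measurable (paths {r\<in>G. R r s})"
      unfolding f_def by (intro meas_\<psi> measurable_restrict borel_measurable_add) (auto simp: space_PiM)
    have fm: "(\<lambda>w. f (\<lambda>r\<in>{r\<in>G. R r s}. \<xi> r w - \<xi> s w)) \<in> borel_measurable P"
      using s by (intro measurable_compose[OF _ f] measurable_restrict) auto
    have "(\<integral>\<^sup>+w. g1 x (?u w) (?v w') \<partial>P)
      = (\<integral>\<^sup>+w. f (\<lambda>r\<in>{r\<in>G. R r s}. \<xi> r w - \<xi> s w) * heat r ((x + \<eta> t w' - a) + (\<xi> s' w - \<xi> s w)) \<partial>P)"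
      using s t unfolding g1_def f_def rest by (simp add: algebra_simps)
    also have "\<dots> = (\<integral>\<^sup>+w. f (\<lambda>r\<in>{r\<in>G. R r s}. \<xi> r w - \<xi> s w) \<partial>P) * heat (r + \<bar>s' - s\<bar>) (x + \<eta> t w' - a)"
      by (rule increment_\<xi>[OF R s f r])
    also have "\<dots> = (\<integral>\<^sup>+w. f (\<lambda>r\<in>{r\<in>G. R r s}. \<xi> r w - \<xi> s w) * heat (r + \<bar>s' - s\<bar>) (x + \<eta> t w' - a) \<partial>P)"
      using fm by (simp add: nn_integral_multc)
    also have "\<dots> = (\<integral>\<^sup>+w. g2 x (?u w) (?v w') \<partial>P)"
      using s t unfolding g2_def f_def rest by simp
    finally show ?thesis .
  qed
  have "(\<integral>\<^sup>+w. \<psi> (past R s w) * heat r (Z s' t w - a) \<partial>M)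
    = (\<integral>\<^sup>+w. g1 (V w + \<xi> s w) (?u w) (?v w) \<partial>M)"
    using s t Z_eq snd_t unfolding g1_def p_eq by (simp add: snd_past restrict_apply algebra_simps)
  also have "\<dots> = (\<integral>\<^sup>+w. g2 (V w + \<xi> s w) (?u w) (?v w) \<partial>M)"
    unfolding law_shift[OF s(1) g1m] law_shift[OF s(1) g2m] using inner by (simp cong: nn_integral_cong)
  also have "\<dots> = (\<integral>\<^sup>+w. \<psi> (past R s w) * heat (r + \<bar>s' - s\<bar>) (Z s t w - a) \<partial>M)"
    using s t snd_t unfolding g2_def p_eq by (simp add: snd_past restrict_apply Z_def)
  finally show ?thesis .
qed

end

lemma four_squares_ennreal:
  fixes a b c d x :: ennreal
  assumes "a\<^sup>2 \<le> x" "b\<^sup>2 \<le> x" "c\<^sup>2 \<le> x" "d\<^sup>2 \<le> x"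
  shows "(a + b + c + d)\<^sup>2 \<le> 16 * x"
proof -
  define m where "m = max (max a b) (max c d)"
  have "m\<^sup>2 \<le> x" using assms by (auto simp: m_def max_def)
  have "a + b + c + d \<le> m + m + m + m"
    unfolding m_def by (intro add_mono) (simp_all add: le_max_iff_disj)
  also have "\<dots> = 4 * m"
  proof -
    have "(4 :: ennreal) = 1 + 1 + 1 + 1" by simp
    then show ?thesis by (simp only: distrib_right mult_1)
  qed
  finally have "(a + b + c + d)\<^sup>2 \<le> (4 * m)\<^sup>2" by (rule power_mono_ennreal)
  also have "\<dots> \<le> 16 * x"
    using \<open>m\<^sup>2 \<le> x\<close> by (simp add: power_mult_distrib mult_left_mono)
  finally show ?thesis .
qed

section \<open>The Markov property and conditioning on the pasts\<close>

context lebesgue_field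
begin

text \<open>Instead of factoring \<open>\<phi>\<close> through the past, the two heat kernels are
  read as densities. By \<open>markov_past\<close> for indicators the resulting measures agree on
  \<open>F R s\<close>, so they integrate every \<open>F R s\<close>-measurable weight
  alike.\<close>

lemma markov_F:
  fixes \<phi> :: "'w \<Rightarrow> ennreal"
  assumes R: "R = (\<le>) \<or> R = (\<ge>)" and s: "s \<in> G" "s' \<in> G" "R s s'" and t: "t \<in> G'" and r: "0 < r"
    and \<phi>: "\<phi> \<in> borel_measurable (F R s)"
  shows "(\<integral>\<^sup>+w. \<phi> w * heat r (Z s' t w - a) \<partial>M) = (\<integral>\<^sup>+w. \<phi> w * heat (r + \<bar>s' - s\<bar>) (Z s t w - a) \<partial>M)"
proof -
  let ?D1 = "density M (\<lambda>w. ennreal (heat r (Z s' t w - a)))"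
  let ?D2 = "density M (\<lambda>w. ennreal (heat (r + \<bar>s' - s\<bar>) (Z s t w - a)))"
  note [measurable] = s(1,2) t
  have sub: "subalgebra ?D1 (F R s)" "subalgebra ?D2 (F R s)"
    using subalgebra_F[of R s] by (auto simp: subalgebra_def)
  have \<phi>M [measurable]: "\<phi> \<in> borel_measurable M"
    by (rule measurable_from_subalg[OF subalgebra_F \<phi>])
  have "restr_to_subalg ?D1 (F R s) = restr_to_subalg ?D2 (F R s)"
  proof (rule measure_eqI)
    fix B assume "B \<in> sets (restr_to_subalg ?D1 (F R s))"
    then have B: "B \<in> sets (F R s)"
      using sub by (simp add: sets_restr_to_subalg)
    then obtain C where C: "C \<in> sets (paths {r\<in>G. R r s} \<Otimes>\<^sub>M paths G')"
      and BC: "B = past R s -` C \<inter> space M"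
      unfolding sets_F by blast
    have [measurable]: "B \<in> sets M"
      using B subalgebra_F[of R s] by (auto simp: subalgebra_def)
    have ind: "indicator C (past R s w) = (indicator B w :: ennreal)" if "w \<in> space M" for w
      using that by (auto simp: BC indicator_def)
    have "emeasure ?D1 B = (\<integral>\<^sup>+w. (indicator C (past R s w) :: ennreal) * heat r (Z s' t w - a) \<partial>M)"
      by (subst emeasure_density) (auto simp: ind mult.commute intro!: nn_integral_cong)
    also have "\<dots> = (\<integral>\<^sup>+w. (indicator C (past R s w) :: ennreal) * heat (r + \<bar>s' - s\<bar>) (Z s t w - a) \<partial>M)"
      by (rule markov_past[OF R s t r]) (use C in simp)
    also have "\<dots> = emeasure ?D2 B"
      by (subst emeasure_density) (auto simp: ind mult.commute intro!: nn_integral_cong)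
    finally show "emeasure (restr_to_subalg ?D1 (F R s)) B = emeasure (restr_to_subalg ?D2 (F R s)) B"
      using B sub by (simp add: emeasure_restr_to_subalg)
  qed (use sub in \<open>simp add: sets_restr_to_subalg\<close>)
  moreover have "(\<integral>\<^sup>+w. \<phi> w * heat r (Z s' t w - a) \<partial>M) = (\<integral>\<^sup>+w. \<phi> w \<partial>restr_to_subalg ?D1 (F R s))"
    using sub(1) \<phi> by (subst nn_integral_subalgebra2) (auto simp: nn_integral_density mult.commute)
  moreover have "(\<integral>\<^sup>+w. \<phi> w * heat (r + \<bar>s' - s\<bar>) (Z s t w - a) \<partial>M) = (\<integral>\<^sup>+w. \<phi> w \<partial>restr_to_subalg ?D2 (F R s))"
    using sub(2) \<phi> by (subst nn_integral_subalgebra2) (auto simp: nn_integral_density mult.commute)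
  ultimately show ?thesis by simp
qed

text \<open>Conditional expectations require \<sigma>-finiteness on the small \<sigma>-algebra. The
  position \<open>V + \<xi> s\<close> is known in the past of \<open>s\<close>, by
  \<open>R s s\<close>, and is Lebesgue distributed; so the preimages of balls have finite measure
  and exhaust the space.\<close>

lemma sigma_finite_F:
  assumes s: "s \<in> G" "R s s"
  shows "sigma_finite_subalgebra M (F R s)"
proof
  show "subalgebra M (F R s)" by (rule subalgebra_F)
  define B where "B n = (\<lambda>w. V w + \<xi> s w) -` cball 0 (real n) \<inter> space M" for n
  have Vs: "(\<lambda>w. V w + \<xi> s w) \<in> borel_measurable (F R s)"
  proof -
    have "(\<lambda>w. fst (past R s w) s) \<in> borel_measurable (F R s)"
      using s by (intro measurable_compose[OF measurable_compose[OF measurable_F_past measurable_fst] measurable_component_singleton]) auto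
    then show ?thesis using s by (simp add: past_def)
  qed
  have B_sets: "B n \<in> sets (F R s)" for n
    using measurable_sets[OF Vs, of "cball 0 (real n)"] by (simp add: B_def F_def)
  have fin: "emeasure M (B n) < \<infinity>" for n
  proof -
    have "emeasure M (B n) = (\<integral>\<^sup>+w. indicator (cball 0 (real n)) (V w + \<xi> s w) \<partial>M)"
    proof -
      have "B n \<in> sets M" using B_sets subalgebra_F[of R s] by (auto simp: subalgebra_def)
      then have "emeasure M (B n) = (\<integral>\<^sup>+w. indicator (B n) w \<partial>M)" by simp
      also have "\<dots> = (\<integral>\<^sup>+w. indicator (cball 0 (real n)) (V w + \<xi> s w) \<partial>M)"
        by (intro nn_integral_cong) (auto simp: B_def indicator_def)
      finally show ?thesis .
    qed
    also have "\<dots> = (\<integral>\<^sup>+w'. \<integral>\<^sup>+x. \<integral>\<^sup>+w. indicator (cball (0 :: real ^ 'd) (real n)) x \<partial>P \<partial>lborel \<partial>P)"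
      by (rule law_shift[OF s(1), of "\<lambda>x _ _. indicator (cball 0 (real n)) x"])
         (unfold split_beta, rule measurable_compose[OF measurable_fst borel_measurable_indicator], simp)
    also have "\<dots> < \<infinity>"
      using P.emeasure_space_1 emeasure_lborel_cball_finite[of "0 :: real ^ 'd" "real n"] by simp
    finally show ?thesis .
  qed
  have "(\<Union>n. B n) = space M"
    using real_arch_simple by (fastforce simp: B_def)
  then show "\<exists>A. countable A \<and> A \<subseteq> sets (restr_to_subalg M (F R s)) \<and> \<Union> A = space (restr_to_subalg M (F R s))
      \<and> (\<forall>a\<in>A. emeasure (restr_to_subalg M (F R s)) a \<noteq> \<infinity>)"
    using B_sets fin subalgebra_F[of R s]
    by (intro exI[of _ "range B"])
       (auto simp: sets_restr_to_subalg space_restr_to_subalg emeasure_restr_to_subalg less_top)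
qed

lemma increment_\<xi>_heat:
  assumes "s \<in> G" "s' \<in> G" "0 < r"
  shows "(\<integral>\<^sup>+w. heat r (z + (\<xi> s' w - \<xi> s w)) \<partial>P) = heat (r + \<bar>s' - s\<bar>) z"
proof -
  define R where "R = (if s \<le> s' then (\<le>) else (\<ge>) :: real \<Rightarrow> real \<Rightarrow> bool)"
  have "R = (\<le>) \<or> R = (\<ge>)" "R s s'" by (auto simp: R_def)
  from increment_\<xi>[OF this(1) assms(1,2) this(2) _ assms(3), of "\<lambda>_. 1"] P.emeasure_space_1
  show ?thesis by simp
qed

text \<open>An exact value, independent of \<open>a\<close>, because the position at the first point
  is Lebesgue distributed. Variances add up: the two smoothing levels and the variance
  \<open>\<bar>s' - s\<bar> + \<bar>t' - t\<bar>\<close> of the displacement between the two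
  points.\<close>

lemma heat_second_moment:
  assumes s: "s \<in> G" "s' \<in> G" and t: "t \<in> G'" "t' \<in> G'" and r: "0 < r" "0 < r'"
  shows "(\<integral>\<^sup>+w. ennreal (heat r (Z s t w - a)) * heat r' (Z s' t' w - a) \<partial>M)
    = heat (r + r' + \<bar>s' - s\<bar> + \<bar>t' - t\<bar>) (0 :: real ^ 'd)"
proof -
  let ?u = "\<lambda>w. \<lambda>r\<in>G. \<xi> r w - \<xi> s w" and ?v = "\<lambda>w. \<lambda>t\<in>G'. \<eta> t w"
  interpret S: lebesgue_field P M V \<eta> \<xi> G' G by (rule swap)
  note [measurable] = s t
  define g where "g x u v = ennreal (heat r (x + v t - a)) * ennreal (heat r' (x + u s' + v t' - a))"
    for x and u v :: "real \<Rightarrow> real ^ 'd"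
  have gm: "(\<lambda>(x, u, v). g x u v) \<in> borel_measurable (borel \<Otimes>\<^sub>M paths G \<Otimes>\<^sub>M paths G')"
    unfolding g_def split_beta using s t
    by (intro borel_measurable_times_ennreal borel_measurable_add measurable_compose[OF _ measurable_ennreal]
        measurable_compose[OF _ borel_measurable_heat] borel_measurable_diff
        measurable_compose[OF measurable_compose[OF measurable_snd measurable_fst] measurable_component_singleton]
        measurable_compose[OF measurable_compose[OF measurable_snd measurable_snd] measurable_component_singleton]) auto
  let ?q = "r' + \<bar>s' - s\<bar>"
  have q0: "0 < ?q" and q1: "0 < ?q + \<bar>t' - t\<bar>" using r by simp_all
  have eq: "V w + \<xi> s w + (\<xi> s' w - \<xi> s w) + \<eta> t' w = Z s' t' w" for w
    by (simp add: Z_def)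
  have "(\<integral>\<^sup>+w. ennreal (heat r (Z s t w - a)) * heat r' (Z s' t' w - a) \<partial>M)
    = (\<integral>\<^sup>+w. g (V w + \<xi> s w) (?u w) (?v w) \<partial>M)"
    using s t unfolding g_def by (simp add: eq Z_def)
  also have "\<dots> = (\<integral>\<^sup>+w'. \<integral>\<^sup>+x. \<integral>\<^sup>+w. g x (?u w) (?v w') \<partial>P \<partial>lborel \<partial>P)"
    by (rule law_shift[OF s(1) gm])
  also have "\<dots> = (\<integral>\<^sup>+w'. \<integral>\<^sup>+x. ennreal (heat r (x + \<eta> t w' - a)) * ennreal (heat ?q (x + \<eta> t' w' - a)) \<partial>lborel \<partial>P)"
  proof (intro nn_integral_cong)
    fix w' x
    have "(\<integral>\<^sup>+w. g x (?u w) (?v w') \<partial>P)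
      = (\<integral>\<^sup>+w. ennreal (heat r (x + \<eta> t w' - a)) * ennreal (heat r' ((x + \<eta> t' w' - a) + (\<xi> s' w - \<xi> s w))) \<partial>P)"
      using s t unfolding g_def by (simp add: algebra_simps)
    also have "\<dots> = ennreal (heat r (x + \<eta> t w' - a)) * (\<integral>\<^sup>+w. ennreal (heat r' ((x + \<eta> t' w' - a) + (\<xi> s' w - \<xi> s w))) \<partial>P)"
      by (rule nn_integral_cmult) measurable
    finally show "(\<integral>\<^sup>+w. g x (?u w) (?v w') \<partial>P)
      = ennreal (heat r (x + \<eta> t w' - a)) * ennreal (heat ?q (x + \<eta> t' w' - a))"
      using increment_\<xi>_heat[OF s r(2)] by simp
  qed
  \<comment> \<open>Shifting \<open>x\<close> by \<open>a - \<eta> t w'\<close> leaves only the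
    increment of \<open>\<eta>\<close> as a random quantity.\<close>
  also have "\<dots> = (\<integral>\<^sup>+w'. \<integral>\<^sup>+x. ennreal (heat r x) * ennreal (heat ?q (x + (\<eta> t' w' - \<eta> t w'))) \<partial>lborel \<partial>P)"
  proof (rule nn_integral_cong)
    fix w'
    show "(\<integral>\<^sup>+x. ennreal (heat r (x + \<eta> t w' - a)) * ennreal (heat ?q (x + \<eta> t' w' - a)) \<partial>lborel)
      = (\<integral>\<^sup>+x. ennreal (heat r x) * ennreal (heat ?q (x + (\<eta> t' w' - \<eta> t w'))) \<partial>lborel)"
      using nn_integral_lborel_translation[of "\<lambda>x. ennreal (heat r (x + \<eta> t w' - a)) * ennreal (heat ?q (x + \<eta> t' w' - a))" "a - \<eta> t w'"]
      by (simp add: algebra_simps)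
  qed
  also have "\<dots> = (\<integral>\<^sup>+x. \<integral>\<^sup>+w'. ennreal (heat r x) * ennreal (heat ?q (x + (\<eta> t' w' - \<eta> t w'))) \<partial>P \<partial>lborel)"
    by (rule LP.Fubini') measurable
  also have "\<dots> = (\<integral>\<^sup>+x. ennreal (heat r x) * ennreal (heat (?q + \<bar>t' - t\<bar>) (x :: real ^ 'd)) \<partial>lborel)"
    by (intro nn_integral_cong) (simp add: nn_integral_cmult S.increment_\<xi>_heat[OF t q0])
  also have "\<dots> = heat (r + r' + \<bar>s' - s\<bar> + \<bar>t' - t\<bar>) (0 :: real ^ 'd)"
    using heat_convolution[OF r(1) q1, of 0] by (simp add: add.assoc)
  finally show ?thesis .
qed

section \<open>Potentials on quadrants\<close>

abbreviation times :: "(real \<times> real) set" where "times \<equiv> G \<times> G'"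

text \<open>\<open>R1\<close> and \<open>R2\<close> select a quadrant at \<open>p\<close>. The
  potential of \<open>\<theta>\<close> on it is what remains of the terms
  \<open>\<theta> q * heat r (Z q - a)\<close> with \<open>q\<close> in the quadrant after
  projection onto the opposite past. Dually, the projections are moved onto the weights
  \<open>A p\<close>; Cauchy-Schwarz then separates the sum of the kernels from the projected
  weights. The factor 16 is one factor 4 of the dual Doob inequality per parameter.\<close>

lemma quadrant_bound:
  fixes A :: "real \<times> real \<Rightarrow> 'w \<Rightarrow> ennreal" and \<theta> :: "real \<times> real \<Rightarrow> ennreal" and c :: ennreal
  assumes R1: "R1 = (\<le>) \<or> R1 = (\<ge>)" and R2: "R2 = (\<le>) \<or> R2 = (\<ge>)" and r: "0 < r"
    and A [measurable]: "\<And>p. p \<in> times \<Longrightarrow> A p \<in> borel_measurable P"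
    and bounded: "\<And>p w. p \<in> times \<Longrightarrow> A p w \<le> c" "c < \<infinity>"
    and int: "\<And>p. p \<in> times \<Longrightarrow> (\<integral>\<^sup>+w. A p w \<partial>M) < \<infinity>"
  shows "(\<Sum>p\<in>times. \<Sum>q\<in>{q\<in>times. R1 (fst p) (fst q) \<and> R2 (snd p) (snd q)}.
      \<theta> q * (\<integral>\<^sup>+w. A p w * heat (r + \<bar>fst q - fst p\<bar> + \<bar>snd q - snd p\<bar>) (Z (fst p) (snd p) w - a) \<partial>M))\<^sup>2
    \<le> 16 * (\<integral>\<^sup>+w. (\<Sum>q\<in>times. \<theta> q * heat r (Z (fst q) (snd q) w - a))\<^sup>2 \<partial>M)
        * (\<integral>\<^sup>+w. (\<Sum>p\<in>times. A p w)\<^sup>2 \<partial>M)"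
proof -
  interpret S: lebesgue_field P M V \<eta> \<xi> G' G by (rule swap)
  have fin: "finite times" using finite_G by simp
  have reflex: "R1 x x" "R2 x x" and trans: "transp R1" "transp R2"
    and total: "R1 x y \<or> R1 y x" "R2 x y \<or> R2 y x" for x y
    using R1 R2 by (auto simp: transp_def)
  have SZ: "S.Z t s = Z s t" for s t
    by (simp add: Z_def S.Z_def fun_eq_iff add_ac)
  let ?F1 = "\<lambda>p. F R1 (fst p)" and ?F2 = "\<lambda>p. S.F R2 (snd p)"
  have sf1: "sigma_finite_subalgebra M (?F1 p)" and sf2: "sigma_finite_subalgebra M (?F2 p)" if "p \<in> times" for p
    using that reflex by (auto intro: sigma_finite_F S.sigma_finite_F)
  define B where "B p = nn_cond_exp M (?F2 p) (A p)" for p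
  define C where "C p = nn_cond_exp M (?F1 p) (B p)" for p
  have [measurable]: "B p \<in> borel_measurable M" "C p \<in> borel_measurable M" for p
    by (simp_all add: B_def C_def)
  note doob = sf2 total S.F_mono trans bounded int
  note doob1 = dual_doob_L2[OF fin, where M = M and F = ?F2 and R = "\<lambda>p q. R2 (snd p) (snd q)" and A = A and c = c]
  have B: "(\<integral>\<^sup>+w. (\<Sum>p\<in>times. B p w)\<^sup>2 \<partial>M) \<le> 4 * (\<integral>\<^sup>+w. (\<Sum>p\<in>times. A p w)\<^sup>2 \<partial>M)"
    unfolding B_def by (rule doob1(1)) (use doob in auto)
  have B_le: "AE w in M. B p w \<le> c" if "p \<in> times" for p
    unfolding B_def by (rule doob1(2)) (use that doob in auto)
  have B_int: "(\<integral>\<^sup>+w. B p w \<partial>M) < \<infinity>" if "p \<in> times" for p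
  proof -
    have "(\<integral>\<^sup>+w. B p w \<partial>M) = (\<integral>\<^sup>+w. A p w \<partial>M)"
      unfolding B_def by (rule doob1(3)) (use that doob in auto)
    then show ?thesis using int[OF that] by simp
  qed
  have "(\<integral>\<^sup>+w. (\<Sum>p\<in>times. C p w)\<^sup>2 \<partial>M) \<le> 4 * (\<integral>\<^sup>+w. (\<Sum>p\<in>times. B p w)\<^sup>2 \<partial>M)"
    unfolding C_def
    by (rule dual_doob_L2(1)[OF fin, where R = "\<lambda>p q. R1 (fst p) (fst q)" and c = c])
      (use sf1 total F_mono trans bounded B_le B_int in auto)
  also have "\<dots> \<le> 4 * (4 * (\<integral>\<^sup>+w. (\<Sum>p\<in>times. A p w)\<^sup>2 \<partial>M))"
    by (rule mult_left_mono[OF B]) simp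
  finally have C: "(\<integral>\<^sup>+w. (\<Sum>p\<in>times. C p w)\<^sup>2 \<partial>M) \<le> 16 * (\<integral>\<^sup>+w. (\<Sum>p\<in>times. A p w)\<^sup>2 \<partial>M)"
    by (simp add: mult.assoc[symmetric])
  \<comment> \<open>The kernel is carried from \<open>q\<close> to \<open>p\<close> by two
    axis-parallel moves through the corner \<open>(s, t')\<close>. Each move is the Markov property
    in one parameter; after it the kernel is measurable for that past, and the conditional
    expectation can be undone.\<close>
  have key: "(\<integral>\<^sup>+w. A p w * heat (r + \<bar>fst q - fst p\<bar> + \<bar>snd q - snd p\<bar>) (Z (fst p) (snd p) w - a) \<partial>M)
      = (\<integral>\<^sup>+w. C p w * heat r (Z (fst q) (snd q) w - a) \<partial>M)"
    if p: "p \<in> times" and q: "q \<in> times" and Rpq: "R1 (fst p) (fst q)" "R2 (snd p) (snd q)" for p q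
  proof -
    obtain s t s' t' where pq: "p = (s, t)" "q = (s', t')" by (metis surj_pair)
    have mem: "s \<in> G" "t \<in> G'" "s' \<in> G" "t' \<in> G'" using p q pq by auto
    interpret E1: sigma_finite_subalgebra M "F R1 s" using sf1[OF p] pq by simp
    interpret E2: sigma_finite_subalgebra M "S.F R2 t" using sf2[OF p] pq by simp
    let ?r1 = "r + \<bar>s' - s\<bar>" and ?r2 = "r + \<bar>s' - s\<bar> + \<bar>t' - t\<bar>"
    have r1: "0 < ?r1" using r by simp
    have Cp: "C p = nn_cond_exp M (F R1 s) (B p)" and Bp: "B p = nn_cond_exp M (S.F R2 t) (A p)"
      by (simp_all add: C_def B_def pq)
    have Cm: "C p \<in> borel_measurable (F R1 s)" by (simp add: Cp)
    have Bm: "B p \<in> borel_measurable (S.F R2 t)" by (simp add: Bp)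
    have m1: "(\<lambda>w. ennreal (heat ?r1 (Z s t' w - a))) \<in> borel_measurable (F R1 s)"
      using Z_measurable_F[of s R1 t'] mem reflex by simp
    have m2: "(\<lambda>w. ennreal (heat ?r2 (Z s t w - a))) \<in> borel_measurable (S.F R2 t)"
      using S.Z_measurable_F[of t R2 s] mem reflex by (simp add: SZ)
    have "(\<integral>\<^sup>+w. C p w * heat r (Z s' t' w - a) \<partial>M) = (\<integral>\<^sup>+w. C p w * heat ?r1 (Z s t' w - a) \<partial>M)"
      using markov_F[OF R1 mem(1,3) _ mem(4) r Cm, of a] Rpq pq by simp
    also have "\<dots> = (\<integral>\<^sup>+w. B p w * heat ?r1 (Z s t' w - a) \<partial>M)"
      using E1.nn_cond_exp_intg[OF m1, of "B p"] by (simp add: Cp mult.commute)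
    also have "\<dots> = (\<integral>\<^sup>+w. B p w * heat ?r2 (Z s t w - a) \<partial>M)"
      using S.markov_F[OF R2 mem(2,4) _ mem(1) r1 Bm, of a] Rpq pq by (simp add: SZ)
    also have "\<dots> = (\<integral>\<^sup>+w. A p w * heat ?r2 (Z s t w - a) \<partial>M)"
      using E2.nn_cond_exp_intg[OF m2, of "A p"] A[OF p] by (simp add: Bp mult.commute)
    finally show ?thesis by (simp add: pq)
  qed
  let ?J = "\<lambda>w. \<Sum>q\<in>times. \<theta> q * heat r (Z (fst q) (snd q) w - a)"
  have Zm: "(\<lambda>w. ennreal (heat r (Z (fst q) (snd q) w - a))) \<in> borel_measurable M" if "q \<in> times" for q
    using that by (auto simp: mem_Times_iff)
  then have [measurable]: "?J \<in> borel_measurable M"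
    by (intro borel_measurable_sum borel_measurable_times_ennreal) auto
  have "(\<Sum>p\<in>times. \<Sum>q\<in>{q\<in>times. R1 (fst p) (fst q) \<and> R2 (snd p) (snd q)}.
      \<theta> q * (\<integral>\<^sup>+w. A p w * heat (r + \<bar>fst q - fst p\<bar> + \<bar>snd q - snd p\<bar>) (Z (fst p) (snd p) w - a) \<partial>M))
    = (\<Sum>p\<in>times. \<Sum>q\<in>{q\<in>times. R1 (fst p) (fst q) \<and> R2 (snd p) (snd q)}.
      \<theta> q * (\<integral>\<^sup>+w. C p w * heat r (Z (fst q) (snd q) w - a) \<partial>M))"
    by (intro sum.cong refl) (simp add: key)
  \<comment> \<open>Nonnegative terms outside the quadrant are added, so that the sum over
    \<open>q\<close> becomes \<open>?J\<close> and no longer depends on \<open>p\<close>.\<close>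
  also have "\<dots> \<le> (\<Sum>p\<in>times. \<Sum>q\<in>times. \<theta> q * (\<integral>\<^sup>+w. C p w * heat r (Z (fst q) (snd q) w - a) \<partial>M))"
    using fin by (intro sum_mono sum_mono2) auto
  also have "\<dots> = (\<Sum>p\<in>times. \<Sum>q\<in>times. (\<integral>\<^sup>+w. C p w * (\<theta> q * heat r (Z (fst q) (snd q) w - a)) \<partial>M))"
    using Zm by (intro sum.cong refl) (simp add: nn_integral_cmult[symmetric] mult_ac)
  also have "\<dots> = (\<Sum>p\<in>times. (\<integral>\<^sup>+w. (\<Sum>q\<in>times. C p w * (\<theta> q * heat r (Z (fst q) (snd q) w - a))) \<partial>M))"
    using Zm by (intro sum.cong refl nn_integral_sum[symmetric]) auto
  also have "\<dots> = (\<integral>\<^sup>+w. (\<Sum>p\<in>times. C p w * ?J w) \<partial>M)"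
    unfolding sum_distrib_left using Zm
    by (intro nn_integral_sum[symmetric] borel_measurable_sum borel_measurable_times_ennreal) auto
  also have "\<dots> = (\<integral>\<^sup>+w. ?J w * (\<Sum>p\<in>times. C p w) \<partial>M)"
    by (intro nn_integral_cong) (subst mult.commute, rule sum_distrib_right[symmetric])
  finally have "(\<Sum>p\<in>times. \<Sum>q\<in>{q\<in>times. R1 (fst p) (fst q) \<and> R2 (snd p) (snd q)}.
      \<theta> q * (\<integral>\<^sup>+w. A p w * heat (r + \<bar>fst q - fst p\<bar> + \<bar>snd q - snd p\<bar>) (Z (fst p) (snd p) w - a) \<partial>M))\<^sup>2
    \<le> (\<integral>\<^sup>+w. ?J w * (\<Sum>p\<in>times. C p w) \<partial>M)\<^sup>2"
    by (rule power_mono_ennreal)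
  also have "\<dots> \<le> (\<integral>\<^sup>+w. (?J w)\<^sup>2 \<partial>M) * (\<integral>\<^sup>+w. (\<Sum>p\<in>times. C p w)\<^sup>2 \<partial>M)"
    by (rule Cauchy_Schwarz_nn_integral) measurable
  also have "\<dots> \<le> (\<integral>\<^sup>+w. (?J w)\<^sup>2 \<partial>M) * (16 * (\<integral>\<^sup>+w. (\<Sum>p\<in>times. A p w)\<^sup>2 \<partial>M))"
    by (rule mult_left_mono[OF C]) simp
  finally show ?thesis
    by (simp only: mult_ac)
qed

text \<open>Any two points are comparable in each coordinate, so every pair lies in at least one
  quadrant and the full potential is at most the sum of the four. Squaring four terms costs another
  factor 16, whence 256. \<open>heat_second_moment\<close> turns the remaining square into a
  discrete energy of \<open>\<theta>\<close>.\<close>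

lemma total_bound:
  fixes A :: "real \<times> real \<Rightarrow> 'w \<Rightarrow> ennreal" and \<theta> :: "real \<times> real \<Rightarrow> ennreal" and c :: ennreal
  assumes r: "0 < r"
    and A: "\<And>p. p \<in> times \<Longrightarrow> A p \<in> borel_measurable P"
    and bounded: "\<And>p w. p \<in> times \<Longrightarrow> A p w \<le> c" "c < \<infinity>"
    and int: "\<And>p. p \<in> times \<Longrightarrow> (\<integral>\<^sup>+w. A p w \<partial>M) < \<infinity>"
  shows "(\<Sum>p\<in>times. \<Sum>q\<in>times.
      \<theta> q * (\<integral>\<^sup>+w. A p w * heat (r + \<bar>fst q - fst p\<bar> + \<bar>snd q - snd p\<bar>) (Z (fst p) (snd p) w - a) \<partial>M))\<^sup>2
    \<le> 256 * (\<Sum>p\<in>times. \<Sum>q\<in>times. \<theta> p * \<theta> q * heat (r + r + \<bar>fst q - fst p\<bar> + \<bar>snd q - snd p\<bar>) (0 :: real ^ 'd))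
        * (\<integral>\<^sup>+w. (\<Sum>p\<in>times. A p w)\<^sup>2 \<partial>M)"
proof -
  have fin: "finite times" using finite_G by simp
  let ?h = "\<lambda>q w. ennreal (heat r (Z (fst q) (snd q) w - a))"
  let ?S = "\<integral>\<^sup>+w. (\<Sum>p\<in>times. A p w)\<^sup>2 \<partial>M"
  define f where "f p q = \<theta> q * (\<integral>\<^sup>+w. A p w * heat (r + \<bar>fst q - fst p\<bar> + \<bar>snd q - snd p\<bar>) (Z (fst p) (snd p) w - a) \<partial>M)" for p q
  define Q where "Q R1 R2 = (\<Sum>p\<in>times. \<Sum>q\<in>{q\<in>times. R1 (fst p) (fst q) \<and> R2 (snd p) (snd q)}. f p q)" for R1 R2
  have hm: "?h q \<in> borel_measurable M" if "q \<in> times" for q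
    using that by (auto simp: mem_Times_iff)
  have J: "(\<integral>\<^sup>+w. (\<Sum>q\<in>times. \<theta> q * ?h q w)\<^sup>2 \<partial>M)
    = (\<Sum>p\<in>times. \<Sum>q\<in>times. \<theta> p * \<theta> q * heat (r + r + \<bar>fst q - fst p\<bar> + \<bar>snd q - snd p\<bar>) (0 :: real ^ 'd))"
  proof -
    have "(\<Sum>q\<in>times. \<theta> q * ?h q w)\<^sup>2 = (\<Sum>p\<in>times. \<Sum>q\<in>times. \<theta> p * \<theta> q * (?h p w * ?h q w))" for w
      by (simp add: power2_eq_square sum_product mult_ac)
    then have "(\<integral>\<^sup>+w. (\<Sum>q\<in>times. \<theta> q * ?h q w)\<^sup>2 \<partial>M)
      = (\<integral>\<^sup>+w. (\<Sum>p\<in>times. \<Sum>q\<in>times. \<theta> p * \<theta> q * (?h p w * ?h q w)) \<partial>M)" by simp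
    also have "\<dots> = (\<Sum>p\<in>times. (\<integral>\<^sup>+w. (\<Sum>q\<in>times. \<theta> p * \<theta> q * (?h p w * ?h q w)) \<partial>M))"
      using hm by (intro nn_integral_sum borel_measurable_sum borel_measurable_times_ennreal borel_measurable_const)
    also have "\<dots> = (\<Sum>p\<in>times. \<Sum>q\<in>times. (\<integral>\<^sup>+w. \<theta> p * \<theta> q * (?h p w * ?h q w) \<partial>M))"
      using hm by (intro sum.cong refl nn_integral_sum borel_measurable_times_ennreal borel_measurable_const)
    also have "\<dots> = (\<Sum>p\<in>times. \<Sum>q\<in>times. \<theta> p * \<theta> q * heat (r + r + \<bar>fst q - fst p\<bar> + \<bar>snd q - snd p\<bar>) (0 :: real ^ 'd))"
    proof (intro sum.cong refl)
      fix p q assume pq: "p \<in> times" "q \<in> times"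
      have "(\<integral>\<^sup>+w. \<theta> p * \<theta> q * (?h p w * ?h q w) \<partial>M) = \<theta> p * \<theta> q * (\<integral>\<^sup>+w. ?h p w * ?h q w \<partial>M)"
        using hm pq by (intro nn_integral_cmult borel_measurable_times_ennreal)
      also have "(\<integral>\<^sup>+w. ?h p w * ?h q w \<partial>M) = heat (r + r + \<bar>fst q - fst p\<bar> + \<bar>snd q - snd p\<bar>) (0 :: real ^ 'd)"
        using pq by (intro heat_second_moment r) (auto simp: mem_Times_iff)
      finally show "(\<integral>\<^sup>+w. \<theta> p * \<theta> q * (?h p w * ?h q w) \<partial>M)
        = \<theta> p * \<theta> q * heat (r + r + \<bar>fst q - fst p\<bar> + \<bar>snd q - snd p\<bar>) (0 :: real ^ 'd)" .
    qed
    finally show ?thesis .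
  qed
  define x where "x = 16 * (\<integral>\<^sup>+w. (\<Sum>q\<in>times. \<theta> q * ?h q w)\<^sup>2 \<partial>M) * ?S"
  have Q: "(Q R1 R2)\<^sup>2 \<le> x" if "R1 = (\<le>) \<or> R1 = (\<ge>)" "R2 = (\<le>) \<or> R2 = (\<ge>)" for R1 R2
    unfolding Q_def f_def x_def by (rule quadrant_bound[OF that r A bounded int])
  have "(\<Sum>p\<in>times. \<Sum>q\<in>times. f p q) \<le> (\<Sum>p\<in>times. \<Sum>q\<in>times.
      (if fst p \<le> fst q \<and> snd p \<le> snd q then f p q else 0) + (if fst p \<le> fst q \<and> snd p \<ge> snd q then f p q else 0)
      + (if fst p \<ge> fst q \<and> snd p \<le> snd q then f p q else 0) + (if fst p \<ge> fst q \<and> snd p \<ge> snd q then f p q else 0))"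
    by (intro sum_mono) auto
  also have "\<dots> = Q (\<le>) (\<le>) + Q (\<le>) (\<ge>) + Q (\<ge>) (\<le>) + Q (\<ge>) (\<ge>)"
    unfolding Q_def sum.inter_filter[OF fin] sum.distrib ..
  finally have "(\<Sum>p\<in>times. \<Sum>q\<in>times. f p q)\<^sup>2 \<le> (Q (\<le>) (\<le>) + Q (\<le>) (\<ge>) + Q (\<ge>) (\<le>) + Q (\<ge>) (\<ge>))\<^sup>2"
    by (rule power_mono_ennreal)
  also have "\<dots> \<le> 16 * x"
    by (intro four_squares_ennreal Q) auto
  also have "16 * x = 256 * (\<integral>\<^sup>+w. (\<Sum>q\<in>times. \<theta> q * ?h q w)\<^sup>2 \<partial>M) * ?S"
    unfolding x_def by (simp only: mult.assoc[symmetric] numeral_times_numeral) simp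
  finally show ?thesis
    unfolding f_def J .
qed

end

section \<open>Brownian motion under the reweighted measure\<close>

lemma brownian_lebesgue_law:
  fixes X Y :: "real \<Rightarrow> 'w \<Rightarrow> real ^ 'd::finite"
    and g :: "(real ^ 'd) \<times> (real \<Rightarrow> real ^ 'd) \<times> (real \<Rightarrow> real ^ 'd) \<Rightarrow> ennreal"
  assumes BX: "brownian_motion P X" and BY: "brownian_motion P Y" and ind: "indep_processes P X Y"
    and m: "0 < m" and G: "finite G" "G \<subseteq> {m..}" and G': "finite G'" "G' \<subseteq> {0..}"
    and g: "g \<in> borel_measurable (borel \<Otimes>\<^sub>M paths G \<Otimes>\<^sub>M paths G')"
  shows "(\<integral>\<^sup>+w. ennreal (1 / heat m (X m w)) * g (X m w, \<lambda>r\<in>G. X r w - X m w, \<lambda>t\<in>G'. Y t w) \<partial>P)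
    = (\<integral>\<^sup>+x. \<integral>\<^sup>+w. \<integral>\<^sup>+w'. g (x, \<lambda>r\<in>G. X r w - X m w, \<lambda>t\<in>G'. Y t w') \<partial>P \<partial>P \<partial>lborel)"
proof -
  interpret P: prob_space P by (rule brownian_motionD[OF BX])
  interpret PP: pair_sigma_finite P P ..
  interpret LP: pair_sigma_finite lborel P ..
  have X [measurable]: "X r \<in> borel_measurable P" if "0 \<le> r" for r
    using that by (rule brownian_motionD[OF BX])
  have Y [measurable]: "Y r \<in> borel_measurable P" if "0 \<le> r" for r
    using that by (rule brownian_motionD[OF BY])
  have [simp]: "0 \<le> m" using m by simp
  have Gpos: "r \<in> G \<Longrightarrow> 0 \<le> r" "t \<in> G' \<Longrightarrow> 0 \<le> t" for r t
    using G(2) G'(2) m by auto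
  have meas_g: "(\<lambda>\<theta>. g (a \<theta>, b \<theta>, c \<theta>)) \<in> borel_measurable N"
    if "a \<in> borel_measurable N" "b \<in> measurable N (paths G)" "c \<in> measurable N (paths G')"
    for a b c and N :: "'x measure"
    using measurable_compose[OF measurable_Pair[OF that(1) measurable_Pair[OF that(2,3)]] g] .
  define \<Xi> where "\<Xi> w = (\<lambda>r\<in>G. X r w - X m w)" for w
  define H where "H w = (\<lambda>t\<in>G'. Y t w)" for w
  have \<Xi> [measurable]: "\<Xi> \<in> measurable P (paths G)"
    unfolding \<Xi>_def[abs_def] using Gpos by (intro measurable_restrict borel_measurable_diff X) auto
  have H [measurable]: "H \<in> measurable P (paths G')"
    unfolding H_def[abs_def] using Gpos by (intro measurable_restrict Y) auto
  define v where "v x = ennreal (1 / heat m x)" for x :: "real ^ 'd"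
  have v [measurable]: "v \<in> borel_measurable borel"
    unfolding v_def[abs_def] by measurable

  have indXY: "P.indep_var (paths (insert m G)) (\<lambda>w. \<lambda>r\<in>insert m G. X r w) (paths G') H"
    unfolding H_def[abs_def] using Gpos by (intro indep_processes_restrict[OF ind]) (auto intro: P.prob_space_axioms)
  have h1: "(\<lambda>\<theta>. v (fst \<theta> m) * g (fst \<theta> m, \<lambda>r\<in>G. fst \<theta> r - fst \<theta> m, snd \<theta>))
      \<in> borel_measurable (paths (insert m G) \<Otimes>\<^sub>M paths G')"
    by (intro borel_measurable_times_ennreal measurable_compose[OF _ v] meas_g measurable_restrict borel_measurable_diff
        measurable_compose[OF measurable_fst measurable_component_singleton]) auto
  have restr: "(\<lambda>r\<in>G. (if r = m \<or> r \<in> G then X r w else undefined) - X m w) = \<Xi> w" for w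
    unfolding \<Xi>_def by (rule restrict_ext) simp
  \<comment> \<open>The path of \<open>Y\<close> is decoupled first; for fixed \<open>Y\<close>, the
    value \<open>X m\<close> is then separated from the later increments of
    \<open>X\<close>.\<close>
  have "(\<integral>\<^sup>+w. v (X m w) * g (X m w, \<Xi> w, H w) \<partial>P)
    = (\<integral>\<^sup>+w. \<integral>\<^sup>+w'. v (X m w) * g (X m w, \<Xi> w, H w') \<partial>P \<partial>P)"
    using P.indep_var_nn_integral[OF indXY, of "\<lambda>u y. v (u m) * g (u m, \<lambda>r\<in>G. u r - u m, y)"] h1
    by (simp add: split_beta restr)
  also have "\<dots> = (\<integral>\<^sup>+w'. \<integral>\<^sup>+w. v (X m w) * g (X m w, \<Xi> w, H w') \<partial>P \<partial>P)"
    by (rule PP.Fubini'[symmetric]) (unfold split_beta, intro borel_measurable_times_ennreal meas_g; measurable)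
  also have "\<dots> = (\<integral>\<^sup>+w'. \<integral>\<^sup>+x. \<integral>\<^sup>+w. g (x, \<Xi> w, H w') \<partial>P \<partial>lborel \<partial>P)"
  proof (rule nn_integral_cong)
    fix w' assume "w' \<in> space P"
    then have Hs: "H w' \<in> space (paths G')" by (rule measurable_space[OF H])
    \<comment> \<open>\<open>X m\<close> enters as the negative of \<open>X 0 - X m\<close>, so that
      independence of the increments on the two sides of \<open>m\<close> applies. This is where all
      times in \<open>G\<close> have to be at least \<open>m\<close>.\<close>
    have indX: "P.indep_var (paths {0}) (\<lambda>w. \<lambda>r\<in>{0}. X r w - X m w) (paths G) \<Xi>"
      unfolding \<Xi>_def[abs_def] using m G by (intro brownian_increments_indep[OF BX]) auto
    have h2: "(\<lambda>(u, y). v (- u 0) * g (- u 0, y, H w')) \<in> borel_measurable (paths {0} \<Otimes>\<^sub>M paths G)"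
      unfolding split_beta using Hs by (intro borel_measurable_times_ennreal measurable_compose[OF _ v] meas_g borel_measurable_uminus
        measurable_compose[OF measurable_fst measurable_component_singleton]) auto
    have k: "(\<lambda>x. v x * (\<integral>\<^sup>+w2. g (x, \<Xi> w2, H w') \<partial>P)) \<in> borel_measurable borel"
      using Hs by (intro borel_measurable_times_ennreal v P.borel_measurable_nn_integral)
        (unfold split_beta, intro meas_g, auto)
    have "(\<integral>\<^sup>+w. v (X m w) * g (X m w, \<Xi> w, H w') \<partial>P)
      = (\<integral>\<^sup>+w. v (- (X 0 w - X m w)) * g (- (X 0 w - X m w), \<Xi> w, H w') \<partial>P)"
      by (intro nn_integral_cong) (simp add: brownian_motionD(3)[OF BX])
    also have "\<dots> = (\<integral>\<^sup>+w. \<integral>\<^sup>+w2. v (- (X 0 w - X m w)) * g (- (X 0 w - X m w), \<Xi> w2, H w') \<partial>P \<partial>P)"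
      using P.indep_var_nn_integral[OF indX h2] by simp
    also have "\<dots> = (\<integral>\<^sup>+w. v (X m w - X 0 w) * (\<integral>\<^sup>+w2. g (X m w - X 0 w, \<Xi> w2, H w') \<partial>P) \<partial>P)"
      using Hs by (intro nn_integral_cong) (subst nn_integral_cmult[symmetric], auto intro!: meas_g)
    also have "\<dots> = (\<integral>\<^sup>+x. ennreal (heat (m - 0) x) * (v x * (\<integral>\<^sup>+w2. g (x, \<Xi> w2, H w') \<partial>P)) \<partial>lborel)"
      using k by (intro distributed_nn_integral[OF brownian_motionD(5)[OF BX order_refl m], symmetric]) simp
    also have "\<dots> = (\<integral>\<^sup>+x. \<integral>\<^sup>+w2. g (x, \<Xi> w2, H w') \<partial>P \<partial>lborel)"
    proof (rule nn_integral_cong)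
      fix x :: "real ^ 'd"
      have "ennreal (heat m x) * v x = 1"
        using heat_pos[OF m, of x] by (simp add: v_def flip: ennreal_mult)
      then show "ennreal (heat (m - 0) x) * (v x * (\<integral>\<^sup>+w2. g (x, \<Xi> w2, H w') \<partial>P)) = (\<integral>\<^sup>+w2. g (x, \<Xi> w2, H w') \<partial>P)"
        by (simp add: mult.assoc[symmetric])
    qed
    finally show "(\<integral>\<^sup>+w. v (X m w) * g (X m w, \<Xi> w, H w') \<partial>P) = (\<integral>\<^sup>+x. \<integral>\<^sup>+w. g (x, \<Xi> w, H w') \<partial>P \<partial>lborel)" .
  qed
  also have "\<dots> = (\<integral>\<^sup>+x. \<integral>\<^sup>+w'. \<integral>\<^sup>+w. g (x, \<Xi> w, H w') \<partial>P \<partial>P \<partial>lborel)"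
    by (rule LP.Fubini') (unfold split_beta, intro P.borel_measurable_nn_integral, unfold split_beta, intro meas_g; measurable)
  also have "\<dots> = (\<integral>\<^sup>+x. \<integral>\<^sup>+w. \<integral>\<^sup>+w'. g (x, \<Xi> w, H w') \<partial>P \<partial>P \<partial>lborel)"
    by (rule nn_integral_cong, rule PP.Fubini') (unfold split_beta, intro meas_g; measurable)
  finally show ?thesis
    by (simp add: v_def \<Xi>_def H_def)
qed

text \<open>With this choice of \<open>V\<close> and \<open>\<xi>\<close>, the field
  \<open>Z s t\<close> equals \<open>X s + Y t\<close>, and \<open>\<xi> r - \<xi> s\<close> is an
  ordinary increment of \<open>X\<close>; so \<open>m\<close> cancels from the increment
  conditions.\<close>

lemma brownian_lebesgue_field:
  fixes X Y :: "real \<Rightarrow> 'w \<Rightarrow> real ^ 'd::finite"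
  assumes BX: "brownian_motion P X" and BY: "brownian_motion P Y" and ind: "indep_processes P X Y"
    and m: "0 < m" and G: "finite G" "G \<subseteq> {m..}" and G': "finite G'" "G' \<subseteq> {0..}"
  shows "lebesgue_field P (density P (\<lambda>w. ennreal (1 / heat m (X m w)))) (X m)
    (\<lambda>r w. X r w - X m w) Y G G'"
proof (rule lebesgue_field.intro)
  have Gpos: "r \<in> G \<Longrightarrow> 0 \<le> r" "t \<in> G' \<Longrightarrow> 0 \<le> t" for r t
    using G(2) G'(2) m by auto
  have [simp]: "0 \<le> m" using m by simp
  have X: "X r \<in> borel_measurable P" if "0 \<le> r" for r
    using that by (rule brownian_motionD[OF BX])
  have Y: "Y r \<in> borel_measurable P" if "0 \<le> r" for r
    using that by (rule brownian_motionD[OF BY])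
  have [measurable]: "X m \<in> borel_measurable P" by (rule X) simp
  show "prob_space P" by (rule brownian_motionD[OF BX])
  show "X m \<in> borel_measurable P" by (rule X) simp
  show "(\<lambda>w. X s w - X m w) \<in> borel_measurable P" if "s \<in> G" for s
    using that Gpos X by (intro borel_measurable_diff) auto
  show "Y t \<in> borel_measurable P" if "t \<in> G'" for t
    using that Gpos Y by auto
  fix g :: "(real ^ 'd) \<times> (real \<Rightarrow> real ^ 'd) \<times> (real \<Rightarrow> real ^ 'd) \<Rightarrow> ennreal"
  assume g: "g \<in> borel_measurable (borel \<Otimes>\<^sub>M paths G \<Otimes>\<^sub>M paths G')"
  have "(\<lambda>w. g (X m w, \<lambda>r\<in>G. X r w - X m w, \<lambda>t\<in>G'. Y t w)) \<in> borel_measurable P"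
    using Gpos X Y by (intro measurable_compose[OF _ g] measurable_Pair measurable_restrict borel_measurable_diff) auto
  then show "(\<integral>\<^sup>+w. g (X m w, \<lambda>r\<in>G. X r w - X m w, \<lambda>t\<in>G'. Y t w)
      \<partial>density P (\<lambda>w. ennreal (1 / heat m (X m w))))
    = (\<integral>\<^sup>+x. \<integral>\<^sup>+w. \<integral>\<^sup>+w'. g (x, \<lambda>r\<in>G. X r w - X m w, \<lambda>t\<in>G'. Y t w') \<partial>P \<partial>P \<partial>lborel)"
    using brownian_lebesgue_law[OF assms g] by (simp add: nn_integral_density)
next
  fix R s s' z and r :: real and f :: "(real \<Rightarrow> real ^ 'd) \<Rightarrow> ennreal"
  assume *: "R = (\<le>) \<or> R = (\<ge>)" "s \<in> G" "s' \<in> G" "R s s'"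
    "f \<in> borel_measurable (paths {r\<in>G. R r s})" "0 < r"
  have "G \<subseteq> {0..}" using G(2) m by auto
  then show "(\<integral>\<^sup>+w. f (\<lambda>r\<in>{r\<in>G. R r s}. X r w - X m w - (X s w - X m w))
      * heat r (z + (X s' w - X m w - (X s w - X m w))) \<partial>P)
    = (\<integral>\<^sup>+w. f (\<lambda>r\<in>{r\<in>G. R r s}. X r w - X m w - (X s w - X m w)) \<partial>P) * heat (r + \<bar>s' - s\<bar>) z"
    using brownian_increment_heat[OF BX G(1) _ _ _ *(1,4,5,6), of z] *(2,3) by (simp add: subset_iff)
next
  fix R s s' z and r :: real and f :: "(real \<Rightarrow> real ^ 'd) \<Rightarrow> ennreal"
  assume *: "R = (\<le>) \<or> R = (\<ge>)" "s \<in> G'" "s' \<in> G'" "R s s'"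
    "f \<in> borel_measurable (paths {r\<in>G'. R r s})" "0 < r"
  then show "(\<integral>\<^sup>+w. f (\<lambda>r\<in>{r\<in>G'. R r s}. Y r w - Y s w) * heat r (z + (Y s' w - Y s w)) \<partial>P)
    = (\<integral>\<^sup>+w. f (\<lambda>r\<in>{r\<in>G'. R r s}. Y r w - Y s w) \<partial>P) * heat (r + \<bar>s' - s\<bar>) z"
    using brownian_increment_heat[OF BY G' _ _ *(1,4,5,6), of z] G'(2) by (auto simp: subset_iff)
qed (use G G' in auto)

section \<open>The energy of a finitely valued selection\<close>

lemma nn_integral_finite_range:
  fixes k :: "'b::t1_space \<Rightarrow> 'a \<Rightarrow> ennreal"
  assumes Q: "finite Q" "\<And>w. w \<in> space M \<Longrightarrow> U w \<in> Q" and U [measurable]: "U \<in> borel_measurable M"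
    and H [measurable]: "H \<in> sets M" and k: "\<And>q. q \<in> Q \<Longrightarrow> k q \<in> borel_measurable M"
  shows "(\<integral>\<^sup>+w. indicator H w * k (U w) w \<partial>M) = (\<Sum>q\<in>Q. \<integral>\<^sup>+w. indicator (H \<inter> (U -` {q} \<inter> space M)) w * k q w \<partial>M)"
proof -
  have [measurable]: "U -` {q} \<inter> space M \<in> sets M" for q
    by (rule measurable_sets[OF U]) simp
  have "(\<integral>\<^sup>+w. indicator H w * k (U w) w \<partial>M)
    = (\<integral>\<^sup>+w. (\<Sum>q\<in>Q. indicator (H \<inter> (U -` {q} \<inter> space M)) w * k q w) \<partial>M)"
  proof (rule nn_integral_cong)
    fix w assume w: "w \<in> space M"
    have "(\<Sum>q\<in>Q. indicator (H \<inter> (U -` {q} \<inter> space M)) w * k q w) = (\<Sum>q\<in>Q. if U w = q then indicator H w * k q w else 0)"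
      using w by (intro sum.cong) (auto simp: indicator_def)
    then show "indicator H w * k (U w) w = (\<Sum>q\<in>Q. indicator (H \<inter> (U -` {q} \<inter> space M)) w * k q w)"
      using Q w by simp
  qed
  also have "\<dots> = (\<Sum>q\<in>Q. \<integral>\<^sup>+w. indicator (H \<inter> (U -` {q} \<inter> space M)) w * k q w \<partial>M)"
    using k by (intro nn_integral_sum borel_measurable_times_ennreal borel_measurable_indicator) auto
  finally show ?thesis .
qed

text \<open>\<open>total_bound\<close> is used with weights living on the events that
  \<open>U = q\<close> within \<open>H\<close> and with \<open>\<theta> q\<close> their
  probabilities, the unnormalized law of \<open>U\<close> on \<open>H\<close>. Were the field equal
  to \<open>a\<close> at \<open>U\<close>, the left side would be the square of the energy on the
  right. Since \<open>U\<close> will be a rounded hitting point, the position error stays in the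
  kernel.\<close>

lemma finite_range_bound:
  fixes X Y :: "real \<Rightarrow> 'w \<Rightarrow> real ^ 'd::finite" and U :: "'w \<Rightarrow> real \<times> real"
  assumes BX: "brownian_motion P X" and BY: "brownian_motion P Y" and ind: "indep_processes P X Y"
    and m: "0 < m" and G: "finite G" "G \<subseteq> {m..}" and G': "finite G'" "G' \<subseteq> {0..}" and r: "0 < r"
    and H [measurable]: "H \<in> sets P" and U [measurable]: "U \<in> borel_measurable P"
    and range: "\<And>w. w \<in> space P \<Longrightarrow> U w \<in> G \<times> G'"
  shows "(\<integral>\<^sup>+w. indicator H w * (\<integral>\<^sup>+w'. indicator H w' * ennreal (heat (r + \<bar>fst (U w') - fst (U w)\<bar> + \<bar>snd (U w') - snd (U w)\<bar>)
        (X (fst (U w)) w + Y (snd (U w)) w - a)) \<partial>P) \<partial>P)\<^sup>2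
    \<le> 256 * ennreal (heat m (0 :: real ^ 'd)) * emeasure P H * (\<integral>\<^sup>+w. indicator H w * (\<integral>\<^sup>+w'. indicator H w' *
        ennreal (heat (r + \<bar>fst (U w') - fst (U w)\<bar> + \<bar>snd (U w') - snd (U w)\<bar>) (0 :: real ^ 'd)) \<partial>P) \<partial>P)"
proof -
  define M where "M = density P (\<lambda>w. ennreal (1 / heat m (X m w)))"
  interpret lebesgue_field P M "X m" "\<lambda>r w. X r w - X m w" Y G G'
    unfolding M_def by (rule brownian_lebesgue_field[OF BX BY ind m G G'])
  have fin: "finite (G \<times> G')" using G G' by simp
  define K where "K q = H \<inter> (U -` {q} \<inter> space P)" for q
  have K [measurable]: "K q \<in> sets P" for q
    unfolding K_def by (intro sets.Int H measurable_sets[OF U]) simp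
  \<comment> \<open>The factor \<open>heat m (X m)\<close> compensates the density of
    \<open>M\<close>: integrating against \<open>A q\<close> under \<open>M\<close> means
    integrating over \<open>K q\<close> under \<open>P\<close>.\<close>
  define A where "A q w = indicator (K q) w * ennreal (heat m (X m w))" for q w
  have A [measurable]: "A q \<in> borel_measurable P" for q
    unfolding A_def[abs_def] by measurable
  define C where "C = heat m (0 :: real ^ 'd)"
  have A_le: "A q w \<le> C" for q w
    using heat_le_zero[OF m, of "X m w"] by (auto simp: A_def C_def indicator_def)
  have A_int: "(\<integral>\<^sup>+w. A q w * f w \<partial>M) = (\<integral>\<^sup>+w. indicator (K q) w * f w \<partial>P)"
    if [measurable]: "f \<in> borel_measurable P" for q f
  proof -
    have "ennreal (1 / heat m (X m w)) * (A q w * f w) = indicator (K q) w * f w" for w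
    proof -
      have "ennreal (1 / heat m (X m w)) * ennreal (heat m (X m w)) = 1"
        using heat_pos[OF m, of "X m w"] by (simp flip: ennreal_mult)
      then show ?thesis by (cases "w \<in> K q") (simp_all add: A_def mult.assoc[symmetric])
    qed
    then show ?thesis
      unfolding M_def by (subst nn_integral_density) auto
  qed
  let ?D = "\<lambda>p q. r + \<bar>fst q - fst p\<bar> + \<bar>snd q - snd p\<bar>"
  let ?z = "\<lambda>p w. X (fst p) w + Y (snd p) w - a"
  let ?I = "\<lambda>p q. \<integral>\<^sup>+w. A p w * heat (?D p q) (?z p w) \<partial>M"
  let ?h = "\<lambda>p w. \<Sum>q\<in>G\<times>G'. emeasure P (K q) * heat (?D p q) (?z p w)"
  have D: "0 < ?D p q" for p q :: "real \<times> real" using r by simp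
  have Zz: "Z (fst p) (snd p) w - a = ?z p w" for p w
    by (simp add: Z_def)
  have z [measurable]: "?z p \<in> borel_measurable P" if "p \<in> G \<times> G'" for p
    using borel_measurable_Z[of "fst p" "snd p"] that by (simp add: Zz[symmetric] mem_Times_iff)
  have inner: "(\<integral>\<^sup>+w'. indicator H w' * ennreal (heat (?D p (U w')) y) \<partial>P)
    = (\<Sum>q\<in>G\<times>G'. emeasure P (K q) * heat (?D p q) y)" for p and y :: "real ^ 'd"
    unfolding K_def by (subst nn_integral_finite_range[OF fin range, where k = "\<lambda>q _. ennreal (heat (?D p q) y)"])
      (auto simp: nn_integral_multc K_def[symmetric])
  have "(\<integral>\<^sup>+w. indicator H w * (\<integral>\<^sup>+w'. indicator H w' * ennreal (heat (?D (U w) (U w')) (?z (U w) w)) \<partial>P) \<partial>P)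
    = (\<integral>\<^sup>+w. indicator H w * (\<Sum>q\<in>G\<times>G'. emeasure P (K q) * heat (?D (U w) q) (?z (U w) w)) \<partial>P)"
    unfolding inner ..
  also have "\<dots> = (\<Sum>p\<in>G\<times>G'. \<integral>\<^sup>+w. indicator (K p) w * ?h p w \<partial>P)"
    unfolding K_def[of p for p]
    by (rule nn_integral_finite_range[OF fin range U H, where k = "\<lambda>p w. \<Sum>q\<in>G\<times>G'. emeasure P (H \<inter> (U -` {q} \<inter> space P)) * heat (?D p q) (?z p w)"])
       (auto intro!: borel_measurable_sum borel_measurable_times_ennreal z measurable_compose[OF _ measurable_ennreal] measurable_compose[OF _ borel_measurable_heat])
  also have "\<dots> = (\<Sum>p\<in>G\<times>G'. \<Sum>q\<in>G\<times>G'. emeasure P (K q) * ?I p q)"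
  proof (rule sum.cong[OF refl])
    fix p assume p: "p \<in> G \<times> G'"
    have zp [measurable]: "?z p \<in> borel_measurable P" by (rule z[OF p])
    have "(\<integral>\<^sup>+w. indicator (K p) w * ?h p w \<partial>P)
      = (\<integral>\<^sup>+w. (\<Sum>q\<in>G\<times>G'. emeasure P (K q) * (indicator (K p) w * ennreal (heat (?D p q) (?z p w)))) \<partial>P)"
      by (simp add: sum_distrib_left mult_ac)
    also have "\<dots> = (\<Sum>q\<in>G\<times>G'. emeasure P (K q) * (\<integral>\<^sup>+w. indicator (K p) w * ennreal (heat (?D p q) (?z p w)) \<partial>P))"
      by (subst nn_integral_sum) (auto intro!: sum.cong nn_integral_cmult)
    also have "\<dots> = (\<Sum>q\<in>G\<times>G'. emeasure P (K q) * ?I p q)"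
      by (intro sum.cong refl) (subst A_int, auto)
    finally show "(\<integral>\<^sup>+w. indicator (K p) w * ?h p w \<partial>P)
      = (\<Sum>q\<in>G\<times>G'. emeasure P (K q) * ?I p q)" .
  qed
  finally have lhs: "(\<integral>\<^sup>+w. indicator H w * (\<integral>\<^sup>+w'. indicator H w' * ennreal (heat (?D (U w) (U w')) (?z (U w) w)) \<partial>P) \<partial>P)
    = (\<Sum>p\<in>G\<times>G'. \<Sum>q\<in>G\<times>G'. emeasure P (K q) * ?I p q)" .
  have rhs: "(\<integral>\<^sup>+w. indicator H w * (\<integral>\<^sup>+w'. indicator H w' * ennreal (heat (?D (U w) (U w')) (0 :: real ^ 'd)) \<partial>P) \<partial>P)
    = (\<Sum>p\<in>G\<times>G'. \<Sum>q\<in>G\<times>G'. emeasure P (K p) * emeasure P (K q) * heat (?D p q) (0 :: real ^ 'd))"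
  proof -
    let ?c = "\<lambda>p. \<Sum>q\<in>G\<times>G'. emeasure P (K q) * heat (?D p q) (0 :: real ^ 'd)"
    have "(\<integral>\<^sup>+w. indicator H w * ?c (U w) \<partial>P) = (\<Sum>p\<in>G\<times>G'. \<integral>\<^sup>+w. indicator (K p) w * ?c p \<partial>P)"
      unfolding K_def[of p for p]
      by (rule nn_integral_finite_range[OF fin range U H,
            where k = "\<lambda>p _. \<Sum>q\<in>G\<times>G'. emeasure P (H \<inter> (U -` {q} \<inter> space P)) * heat (?D p q) (0 :: real ^ 'd)"]) auto
    also have "\<dots> = (\<Sum>p\<in>G\<times>G'. emeasure P (K p) * ?c p)"
      by (intro sum.cong refl) (subst nn_integral_multc, auto)
    finally show ?thesis
      unfolding inner by (simp only: sum_distrib_left mult.assoc)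
  qed
  \<comment> \<open>The events \<open>K p\<close> are disjoint with union \<open>H\<close>. Of the
    square of \<open>heat m (X m)\<close> one factor is cancelled by the density of
    \<open>M\<close>; the other is at most \<open>heat m 0\<close>, the source of this constant in
    the upper bound.\<close>
  have sumA: "(\<integral>\<^sup>+w. (\<Sum>p\<in>G\<times>G'. A p w)\<^sup>2 \<partial>M) \<le> C * emeasure P H"
  proof -
    have S: "(\<Sum>p\<in>G\<times>G'. A p w) = indicator H w * ennreal (heat m (X m w))" if w: "w \<in> space P" for w
    proof -
      have "(\<Sum>p\<in>G\<times>G'. A p w) = (\<Sum>p\<in>G\<times>G'. if U w = p then indicator H w * ennreal (heat m (X m w)) else 0)"
        using w by (intro sum.cong) (auto simp: A_def K_def indicator_def)
      then show ?thesis using fin range[OF w] by simp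
    qed
    have "(\<integral>\<^sup>+w. (\<Sum>p\<in>G\<times>G'. A p w)\<^sup>2 \<partial>M) = (\<integral>\<^sup>+w. ennreal (1 / heat m (X m w)) * (\<Sum>p\<in>G\<times>G'. A p w)\<^sup>2 \<partial>P)"
      unfolding M_def by (rule nn_integral_density) auto
    also have "\<dots> \<le> (\<integral>\<^sup>+w. ennreal C * indicator H w \<partial>P)"
    proof (rule nn_integral_mono)
      fix w assume w: "w \<in> space P"
      have "ennreal (1 / heat m (X m w)) * (ennreal (heat m (X m w)))\<^sup>2 = ennreal (heat m (X m w))"
        using heat_pos[OF m, of "X m w"] by (simp add: power2_eq_square flip: ennreal_mult)
      then show "ennreal (1 / heat m (X m w)) * (\<Sum>p\<in>G\<times>G'. A p w)\<^sup>2 \<le> ennreal C * indicator H w"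
        unfolding S[OF w] using heat_le_zero[OF m, of "X m w"] by (auto simp: C_def indicator_def)
    qed
    also have "\<dots> = C * emeasure P H"
      by (simp add: nn_integral_cmult)
    finally show ?thesis .
  qed
  have "(\<Sum>p\<in>G\<times>G'. \<Sum>q\<in>G\<times>G'. emeasure P (K q) * ?I p q)\<^sup>2
    \<le> 256 * (\<Sum>p\<in>G\<times>G'. \<Sum>q\<in>G\<times>G'. emeasure P (K p) * emeasure P (K q) * heat (r + r + \<bar>fst q - fst p\<bar> + \<bar>snd q - snd p\<bar>) (0 :: real ^ 'd))
        * (\<integral>\<^sup>+w. (\<Sum>p\<in>G\<times>G'. A p w)\<^sup>2 \<partial>M)"
    unfolding Zz[symmetric]
  proof (rule total_bound[OF r A A_le])
    show "(\<integral>\<^sup>+w. A p w \<partial>M) < \<infinity>" for p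
    proof -
      have "(\<integral>\<^sup>+w. A p w \<partial>M) = emeasure P (K p)" using A_int[of "\<lambda>_. 1"] by simp
      then show ?thesis by (metis P.emeasure_finite infinity_ennreal_def top.not_eq_extremum)
    qed
  qed simp
  \<comment> \<open>Lowering the smoothing from \<open>r + r\<close> to \<open>r\<close> gives both
    sides the same kernel, which the later cancellation requires.\<close>
  also have "\<dots> \<le> 256 * (\<Sum>p\<in>G\<times>G'. \<Sum>q\<in>G\<times>G'. emeasure P (K p) * emeasure P (K q) * heat (?D p q) (0 :: real ^ 'd))
      * (C * emeasure P H)"
  proof (intro mult_mono sumA sum_mono mult_left_mono order_refl ennreal_leI)
    fix p q :: "real \<times> real"
    show "heat (r + r + \<bar>fst q - fst p\<bar> + \<bar>snd q - snd p\<bar>) (0 :: real ^ 'd) \<le> heat (?D p q) (0 :: real ^ 'd)"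
      using r by (intro heat_zero_antimono) auto
  qed auto
  finally show ?thesis
    unfolding lhs rhs C_def by (simp add: mult_ac)
qed

subsection \<open>Hitting events\<close>

lemma Inf_image_attained:
  fixes g :: "'a::topological_space \<Rightarrow> real"
  assumes "compact S" "S \<noteq> {}" "continuous_on S g"
  obtains p where "p \<in> S" "Inf (g ` S) = g p" "\<And>q. q \<in> S \<Longrightarrow> g p \<le> g q"
proof -
  obtain p where p: "p \<in> S" "\<And>q. q \<in> S \<Longrightarrow> g p \<le> g q"
    using continuous_attains_inf[OF assms] by blast
  then have "Inf (g ` S) = g p"
    by (intro cInf_eq_minimum) auto
  then show thesis using that p by blast
qed

locale continuous_field =
  fixes P :: "'w measure" and K :: "(real \<times> real) set" and f :: "real \<times> real \<Rightarrow> 'w \<Rightarrow> 'c::euclidean_space" and a :: 'c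
  assumes K: "compact K"
    and measurable_f: "\<And>p. p \<in> K \<Longrightarrow> f p \<in> borel_measurable P"
    and continuous_f: "\<And>w. w \<in> space P \<Longrightarrow> continuous_on K (\<lambda>p. f p w)"
begin

definition hit_set :: "(real \<times> real) set \<Rightarrow> 'w \<Rightarrow> (real \<times> real) set" where
  "hit_set C w = {p\<in>K \<inter> C. f p w = a}"

lemma compact_hit_set: "w \<in> space P \<Longrightarrow> closed C \<Longrightarrow> compact (hit_set C w)"
proof -
  assume "w \<in> space P" "closed C"
  then have "compact (K \<inter> C)" "continuous_on (K \<inter> C) (\<lambda>p. f p w)"
    using K continuous_f by (auto intro: compact_Int_closed continuous_on_subset)
  then have "closed (hit_set C w)"
    unfolding hit_set_def using continuous_closed_preimage_constant[of "K \<inter> C" "\<lambda>p. f p w" a] compact_imp_closed by blast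
  moreover have "hit_set C w \<subseteq> K" by (auto simp: hit_set_def)
  ultimately show ?thesis using K by (metis compact_Int_closed inf.absorb_iff2)
qed

text \<open>A hit is a union over uncountably many points. By continuity it produces arbitrarily
  close approaches along a countable dense set; conversely, by compactness of the image, arbitrarily
  close approaches force a hit.\<close>

lemma hit_measurable:
  assumes "closed C"
  shows "{w\<in>space P. hit_set C w \<noteq> {}} \<in> sets P"
proof -
  have KC: "compact (K \<inter> C)" using K assms by (rule compact_Int_closed)
  obtain D where D: "countable D" "D \<subseteq> K \<inter> C" "K \<inter> C \<subseteq> closure D"
    by (rule separable)
  have "{w\<in>space P. hit_set C w \<noteq> {}} = (\<Inter>n::nat. \<Union>p\<in>D. {w\<in>space P. dist (f p w) a < 1 / Suc n})"
  proof (intro set_eqI iffI)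
    fix w assume "w \<in> {w\<in>space P. hit_set C w \<noteq> {}}"
    then obtain p where w: "w \<in> space P" and p: "p \<in> K \<inter> C" "f p w = a" by (auto simp: hit_set_def)
    have "\<exists>q\<in>D. dist (f q w) a < e" if "0 < e" for e
    proof -
      obtain d where "0 < d" and d: "\<And>q. q \<in> K \<Longrightarrow> dist q p < d \<Longrightarrow> dist (f q w) (f p w) < e"
        using continuous_f[OF w] p \<open>0 < e\<close> unfolding continuous_on_iff by blast
      obtain q where "q \<in> D" "dist q p < d"
        using D(3) p \<open>0 < d\<close> by (meson closure_approachable subsetD)
      then show ?thesis using d D(2) p(2) by blast
    qed
    then show "w \<in> (\<Inter>n::nat. \<Union>p\<in>D. {w\<in>space P. dist (f p w) a < 1 / Suc n})"
      using w by auto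
  next
    fix w assume *: "w \<in> (\<Inter>n::nat. \<Union>p\<in>D. {w\<in>space P. dist (f p w) a < 1 / Suc n})"
    then have w: "w \<in> space P" by auto
    have "closed ((\<lambda>p. f p w) ` (K \<inter> C))"
      by (intro compact_imp_closed compact_continuous_image continuous_on_subset[OF continuous_f[OF w]] KC) auto
    moreover have "a \<in> closure ((\<lambda>p. f p w) ` (K \<inter> C))"
      unfolding closure_approachable
    proof (intro allI impI)
      fix e :: real assume "0 < e"
      then obtain n where "1 / Suc n < e" using nat_approx_posE by blast
      then show "\<exists>y\<in>(\<lambda>p. f p w) ` (K \<inter> C). dist y a < e"
        using * D(2) by (fastforce dest: INT_D[of _ _ _ n] intro: less_trans)
    qed
    ultimately show "w \<in> {w\<in>space P. hit_set C w \<noteq> {}}"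
      using w by (auto simp: hit_set_def)
  qed
  moreover have meas: "{w\<in>space P. dist (f p w) a < 1 / Suc n} \<in> sets P" if "p \<in> D" for p and n :: nat
  proof -
    have [measurable]: "f p \<in> borel_measurable P" using that D(2) measurable_f by blast
    show ?thesis by measurable
  qed
  have "(\<Union>p\<in>D. {w\<in>space P. dist (f p w) a < 1 / Suc n}) \<in> sets P" for n :: nat
    using meas by (intro sets.countable_UN'[OF D(1)]) blast
  then have "(\<Inter>n::nat. \<Union>p\<in>D. {w\<in>space P. dist (f p w) a < 1 / Suc n}) \<in> sets P"
    by (intro sets.countable_INT) blast+
  ultimately show ?thesis by simp
qed

text \<open>First coordinate of the lexicographically smallest hit. The restriction to a set
  \<open>C\<close> serves the measurability of the second coordinate.\<close>

definition first :: "(real \<times> real) set \<Rightarrow> 'w \<Rightarrow> real" where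
  "first C w = (if hit_set C w = {} then 0 else Inf (fst ` hit_set C w))"

lemma first_attained:
  assumes "w \<in> space P" "closed C" "hit_set C w \<noteq> {}"
  obtains p where "p \<in> hit_set C w" "first C w = fst p" "\<And>q. q \<in> hit_set C w \<Longrightarrow> fst p \<le> fst q"
  using Inf_image_attained[OF compact_hit_set[OF assms(1,2)] assms(3) continuous_on_fst[OF continuous_on_id]] assms(3)
  by (auto simp: first_def)

lemma first_measurable:
  assumes C: "closed C"
  shows "first C \<in> borel_measurable P"
proof (subst borel_measurable_iff_le, intro allI)
  fix c :: real
  have C': "closed (C \<inter> {p. fst p \<le> c})"
    using C by (intro closed_Int closed_Collect_le continuous_intros) auto
  \<comment> \<open>The default value 0 puts outcomes without a hit below \<open>c\<close> exactly
    when \<open>0 \<le> c\<close>.\<close>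
  have "{w\<in>space P. first C w \<le> c} = {w\<in>space P. hit_set (C \<inter> {p. fst p \<le> c}) w \<noteq> {}}
      \<union> (if 0 \<le> c then space P - {w\<in>space P. hit_set C w \<noteq> {}} else {})"
  proof (intro set_eqI)
    fix w
    show "w \<in> {w\<in>space P. first C w \<le> c} \<longleftrightarrow> w \<in> {w\<in>space P. hit_set (C \<inter> {p. fst p \<le> c}) w \<noteq> {}}
      \<union> (if 0 \<le> c then space P - {w\<in>space P. hit_set C w \<noteq> {}} else {})"
    proof (cases "w \<in> space P \<and> hit_set C w \<noteq> {}")
      case True
      then obtain p where p: "p \<in> hit_set C w" "first C w = fst p" "\<And>q. q \<in> hit_set C w \<Longrightarrow> fst p \<le> fst q"
        using first_attained[OF _ C] by metis
      have "first C w \<le> c \<longleftrightarrow> hit_set (C \<inter> {p. fst p \<le> c}) w \<noteq> {}"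
        using p by (fastforce simp: hit_set_def)
      then show ?thesis using True by auto
    next
      case False
      then show ?thesis by (auto simp: first_def hit_set_def)
    qed
  qed
  then show "{w\<in>space P. first C w \<le> c} \<in> sets P"
    using hit_measurable[OF C] hit_measurable[OF C'] by auto
qed

definition second :: "'w \<Rightarrow> real" where
  "second w = (if hit_set UNIV w = {} then 0 else Inf (snd ` hit_set {p. fst p = first UNIV w} w))"

lemma second_attained:
  assumes "w \<in> space P" "hit_set UNIV w \<noteq> {}"
  shows "(first UNIV w, second w) \<in> hit_set UNIV w"
    and "q \<in> hit_set UNIV w \<Longrightarrow> fst q = first UNIV w \<Longrightarrow> second w \<le> snd q"
proof -
  have C: "closed {p :: real \<times> real. fst p = first UNIV w}"
    by (intro closed_Collect_eq continuous_intros)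
  obtain p0 where p0: "p0 \<in> hit_set UNIV w" "first UNIV w = fst p0"
    using first_attained[OF assms(1) closed_UNIV assms(2)] by metis
  then have "p0 \<in> hit_set {p. fst p = first UNIV w} w"
    by (simp add: hit_set_def)
  then have "hit_set {p. fst p = first UNIV w} w \<noteq> {}" by blast
  from Inf_image_attained[OF compact_hit_set[OF assms(1) C] this continuous_on_snd[OF continuous_on_id]]
  obtain p where p: "p \<in> hit_set {p. fst p = first UNIV w} w" "second w = snd p"
    "\<And>q. q \<in> hit_set {p. fst p = first UNIV w} w \<Longrightarrow> snd p \<le> snd q"
    using assms(2) by (auto simp: second_def)
  then have "p = (first UNIV w, second w)"
    by (auto simp: hit_set_def prod_eq_iff)
  then show "(first UNIV w, second w) \<in> hit_set UNIV w"
    using p(1) by (auto simp: hit_set_def)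
  show "second w \<le> snd q" if "q \<in> hit_set UNIV w" "fst q = first UNIV w"
    using p(2,3) that by (auto simp: hit_set_def)
qed

text \<open>The vertical line on which \<open>second\<close> is minimized is random, so
  \<open>hit_measurable\<close> cannot be applied to it. Instead, if there is a hit,
  \<open>second w \<le> c\<close> means that the hits in the half-plane below height
  \<open>c\<close> begin no later than all hits do.\<close>

lemma second_measurable: "second \<in> borel_measurable P"
proof (subst borel_measurable_iff_le, intro allI)
  fix c :: real
  let ?C = "{p :: real \<times> real. snd p \<le> c}"
  have C: "closed ?C"
    by (intro closed_Collect_le continuous_intros)
  note [measurable] = first_measurable[OF C] first_measurable[OF closed_UNIV] hit_measurable[OF C] hit_measurable[OF closed_UNIV]
  have "{w\<in>space P. second w \<le> c} = {w\<in>{w\<in>space P. hit_set ?C w \<noteq> {}}. first ?C w \<le> first UNIV w}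
      \<union> (if 0 \<le> c then space P - {w\<in>space P. hit_set UNIV w \<noteq> {}} else {})"
  proof (intro set_eqI)
    fix w
    show "w \<in> {w\<in>space P. second w \<le> c} \<longleftrightarrow> w \<in> {w\<in>{w\<in>space P. hit_set ?C w \<noteq> {}}. first ?C w \<le> first UNIV w}
      \<union> (if 0 \<le> c then space P - {w\<in>space P. hit_set UNIV w \<noteq> {}} else {})"
    proof (cases "w \<in> space P \<and> hit_set UNIV w \<noteq> {}")
      case True
      then have w: "w \<in> space P" and ne: "hit_set UNIV w \<noteq> {}" by auto
      obtain p0 where p0: "p0 \<in> hit_set UNIV w" "first UNIV w = fst p0" "\<And>q. q \<in> hit_set UNIV w \<Longrightarrow> fst p0 \<le> fst q"
        using first_attained[OF w closed_UNIV ne] by metis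
      have "second w \<le> c \<longleftrightarrow> hit_set ?C w \<noteq> {} \<and> first ?C w \<le> first UNIV w"
      proof
        assume le: "second w \<le> c"
        then have in_C: "(first UNIV w, second w) \<in> hit_set ?C w"
          using second_attained(1)[OF w ne] by (auto simp: hit_set_def)
        then have "hit_set ?C w \<noteq> {}" by auto
        from first_attained[OF w C this] in_C show "hit_set ?C w \<noteq> {} \<and> first ?C w \<le> first UNIV w"
          by (metis empty_iff fst_conv)
      next
        assume *: "hit_set ?C w \<noteq> {} \<and> first ?C w \<le> first UNIV w"
        then obtain p where p: "p \<in> hit_set ?C w" "first ?C w = fst p"
          using first_attained[OF w C] by metis
        then have "p \<in> hit_set UNIV w" "snd p \<le> c" by (auto simp: hit_set_def)
        moreover from this have "fst p = first UNIV w" using p0 p(2) * by fastforce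
        ultimately show "second w \<le> c" using second_attained(2)[OF w ne] by fastforce
      qed
      then show ?thesis using True by auto
    next
      case False
      then show ?thesis by (auto simp: second_def hit_set_def)
    qed
  qed
  moreover have "{w\<in>{w\<in>space P. hit_set ?C w \<noteq> {}}. first ?C w \<le> first UNIV w} \<in> sets P"
  proof -
    have "{w\<in>{w\<in>space P. hit_set ?C w \<noteq> {}}. first ?C w \<le> first UNIV w}
      = {w\<in>space P. hit_set ?C w \<noteq> {}} \<inter> {w\<in>space P. first ?C w \<le> first UNIV w}" by auto
    then show ?thesis by simp
  qed
  ultimately show "{w\<in>space P. second w \<le> c} \<in> sets P"
    using hit_measurable[OF closed_UNIV] by auto
qed

lemma measurable_hit_event: "{w\<in>space P. a \<in> (\<lambda>p. f p w) ` K} \<in> sets P"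
proof -
  have "{w\<in>space P. a \<in> (\<lambda>p. f p w) ` K} = {w\<in>space P. hit_set UNIV w \<noteq> {}}"
    by (auto simp: hit_set_def)
  then show ?thesis using hit_measurable[OF closed_UNIV] by simp
qed

lemma measurable_selection:
  assumes "e \<in> K"
  obtains U where "U \<in> borel_measurable P" "\<And>w. w \<in> space P \<Longrightarrow> U w \<in> K"
    "\<And>w. w \<in> space P \<Longrightarrow> a \<in> (\<lambda>p. f p w) ` K \<Longrightarrow> f (U w) w = a"
proof
  let ?U = "\<lambda>w. if w \<in> {w\<in>space P. a \<in> (\<lambda>p. f p w) ` K} then (first UNIV w, second w) else e"
  have hit: "(first UNIV w, second w) \<in> hit_set UNIV w" if "w \<in> space P" "a \<in> (\<lambda>p. f p w) ` K" for w
    using that by (intro second_attained) (auto simp: hit_set_def)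
  note [measurable] = first_measurable[OF closed_UNIV] second_measurable measurable_hit_event
  show "?U \<in> borel_measurable P"
    by (intro measurable_If_set borel_measurable_Pair) auto
  show "?U w \<in> K" if "w \<in> space P" for w
    using hit[OF that] assms by (auto simp: hit_set_def)
  show "f (?U w) w = a" if "w \<in> space P" "a \<in> (\<lambda>p. f p w) ` K" for w
    using hit[OF that] that by (auto simp: hit_set_def)
qed

end

section \<open>Rounding times to grids\<close>

definition round_down :: "real \<Rightarrow> nat \<Rightarrow> real \<Rightarrow> real" where
  "round_down c n x = c + of_int \<lfloor>(x - c) * real (Suc n)\<rfloor> / real (Suc n)"

text \<open>The grid is anchored at \<open>c\<close>, so rounding down does not leave
  \<open>[c, \<infinity>)\<close>. With \<open>c = m\<close> the rounded times of \<open>X\<close>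
  stay where the reweighted field is available.\<close>

lemma round_down_ge: "c \<le> x \<Longrightarrow> c \<le> round_down c n x"
  by (simp add: round_down_def)

lemma round_down_le: "round_down c n x \<le> x"
proof -
  have "of_int \<lfloor>(x - c) * real (Suc n)\<rfloor> / real (Suc n) \<le> x - c"
    by (subst pos_divide_le_eq) (auto intro: of_int_floor_le)
  then show ?thesis by (simp add: round_down_def)
qed

lemma round_down_gt: "x - 1 / real (Suc n) < round_down c n x"
proof -
  have "(x - c) * real (Suc n) < of_int \<lfloor>(x - c) * real (Suc n)\<rfloor> + 1" by linarith
  then have "x - c < (of_int \<lfloor>(x - c) * real (Suc n)\<rfloor> + 1) / real (Suc n)"
    by (subst pos_less_divide_eq) auto
  then show ?thesis by (simp add: round_down_def add_divide_distrib)
qed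

lemma round_down_tendsto: "(\<lambda>n. round_down c n x) \<longlonglongrightarrow> x"
proof (rule tendsto_sandwich[where f = "\<lambda>n. x - 1 / real (Suc n)" and h = "\<lambda>_. x"])
  show "(\<lambda>n. x - 1 / real (Suc n)) \<longlonglongrightarrow> x"
    using tendsto_diff[OF tendsto_const[of x] LIMSEQ_Suc[OF lim_1_over_n]] by simp
qed (use less_imp_le[OF round_down_gt[of x _ c]] in \<open>auto intro!: always_eventually round_down_le simp del: of_nat_Suc\<close>)

lemma finite_round_down: "finite (round_down c n ` {c..L})"
proof (rule finite_subset)
  show "round_down c n ` {c..L} \<subseteq> (\<lambda>k. c + of_int k / real (Suc n)) ` {0..\<lfloor>(L - c) * real (Suc n)\<rfloor>}"
    by (auto simp: round_down_def intro!: imageI floor_mono mult_right_mono)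
qed simp

lemma borel_measurable_round_down [measurable]: "round_down c n \<in> borel_measurable borel"
  unfolding round_down_def[abs_def] by measurable

lemma borel_measurable_heat_compose [measurable]:
  fixes g :: "'a \<Rightarrow> real ^ 'd::finite"
  assumes [measurable]: "f \<in> borel_measurable M" "g \<in> borel_measurable M"
  shows "(\<lambda>w. heat (f w) (g w)) \<in> borel_measurable M"
  unfolding heat_Basis normal_density_def by measurable

lemma borel_measurable_fst_snd:
  fixes f :: "'a \<Rightarrow> real \<times> real"
  assumes "f \<in> borel_measurable M"
  shows "(\<lambda>w. fst (f w)) \<in> borel_measurable M" "(\<lambda>w. snd (f w)) \<in> borel_measurable M"
  using assms by (auto intro!: measurable_compose[OF assms borel_measurable_continuous_onI] continuous_intros)

lemma heat_le_heat_zero: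
  fixes x :: "real ^ 'd::finite"
  assumes "0 < r" "r \<le> q"
  shows "heat q x \<le> heat r (0 :: real ^ 'd)"
  using heat_le_zero[of q x] heat_zero_antimono[OF assms, where 'd = 'd] assms by simp

lemma additive_brownian_field:
  fixes X Y :: "real \<Rightarrow> 'w \<Rightarrow> real ^ 'd::finite"
  assumes BX: "brownian_motion P X" and BY: "brownian_motion P Y"
    and E: "compact E" "E \<subseteq> {0..} \<times> {0..}"
  shows "continuous_field P E (additive_process X Y)"
proof
  show "compact E" by fact
  show "additive_process X Y p \<in> borel_measurable P" if "p \<in> E" for p
  proof -
    have "0 \<le> fst p" "0 \<le> snd p" using that E(2) by auto
    from borel_measurable_add[OF brownian_motionD(2)[OF BX this(1)] brownian_motionD(2)[OF BY this(2)]]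
    show ?thesis by (simp add: additive_process_def split_beta)
  qed
  show "continuous_on E (\<lambda>p. additive_process X Y p w)" if "w \<in> space P" for w
  proof -
    have "continuous_on E (\<lambda>p. X (fst p) w + Y (snd p) w)"
      using E(2)
      by (intro continuous_on_add continuous_on_compose2[OF brownian_motionD(4)[OF BX that]]
          continuous_on_compose2[OF brownian_motionD(4)[OF BY that]] continuous_on_fst continuous_on_snd continuous_on_id) auto
    then show ?thesis by (simp add: additive_process_def split_beta)
  qed
qed

text \<open>\<open>finite_range_bound\<close> is applied to \<open>U\<close> rounded down to finer
  and finer grids. In the limit the position error vanishes on \<open>H\<close> by continuity of the
  paths, and both sides contain the same number \<open>J\<close>; from
  \<open>J * J \<le> c * J\<close> and \<open>J < top\<close> follows \<open>J \<le> c\<close>.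
  Since \<open>r > 0\<close>, the kernel is bounded, which gives dominated convergence as well as
  finiteness of \<open>J\<close>.\<close>

lemma hitting_energy_bound:
  fixes X Y :: "real \<Rightarrow> 'w \<Rightarrow> real ^ 'd::finite" and U :: "'w \<Rightarrow> real \<times> real"
  assumes BX: "brownian_motion P X" and BY: "brownian_motion P Y" and ind: "indep_processes P X Y"
    and m: "0 < m" and E: "compact E" "E \<subseteq> {m..} \<times> {0..}" and r: "0 < r"
    and H [measurable]: "H \<in> sets P" and U [measurable]: "U \<in> borel_measurable P"
    and UE: "\<And>w. w \<in> space P \<Longrightarrow> U w \<in> E"
    and hit: "\<And>w. w \<in> H \<Longrightarrow> additive_process X Y (U w) w = a"
  shows "(\<integral>\<^sup>+w. indicator H w * (\<integral>\<^sup>+w'. indicator H w' *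
      ennreal (heat (r + \<bar>fst (U w') - fst (U w)\<bar> + \<bar>snd (U w') - snd (U w)\<bar>) (0 :: real ^ 'd)) \<partial>P) \<partial>P)
    \<le> 256 * ennreal (heat m (0 :: real ^ 'd)) * emeasure P H"
proof -
  interpret P: prob_space P by (rule brownian_motionD[OF BX])
  obtain L where L: "E \<subseteq> {m..L} \<times> {0..L}"
  proof -
    obtain B where B: "\<And>p. p \<in> E \<Longrightarrow> norm p \<le> B"
      using compact_imp_bounded[OF E(1)] by (auto simp: bounded_iff)
    have "fst p \<le> B \<and> snd p \<le> B" if "p \<in> E" for p
      using B[OF that] norm_fst_le[of p "p"] norm_fst_le[of "fst p" "snd p"] norm_snd_le[of "snd p" "fst p"] by auto
    then show thesis using E(2) by (intro that[of B]) force
  qed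
  define V where "V n w = (round_down m n (fst (U w)), round_down 0 n (snd (U w)))" for n w
  define G where "G n = round_down m n ` {m..L}" for n
  define G' where "G' n = round_down 0 n ` {0..L}" for n
  have G: "finite (G n)" "G n \<subseteq> {m..}" and G': "finite (G' n)" "G' n \<subseteq> {0..}" for n
    by (auto simp: G_def G'_def finite_round_down round_down_ge)
  have V [measurable]: "V n \<in> borel_measurable P" for n
    unfolding V_def[abs_def]
    by (intro borel_measurable_Pair measurable_compose[OF _ borel_measurable_round_down]
        borel_measurable_fst_snd[OF U])
  have range: "V n w \<in> G n \<times> G' n" if "w \<in> space P" for n w
    using UE[OF that] L by (force simp: V_def G_def G'_def)
  have Xm: "X t \<in> borel_measurable P" "Y t \<in> borel_measurable P" if "0 \<le> t" for t
    using that by (auto intro: brownian_motionD[OF BX] brownian_motionD[OF BY])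
  have meas_count: "(\<lambda>w. fst (V n w)) \<in> measurable P (count_space (G n))"
    "(\<lambda>w. snd (V n w)) \<in> measurable P (count_space (G' n))" for n
    unfolding measurable_count_space_eq2[OF G(1)] measurable_count_space_eq2[OF G'(1)]
    using range[of _ n] by (auto simp: mem_Times_iff intro!: measurable_sets[OF borel_measurable_fst_snd(1)[OF V]] measurable_sets[OF borel_measurable_fst_snd(2)[OF V]])
  \<comment> \<open>A process at a random time is measurable here because the time takes only
    finitely many values.\<close>
  have [measurable]: "(\<lambda>w. X (fst (V n w)) w) \<in> borel_measurable P" for n
  proof (rule measurable_compose_countable'[where f = X and I = "G n", OF _ meas_count(1) countable_finite[OF G(1)]])
    fix s assume "s \<in> G n"
    then have "0 \<le> s" using G(2)[of n] m by auto
    then show "X s \<in> borel_measurable P" by (rule Xm)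
  qed
  have [measurable]: "(\<lambda>w. Y (snd (V n w)) w) \<in> borel_measurable P" for n
  proof (rule measurable_compose_countable'[where f = Y and I = "G' n", OF _ meas_count(2) countable_finite[OF G'(1)]])
    fix t assume "t \<in> G' n"
    then have "0 \<le> t" using G'(2)[of n] by auto
    then show "Y t \<in> borel_measurable P" by (rule Xm)
  qed
  define W where "W n w = X (fst (V n w)) w + Y (snd (V n w)) w - a" for n w
  have [measurable]: "W n \<in> borel_measurable P" for n
    unfolding W_def[abs_def] by measurable
  define D :: "real \<times> real \<Rightarrow> real \<times> real \<Rightarrow> real" where
    "D u v = r + \<bar>fst v - fst u\<bar> + \<bar>snd v - snd u\<bar>" for u v
  have D_ge: "r \<le> D u v" for u v by (simp add: D_def)
  have [measurable]: "(\<lambda>w. D (f w) (g w)) \<in> borel_measurable N"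
    if [measurable]: "f \<in> borel_measurable N" "g \<in> borel_measurable N" for f g and N :: "'x measure"
    unfolding D_def using borel_measurable_fst_snd[OF that(1)] borel_measurable_fst_snd[OF that(2)] by measurable
  define C where "C = heat r (0 :: real ^ 'd)"
  have heat_C: "ennreal (heat (D u v) x) \<le> C" for u v and x :: "real ^ 'd"
    unfolding C_def by (intro ennreal_leI heat_le_heat_zero r D_ge)
  have V_lim: "(\<lambda>n. fst (V n w)) \<longlonglongrightarrow> fst (U w)" "(\<lambda>n. snd (V n w)) \<longlonglongrightarrow> snd (U w)" for w
    by (simp_all add: V_def round_down_tendsto)
  have D_lim: "(\<lambda>n. D (V n w) (V n w')) \<longlonglongrightarrow> D (U w) (U w')" for w w'
    unfolding D_def by (intro tendsto_intros V_lim)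
  have W_lim: "(\<lambda>n. W n w) \<longlonglongrightarrow> 0" if "w \<in> H" for w
  proof -
    have w: "w \<in> space P" using that sets.sets_into_space[OF H] by auto
    have pos: "0 \<le> fst (V n w)" "0 \<le> snd (V n w)" "0 \<le> fst (U w)" "0 \<le> snd (U w)" for n
    proof -
      have "V n w \<in> {m..} \<times> {0..}"
        by (rule subsetD[OF Sigma_mono[OF G(2) G'(2)] range[OF w]])
      moreover have "U w \<in> {m..} \<times> {0..}"
        by (rule subsetD[OF E(2) UE[OF w]])
      ultimately show "0 \<le> fst (V n w)" "0 \<le> snd (V n w)" "0 \<le> fst (U w)" "0 \<le> snd (U w)"
        using m by (auto simp: mem_Times_iff)
    qed
    have "(\<lambda>n. X (fst (V n w)) w) \<longlonglongrightarrow> X (fst (U w)) w"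
      using pos by (intro continuous_on_tendsto_compose[OF brownian_motionD(4)[OF BX w] V_lim(1)]) auto
    moreover have "(\<lambda>n. Y (snd (V n w)) w) \<longlonglongrightarrow> Y (snd (U w)) w"
      using pos by (intro continuous_on_tendsto_compose[OF brownian_motionD(4)[OF BY w] V_lim(2)]) auto
    ultimately have "(\<lambda>n. W n w) \<longlonglongrightarrow> X (fst (U w)) w + Y (snd (U w)) w - a"
      unfolding W_def by (intro tendsto_intros)
    then show ?thesis using hit[OF that] by (simp add: additive_process_def split_beta)
  qed
  let ?I = "\<lambda>\<theta> u w. \<integral>\<^sup>+w'. indicator H w' * ennreal (heat (D (u w) (u w')) (\<theta> w :: real ^ 'd)) \<partial>P"
  define \<Phi> where "\<Phi> \<theta> u = (\<integral>\<^sup>+w. indicator H w * ?I \<theta> u w \<partial>P)"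
    for \<theta> u
  \<comment> \<open>Applied with \<open>\<theta> = W\<close> for the left side and with
    \<open>\<theta> = 0\<close> for the right; dominated convergence is used in the inner and in the
    outer integral.\<close>
  have lim: "(\<lambda>n. \<Phi> (\<theta> n) (V n)) \<longlonglongrightarrow> \<Phi> (\<lambda>_. 0) U"
    if \<theta> [measurable]: "\<And>n. \<theta> n \<in> borel_measurable P" and w0: "\<And>w. w \<in> H \<Longrightarrow> (\<lambda>n. \<theta> n w) \<longlonglongrightarrow> 0" for \<theta>
    unfolding \<Phi>_def
  proof (rule nn_integral_dominated_convergence[where w = "\<lambda>_. ennreal C"])
    show "AE w in P. indicator H w * ?I (\<theta> j) (V j) w \<le> ennreal C" for j
    proof (intro AE_I2)
      fix w
      have "?I (\<theta> j) (V j) w \<le> (\<integral>\<^sup>+w'. ennreal C \<partial>P)"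
        using heat_C by (intro nn_integral_mono) (auto simp: indicator_def)
      then show "indicator H w * ?I (\<theta> j) (V j) w \<le> ennreal C"
        by (auto simp: indicator_def P.emeasure_space_1)
    qed
    show "AE w in P. (\<lambda>n. indicator H w * ?I (\<theta> n) (V n) w)
      \<longlonglongrightarrow> indicator H w * ?I (\<lambda>_. 0) U w"
    proof (intro AE_I2)
      fix w assume "w \<in> space P"
      show "(\<lambda>n. indicator H w * ?I (\<theta> n) (V n) w)
        \<longlonglongrightarrow> indicator H w * ?I (\<lambda>_. 0) U w"
      proof (cases "w \<in> H")
        case True
        have "(\<lambda>n. ?I (\<theta> n) (V n) w)
          \<longlonglongrightarrow> ?I (\<lambda>_. 0) U w"
        proof (rule nn_integral_dominated_convergence[where w = "\<lambda>_. ennreal C"])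
          show "AE w' in P. indicator H w' * ennreal (heat (D (V j w) (V j w')) (\<theta> j w)) \<le> ennreal C" for j
            using heat_C by (intro AE_I2) (auto simp: indicator_def)
          show "AE w' in P. (\<lambda>n. indicator H w' * ennreal (heat (D (V n w) (V n w')) (\<theta> n w)))
            \<longlonglongrightarrow> indicator H w' * ennreal (heat (D (U w) (U w')) (0 :: real ^ 'd))"
          proof (intro AE_I2 ennreal_tendsto_cmult tendsto_ennrealI tendsto_heat D_lim w0 True)
            show "0 < D (U w) (U w')" for w' using D_ge[of "U w" "U w'"] r by linarith
          qed (auto simp: indicator_def)
        qed (auto simp: P.emeasure_space_1)
        then show ?thesis using True by simp
      qed simp
    qed
  qed (auto simp: P.emeasure_space_1)
  define J where "J = \<Phi> (\<lambda>_. 0) U"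
  define c where "c = 256 * ennreal (heat m (0 :: real ^ 'd)) * emeasure P H"
  have c_fin: "c < top"
  proof -
    have "emeasure P H < top"
      by (metis P.emeasure_finite infinity_ennreal_def top.not_eq_extremum)
    then show ?thesis by (simp add: c_def ennreal_mult_less_top)
  qed
  have le: "(\<Phi> (W n) (V n))\<^sup>2 \<le> c * \<Phi> (\<lambda>_. 0) (V n)" for n
    using finite_range_bound[OF BX BY ind m G(1,2)[of n] G'(1,2)[of n] r H V range, where a = a]
    unfolding \<Phi>_def c_def D_def W_def by simp
  have \<Phi>_fin: "\<Phi> \<theta> u < top" for \<theta> u
  proof -
    have "\<Phi> \<theta> u \<le> (\<integral>\<^sup>+w. ennreal C \<partial>P)"
      unfolding \<Phi>_def
    proof (rule nn_integral_mono)
      fix w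
      have "?I \<theta> u w \<le> (\<integral>\<^sup>+w'. ennreal C \<partial>P)"
        using heat_C by (intro nn_integral_mono) (auto simp: indicator_def)
      then show "indicator H w * ?I \<theta> u w \<le> ennreal C"
        by (auto simp: indicator_def P.emeasure_space_1)
    qed
    also have "\<dots> < top" by (simp add: P.emeasure_space_1)
    finally show ?thesis .
  qed
  have J_fin: "J < top" unfolding J_def by (rule \<Phi>_fin)
  have "(\<lambda>n. \<Phi> (W n) (V n)) \<longlonglongrightarrow> J" "(\<lambda>n. \<Phi> (\<lambda>_. 0) (V n)) \<longlonglongrightarrow> J"
    unfolding J_def by (rule lim, auto simp: W_lim)+
  \<comment> \<open>The limit of the product inequality is taken over the reals, where
    multiplication is continuous; all quantities are finite.\<close>
  then have "(\<lambda>n. enn2real (\<Phi> (W n) (V n)) ^ 2) \<longlonglongrightarrow> enn2real J ^ 2"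
    "(\<lambda>n. enn2real c * enn2real (\<Phi> (\<lambda>_. 0) (V n))) \<longlonglongrightarrow> enn2real c * enn2real J"
    using J_fin by (auto intro!: tendsto_power tendsto_mult tendsto_const tendsto_enn2real)
  moreover have "enn2real (\<Phi> (W n) (V n)) ^ 2 \<le> enn2real c * enn2real (\<Phi> (\<lambda>_. 0) (V n))" for n
  proof -
    have "c * \<Phi> (\<lambda>_. 0) (V n) < top"
      using c_fin \<Phi>_fin by (simp add: ennreal_mult_less_top)
    from enn2real_mono[OF le this] show ?thesis
      by (simp add: power2_eq_square enn2real_mult)
  qed
  ultimately have "enn2real J ^ 2 \<le> enn2real c * enn2real J"
    by (intro LIMSEQ_le) auto
  then have "ennreal (enn2real J ^ 2) \<le> ennreal (enn2real c * enn2real J)"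
    by (rule ennreal_leI)
  then have "J * J \<le> c * J"
    using J_fin c_fin by (simp add: ennreal_mult power2_eq_square)
  then have "J * J \<le> J * c" by (metis mult.commute)
  then have "J \<le> c"
    using J_fin ennreal_mult_le_mult_iff[of J J c] by (cases "J = 0") auto
  then show ?thesis
    unfolding J_def \<Phi>_def c_def D_def .
qed

subsection \<open>Energy and capacity\<close>

lemma Basis_real_prod: "(Basis :: (real \<times> real) set) = {(1, 0), (0, 1)}"
  by (auto simp: Basis_prod_def)

lemma infnorm_real_prod: "infnorm (p :: real \<times> real) = max \<bar>fst p\<bar> \<bar>snd p\<bar>"
  unfolding infnorm_Max Basis_real_prod by (cases p) (simp add: inner_prod_def)

lemma sum_norm_le_infnorm: "\<bar>fst p\<bar> + \<bar>snd p\<bar> \<le> 2 * infnorm (p :: real \<times> real)"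
  unfolding infnorm_real_prod by linarith

lemma borel_measurable_infnorm [measurable]: "infnorm \<in> borel_measurable (borel :: 'a::euclidean_space measure)"
  by (intro borel_measurable_continuous_onI continuous_on_infnorm continuous_on_id)

lemma inverse_antimono_ennreal: "a \<le> b \<Longrightarrow> inverse b \<le> inverse (a :: ennreal)"
  including ennreal.lifting
  by transfer (rule ereal_inverse_antimono)

definition riesz :: "real \<Rightarrow> 'a::euclidean_space \<Rightarrow> ennreal" where
  "riesz \<beta> x = inverse (ennreal (infnorm x powr \<beta>))"

lemma energy_riesz: "energy \<beta> \<sigma> = (\<integral>\<^sup>+ s. \<integral>\<^sup>+ t. riesz \<beta> (s - t) \<partial>\<sigma> \<partial>\<sigma>)"
  by (simp add: energy_def riesz_def)

lemma borel_measurable_riesz [measurable]: "riesz \<beta> \<in> borel_measurable (borel :: 'a::euclidean_space measure)"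
  unfolding riesz_def[abs_def] by measurable

text \<open>Without smoothing, the kernel is \<open>2 * pi * x\<close> to the power
  \<open>-d/2\<close>, with \<open>x\<close> the sum of the coordinate distances;
  \<open>x \<le> 2 * infnorm p\<close> turns \<open>2 * pi\<close> into \<open>4 * pi\<close>.
  Working in \<open>ennreal\<close> includes \<open>p = 0\<close>, where both sides are
  infinite.\<close>

lemma riesz_le_liminf_heat:
  fixes p :: "real \<times> real"
  shows "riesz (real CARD('d) / 2) p \<le> ennreal ((4 * pi) powr (real CARD('d) / 2)) *
    liminf (\<lambda>n. ennreal (heat (1 / real (Suc n) + (\<bar>fst p\<bar> + \<bar>snd p\<bar>)) (0 :: real ^ 'd::finite)))"
proof -
  define \<beta> where "\<beta> = real CARD('d) / 2"
  have \<beta>: "0 < \<beta>" by (simp add: \<beta>_def)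
  define x where "x = \<bar>fst p\<bar> + \<bar>snd p\<bar>"
  have x: "0 \<le> x" by (simp add: x_def)
  have heat: "ennreal (heat (1 / real (Suc n) + x) (0 :: real ^ 'd)) = inverse (ennreal ((2 * pi * (1 / real (Suc n) + x)) powr \<beta>))" for n
  proof -
    have pos: "0 < 1 / real (Suc n) + x" using x by (simp add: add_pos_nonneg)
    then have "0 < (2 * pi * (1 / real (Suc n) + x)) powr \<beta>" by simp
    then show ?thesis
      using heat_zero_powr[OF pos, where 'd = 'd] by (simp add: \<beta>_def inverse_ennreal inverse_eq_divide)
  qed
  have "(\<lambda>n. 1 / real (Suc n) + x) \<longlonglongrightarrow> 0 + x"
    by (intro tendsto_add tendsto_const LIMSEQ_Suc[OF lim_1_over_n])
  then have "(\<lambda>n. (2 * pi * (1 / real (Suc n) + x)) powr \<beta>) \<longlonglongrightarrow> (2 * pi * x) powr \<beta>"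
    using \<beta> x by (intro tendsto_powr' tendsto_mult tendsto_const) (auto intro!: always_eventually)
  then have lim: "(\<lambda>n. inverse (ennreal ((2 * pi * (1 / real (Suc n) + x)) powr \<beta>))) \<longlonglongrightarrow> inverse (ennreal ((2 * pi * x) powr \<beta>))"
    by (intro continuous_on_tendsto_compose[OF continuous_on_inverse_ennreal[OF continuous_on_id, of UNIV]] tendsto_ennrealI; simp)
  have "liminf (\<lambda>n. ennreal (heat (1 / real (Suc n) + x) (0 :: real ^ 'd))) = inverse (ennreal ((2 * pi * x) powr \<beta>))"
    unfolding heat by (rule lim_imp_Liminf[OF sequentially_bot lim])
  moreover have "riesz \<beta> p \<le> ennreal ((4 * pi) powr \<beta>) * inverse (ennreal ((2 * pi * x) powr \<beta>))"
  proof -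
    let ?c = "(4 * pi) powr \<beta>"
    have c: "0 < ?c" by simp
    have "(2 * pi * x) powr \<beta> \<le> (4 * pi * infnorm p) powr \<beta>"
      using sum_norm_le_infnorm[of p] x \<beta> infnorm_pos_le[of p] by (intro powr_mono2) (auto simp: x_def)
    also have "\<dots> = ?c * infnorm p powr \<beta>"
      using infnorm_pos_le[of p] by (intro powr_mult)
    finally have "ennreal ((2 * pi * x) powr \<beta>) \<le> ennreal ?c * ennreal (infnorm p powr \<beta>)"
      by (simp add: ennreal_leI flip: ennreal_mult)
    then have "inverse (ennreal ?c * ennreal (infnorm p powr \<beta>)) \<le> inverse (ennreal ((2 * pi * x) powr \<beta>))"
      by (rule inverse_antimono_ennreal)
    also have "inverse (ennreal ?c * ennreal (infnorm p powr \<beta>)) = inverse (ennreal ?c) * riesz \<beta> p"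
      unfolding riesz_def by (rule ennreal_inverse_mult) auto
    finally have "ennreal ?c * (inverse (ennreal ?c) * riesz \<beta> p) \<le> ennreal ?c * inverse (ennreal ((2 * pi * x) powr \<beta>))"
      by (rule mult_left_mono) simp
    moreover have "ennreal ?c * inverse (ennreal ?c) = 1"
      using c by (simp add: inverse_ennreal flip: ennreal_mult)
    ultimately show ?thesis by (simp add: mult.assoc[symmetric])
  qed
  ultimately show ?thesis by (simp add: \<beta>_def x_def)
qed

lemma capacity_ge: "\<sigma> \<in> prob_measures_on E \<Longrightarrow> inverse (energy \<beta> \<sigma>) \<le> capacity \<beta> E"
  unfolding capacity_def by (intro inverse_antimono_ennreal INF_lower)

text \<open>Pushing a measure forward along \<open>f\<close> preserves its energy. This serves the
  inclusion of a part of \<open>E\<close> as well as the exchange of the two coordinates.\<close>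

lemma capacity_mono_isometry:
  fixes f :: "'a::euclidean_space \<Rightarrow> 'b::euclidean_space"
  assumes f: "f \<in> borel_measurable borel" and iso: "\<And>x y. infnorm (f x - f y) = infnorm (x - y)"
    and sub: "f ` E \<subseteq> E'" and E: "E \<in> sets borel" and E': "E' \<in> sets borel"
  shows "capacity \<beta> E \<le> capacity \<beta> E'"
  unfolding capacity_def
proof (rule inverse_antimono_ennreal, rule INF_greatest)
  fix \<sigma> :: "'a measure" assume \<sigma>: "\<sigma> \<in> prob_measures_on E"
  then have sets: "sets \<sigma> = sets (restrict_space borel E)" and "prob_space \<sigma>"
    by (auto simp: prob_measures_on_def)
  interpret \<sigma>: prob_space \<sigma> by fact
  have space: "space \<sigma> = E"
    using sets_eq_imp_space_eq[OF sets] by (simp add: space_restrict_space)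
  have fE: "f \<in> measurable \<sigma> (restrict_space borel E')"
  proof -
    have "f \<in> measurable (restrict_space borel E) (restrict_space borel E')"
      using sub f by (intro measurable_restrict_space3) auto
    then show ?thesis by (simp add: measurable_cong_sets[OF sets refl])
  qed
  let ?\<tau> = "distr \<sigma> (restrict_space borel E') f"
  have "prob_space ?\<tau>" by (rule \<sigma>.prob_space_distr[OF fE])
  then have mem: "?\<tau> \<in> prob_measures_on E'" by (simp add: prob_measures_on_def)
  interpret \<tau>: prob_space ?\<tau> by fact
  have id: "(\<lambda>x. x) \<in> measurable (restrict_space borel E') (borel :: 'b measure)"
    by (rule measurable_restrict_space1) simp
  have "energy \<beta> ?\<tau> = (\<integral>\<^sup>+ x. \<integral>\<^sup>+ v. riesz \<beta> (f x - v) \<partial>?\<tau> \<partial>\<sigma>)"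
  proof -
    have "(\<lambda>z. riesz \<beta> (fst z - snd z)) \<in> borel_measurable (restrict_space borel E' \<Otimes>\<^sub>M ?\<tau>)"
      using id by measurable
    from \<tau>.borel_measurable_nn_integral_fst[OF this]
    have "(\<lambda>u. \<integral>\<^sup>+ v. riesz \<beta> (u - v) \<partial>?\<tau>) \<in> borel_measurable ?\<tau>" by simp
    then show ?thesis
      unfolding energy_riesz by (rule nn_integral_distr[OF fE])
  qed
  also have "\<dots> = (\<integral>\<^sup>+ x. \<integral>\<^sup>+ y. riesz \<beta> (f x - f y) \<partial>\<sigma> \<partial>\<sigma>)"
  proof (rule nn_integral_cong)
    fix x
    have "(\<lambda>v. riesz \<beta> (f x - v)) \<in> borel_measurable ?\<tau>"
      using id by measurable
    then show "(\<integral>\<^sup>+ v. riesz \<beta> (f x - v) \<partial>?\<tau>) = (\<integral>\<^sup>+ y. riesz \<beta> (f x - f y) \<partial>\<sigma>)"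
      by (rule nn_integral_distr[OF fE])
  qed
  also have "\<dots> = energy \<beta> \<sigma>"
    unfolding energy_riesz riesz_def by (simp add: iso)
  finally show "Inf (energy \<beta> ` prob_measures_on E') \<le> energy \<beta> \<sigma>"
    using INF_lower[OF mem, of "energy \<beta>"] by simp
qed

subsection \<open>The upper bound\<close>

text \<open>Division by \<open>e\<close> at the extreme values: \<open>e = 0\<close> makes the right
  side infinite because \<open>K\<close> is positive, and \<open>e = top\<close> forces
  \<open>h = 0\<close> because \<open>K\<close> is finite.\<close>

lemma le_mult_inverse_ennreal:
  fixes h e K :: ennreal
  assumes "h * e \<le> K" "0 < K" "K < top"
  shows "h \<le> K * inverse e"
proof (cases "e = 0 \<or> e = top")
  case True
  then show ?thesis using assms by (auto simp: ennreal_mult_top top_unique split: if_splits)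
next
  case False
  then have "e * inverse e = 1"
    using ennreal_divide_self[of e] by (simp add: divide_ennreal_def less_top[symmetric])
  then have "h = h * e * inverse e"
    by (simp add: mult.assoc)
  also have "\<dots> \<le> K * inverse e" by (rule mult_right_mono[OF assms(1)]) simp
  finally show ?thesis .
qed

text \<open>The double integral of the Riesz kernel over the hitting event is at most
  \<open>A * c * h\<close>, and conditioning on this event of probability \<open>h\<close> divides
  it by \<open>h\<close> twice. So the law of the selected point has energy at most
  \<open>A * c / h\<close>, which is solved for \<open>h\<close>. For \<open>h = 0\<close> there is
  nothing to condition on.\<close>

lemma hitting_upper:
  fixes X Y :: "real \<Rightarrow> 'w \<Rightarrow> real ^ 'd::finite"
  assumes BX: "brownian_motion P X" and BY: "brownian_motion P Y" and ind: "indep_processes P X Y"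
    and m: "0 < m" and E: "compact E" "E \<subseteq> {m..} \<times> {0..}"
  shows "emeasure P {w\<in>space P. a \<in> (\<lambda>p. additive_process X Y p w) ` E}
    \<le> ennreal ((4 * pi) powr (real CARD('d) / 2) * (256 * heat m (0 :: real ^ 'd))) * capacity (real CARD('d) / 2) E"
proof (cases "emeasure P {w\<in>space P. a \<in> (\<lambda>p. additive_process X Y p w) ` E} = 0")
  case True
  then show ?thesis by simp
next
  case False
  interpret P: prob_space P by (rule brownian_motionD[OF BX])
  have E0: "E \<subseteq> {0..} \<times> {0..}" using E(2) m by force
  interpret continuous_field P E "additive_process X Y" a
    by (rule additive_brownian_field[OF BX BY E(1) E0])
  define H where "H = {w\<in>space P. a \<in> (\<lambda>p. additive_process X Y p w) ` E}"
  define \<beta> where "\<beta> = real CARD('d) / 2"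
  have H [measurable]: "H \<in> sets P"
    unfolding H_def by (rule measurable_hit_event)
  have "H \<noteq> {}" using False by (auto simp: H_def[symmetric])
  then obtain e where "e \<in> E" by (auto simp: H_def)
  then obtain U where U [measurable]: "U \<in> borel_measurable P" and UE: "\<And>w. w \<in> space P \<Longrightarrow> U w \<in> E"
    and UH: "\<And>w. w \<in> H \<Longrightarrow> additive_process X Y (U w) w = a"
    by (rule measurable_selection) (auto simp: H_def)
  define h where "h = emeasure P H"
  have h: "h \<noteq> 0" "h < top"
    using False P.emeasure_finite[of H] top.not_eq_extremum unfolding h_def H_def infinity_ennreal_def by blast+
  define c where "c = 256 * ennreal (heat m (0 :: real ^ 'd))"
  define A where "A = ennreal ((4 * pi) powr \<beta>)"
  define k where "k n w w' = ennreal (heat (1 / real (Suc n) + \<bar>fst (U w') - fst (U w)\<bar> + \<bar>snd (U w') - snd (U w)\<bar>) (0 :: real ^ 'd))"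
    for n w w'
  note [measurable] = borel_measurable_fst_snd[OF U]
  have k [measurable]: "(\<lambda>w. k n (f w) (g w)) \<in> borel_measurable N"
    if [measurable]: "f \<in> measurable N P" "g \<in> measurable N P" for f g n and N :: "'x measure"
    unfolding k_def using measurable_compose[OF that(1) borel_measurable_fst_snd(1)[OF U]]
      measurable_compose[OF that(1) borel_measurable_fst_snd(2)[OF U]]
      measurable_compose[OF that(2) borel_measurable_fst_snd(1)[OF U]]
      measurable_compose[OF that(2) borel_measurable_fst_snd(2)[OF U]] by measurable
  have bound: "(\<integral>\<^sup>+w. indicator H w * (\<integral>\<^sup>+w'. indicator H w' * k n w w' \<partial>P) \<partial>P) \<le> c * h" for n
    unfolding k_def c_def h_def by (rule hitting_energy_bound[OF BX BY ind m E _ H U UE UH]) auto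
  have riesz_le: "riesz \<beta> (U w - U w') \<le> A * liminf (\<lambda>n. k n w w')" for w w'
    using riesz_le_liminf_heat[of "U w - U w'", where 'd = 'd]
    unfolding A_def k_def \<beta>_def by (simp add: abs_minus_commute add.assoc)
  have ind_liminf: "indicator H w * liminf u = liminf (\<lambda>n. indicator H w * u n)" for w and u :: "nat \<Rightarrow> ennreal"
    by (cases "w \<in> H") (simp_all add: Liminf_const)
  let ?L = "\<lambda>w. (\<integral>\<^sup>+w'. indicator H w' * liminf (\<lambda>n. k n w w') \<partial>P)" and ?K = "\<lambda>n w. (\<integral>\<^sup>+w'. indicator H w' * k n w w' \<partial>P)"
  \<comment> \<open>Fatou's lemma in the inner and then in the outer integral removes the smoothing
    \<open>1 / real (Suc n)\<close>.\<close>
  have "(\<integral>\<^sup>+w. indicator H w * ?L w \<partial>P)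
    \<le> (\<integral>\<^sup>+w. liminf (\<lambda>n. indicator H w * ?K n w) \<partial>P)"
  proof (rule nn_integral_mono)
    fix w assume w [measurable]: "w \<in> space P"
    have "(\<integral>\<^sup>+w'. liminf (\<lambda>n. indicator H w' * k n w w') \<partial>P) \<le> liminf (\<lambda>n. \<integral>\<^sup>+w'. indicator H w' * k n w w' \<partial>P)"
      using w by (intro nn_integral_liminf borel_measurable_times_ennreal k borel_measurable_indicator H) auto
    then have "indicator H w * ?L w
      \<le> indicator H w * liminf (\<lambda>n. \<integral>\<^sup>+w'. indicator H w' * k n w w' \<partial>P)"
      by (intro mult_left_mono) (simp_all only: ind_liminf zero_le)
    also have "\<dots> = liminf (\<lambda>n. indicator H w * ?K n w)"
      by (rule ind_liminf)
    finally show "indicator H w * ?L w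
      \<le> liminf (\<lambda>n. indicator H w * ?K n w)" .
  qed
  also have "\<dots> \<le> liminf (\<lambda>n. \<integral>\<^sup>+w. indicator H w * ?K n w \<partial>P)"
    by (rule nn_integral_liminf) measurable
  also have "\<dots> \<le> c * h"
    by (rule order_trans[OF Liminf_le_Limsup Limsup_bounded]) (use bound in auto)
  finally have lim: "(\<integral>\<^sup>+w. indicator H w * ?L w \<partial>P) \<le> c * h" .
  have "(\<integral>\<^sup>+w. indicator H w * (\<integral>\<^sup>+w'. indicator H w' * riesz \<beta> (U w - U w') \<partial>P) \<partial>P)
    \<le> (\<integral>\<^sup>+w. indicator H w * (\<integral>\<^sup>+w'. A * (indicator H w' * liminf (\<lambda>n. k n w w')) \<partial>P) \<partial>P)"
    using riesz_le by (intro nn_integral_mono mult_left_mono) (auto simp: indicator_def)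
  also have "\<dots> = (\<integral>\<^sup>+w. A * (indicator H w * ?L w) \<partial>P)"
  proof (rule nn_integral_cong)
    fix w assume [measurable]: "w \<in> space P"
    have "(\<integral>\<^sup>+w'. A * (indicator H w' * liminf (\<lambda>n. k n w w')) \<partial>P) = A * ?L w"
      by (rule nn_integral_cmult) measurable
    then show "indicator H w * (\<integral>\<^sup>+w'. A * (indicator H w' * liminf (\<lambda>n. k n w w')) \<partial>P)
      = A * (indicator H w * ?L w)"
      by (simp only: mult_ac)
  qed
  also have "\<dots> = A * (\<integral>\<^sup>+w. indicator H w * ?L w \<partial>P)"
    by (rule nn_integral_cmult) measurable
  also have "\<dots> \<le> A * (c * h)"
    by (rule mult_left_mono[OF lim]) simp
  finally have riesz: "(\<integral>\<^sup>+w. indicator H w * (\<integral>\<^sup>+w'. indicator H w' * riesz \<beta> (U w - U w') \<partial>P) \<partial>P) \<le> A * (c * h)" .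

  let ?Q = "uniform_measure P H"
  have UR: "U \<in> measurable P (restrict_space borel E)"
    using U UE by (intro measurable_restrict_space2) auto
  then have UQ: "U \<in> measurable ?Q (restrict_space borel E)"
    by (simp add: measurable_cong_sets[OF sets_uniform_measure refl])
  have "prob_space ?Q"
    using h unfolding h_def by (intro prob_space_uniform_measure) auto
  then interpret Q: prob_space ?Q .
  define \<sigma> where "\<sigma> = distr ?Q (restrict_space borel E) U"
  have "prob_space \<sigma>" unfolding \<sigma>_def by (rule Q.prob_space_distr[OF UQ])
  then interpret \<sigma>: prob_space \<sigma> .
  have \<sigma>: "\<sigma> \<in> prob_measures_on E"
    using \<open>prob_space \<sigma>\<close> by (simp add: prob_measures_on_def \<sigma>_def)
  have id: "(\<lambda>x. x) \<in> measurable (restrict_space borel E) (borel :: (real \<times> real) measure)"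
    by (rule measurable_restrict_space1) simp
  have "energy \<beta> \<sigma> = (\<integral>\<^sup>+w. \<integral>\<^sup>+w'. riesz \<beta> (U w - U w') \<partial>?Q \<partial>?Q)"
  proof -
    have "(\<lambda>z. riesz \<beta> (fst z - snd z)) \<in> borel_measurable (restrict_space borel E \<Otimes>\<^sub>M distr ?Q (restrict_space borel E) U)"
      using id by measurable
    then have "(\<lambda>z. riesz \<beta> (fst z - snd z)) \<in> borel_measurable (restrict_space borel E \<Otimes>\<^sub>M \<sigma>)"
      by (simp only: \<sigma>_def)
    from \<sigma>.borel_measurable_nn_integral_fst[OF this]
    have "(\<lambda>u. \<integral>\<^sup>+ v. riesz \<beta> (u - v) \<partial>\<sigma>) \<in> borel_measurable (distr ?Q (restrict_space borel E) U)" by simp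
    then have "energy \<beta> \<sigma> = (\<integral>\<^sup>+w. \<integral>\<^sup>+ v. riesz \<beta> (U w - v) \<partial>\<sigma> \<partial>?Q)"
      unfolding energy_riesz by (subst \<sigma>_def, rule nn_integral_distr[OF UQ])
    also have "\<dots> = (\<integral>\<^sup>+w. \<integral>\<^sup>+w'. riesz \<beta> (U w - U w') \<partial>?Q \<partial>?Q)"
    proof (rule nn_integral_cong)
      fix w
      have "(\<lambda>v. riesz \<beta> (U w - v)) \<in> borel_measurable (distr ?Q (restrict_space borel E) U)"
        using id by measurable
      then show "(\<integral>\<^sup>+ v. riesz \<beta> (U w - v) \<partial>\<sigma>) = (\<integral>\<^sup>+w'. riesz \<beta> (U w - U w') \<partial>?Q)"
        unfolding \<sigma>_def by (rule nn_integral_distr[OF UQ])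
    qed
    finally show ?thesis .
  qed
  also have "\<dots> = (\<integral>\<^sup>+w. indicator H w * (\<integral>\<^sup>+w'. indicator H w' * riesz \<beta> (U w - U w') \<partial>P) \<partial>P) * (inverse h * inverse h)"
    by (simp add: nn_integral_uniform_measure divide_ennreal_def h_def[symmetric] nn_integral_multc mult.commute[of _ "indicator H _"] mult.assoc[symmetric])
  finally have "h * energy \<beta> \<sigma> \<le> h * (A * (c * h) * (inverse h * inverse h))"
    using riesz by (auto intro!: mult_left_mono mult_right_mono)
  also have "\<dots> = A * c * (h * inverse h) * (h * inverse h)"
    by (simp only: mult_ac)
  also have "h * inverse h = 1"
    using h by (simp add: ennreal_divide_self flip: divide_ennreal_def)
  finally have "h * energy \<beta> \<sigma> \<le> A * c" by simp
  moreover have "0 < A * c" "A * c < top"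
    using heat_pos[OF m, of "0 :: real ^ 'd"] by (auto simp: A_def c_def ennreal_zero_less_mult_iff ennreal_mult_less_top)
  ultimately have "h \<le> A * c * inverse (energy \<beta> \<sigma>)"
    by (rule le_mult_inverse_ennreal)
  also have "\<dots> \<le> A * c * capacity \<beta> E"
    by (rule mult_left_mono[OF capacity_ge[OF \<sigma>]]) simp
  also have "A * c = ennreal ((4 * pi) powr (real CARD('d) / 2) * (256 * heat m (0 :: real ^ 'd)))"
    by (simp add: A_def c_def \<beta>_def ennreal_mult)
  finally show ?thesis
    by (simp add: h_def H_def \<beta>_def)
qed

subsection \<open>The lower bound\<close>

lemma indep_processes_sym:
  assumes "prob_space P" "indep_processes P X Y"
  shows "indep_processes P Y X"
  using prob_space.indep_var_sym[OF assms(1)] assms(2) by (auto simp: indep_processes_def)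

lemmas measurable_intros = borel_measurable_times_ennreal measurable_compose[OF _ measurable_ennreal]
  measurable_compose[OF _ borel_measurable_heat] borel_measurable_add borel_measurable_diff
  borel_measurable_uminus borel_measurable_const
  measurable_compose[OF measurable_fst measurable_component_singleton]
  measurable_compose[OF measurable_snd measurable_component_singleton]

text \<open>Smoothing at level \<open>r\<close> adds to the variances \<open>s\<close> and
  \<open>t\<close> of the summands. The first form, with independent copies, is what remains after
  decoupling in the two-point estimate.\<close>

lemma brownian_sum_heat:
  fixes X Y :: "real \<Rightarrow> 'w \<Rightarrow> real ^ 'd::finite"
  assumes BX: "brownian_motion P X" and BY: "brownian_motion P Y" and ind: "indep_processes P X Y"
    and s: "0 \<le> s" and t: "0 \<le> t" and r: "0 < r"
  shows "(\<integral>\<^sup>+w. \<integral>\<^sup>+w'. heat r (X s w' + Y t w - a) \<partial>P \<partial>P) = heat (r + s + t) a"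
    and "(\<integral>\<^sup>+w. heat r (X s w + Y t w - a) \<partial>P) = heat (r + s + t) a"
proof -
  interpret P: prob_space P by (rule brownian_motionD[OF BX])
  have [measurable]: "X s \<in> borel_measurable P" "Y t \<in> borel_measurable P"
    using s t brownian_motionD(2)[OF BX] brownian_motionD(2)[OF BY] by auto
  have inner: "(\<integral>\<^sup>+w'. heat r (X s w' + y) \<partial>P) = heat (r + s) y" for y
  proof -
    have "(\<integral>\<^sup>+w'. heat r (X s w' + y) \<partial>P) = (\<integral>\<^sup>+w'. heat r (y + (X s w' - X 0 w')) \<partial>P)"
      by (intro nn_integral_cong) (simp add: brownian_motionD(3)[OF BX] add.commute)
    then show ?thesis using brownian_heat[OF BX order_refl s r, of y] s by simp
  qed
  have outer: "(\<integral>\<^sup>+w. heat (r + s) (Y t w - a) \<partial>P) = heat (r + s + t) a"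
  proof -
    have "(\<integral>\<^sup>+w. heat (r + s) (Y t w - a) \<partial>P) = (\<integral>\<^sup>+w. heat (r + s) (- a + (Y t w - Y 0 w)) \<partial>P)"
      by (intro nn_integral_cong) (simp add: brownian_motionD(3)[OF BY])
    then show ?thesis using brownian_heat[OF BY order_refl t, of "r + s" "- a"] s t r by (simp add: heat_minus)
  qed
  show 1: "(\<integral>\<^sup>+w. \<integral>\<^sup>+w'. heat r (X s w' + Y t w - a) \<partial>P \<partial>P) = heat (r + s + t) a"
  proof -
    have "(\<integral>\<^sup>+w'. heat r (X s w' + Y t w - a) \<partial>P) = heat (r + s) (Y t w - a)" for w
      using inner[of "Y t w - a"] by (simp only: add_diff_eq)
    then show ?thesis using outer by simp
  qed
  have "P.indep_var (paths {t}) (\<lambda>w. \<lambda>r\<in>{t}. Y r w) (paths {s}) (\<lambda>w. \<lambda>r\<in>{s}. X r w)"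
    using s t by (intro indep_processes_restrict[OF indep_processes_sym[OF P.prob_space_axioms ind] _ _ P.prob_space_axioms]) auto
  moreover have "(\<lambda>(v, u). ennreal (heat r (u s + v t - a)))
      \<in> borel_measurable (paths {t} \<Otimes>\<^sub>M paths {s})"
    unfolding split_beta
    by (intro measurable_intros) simp_all
  ultimately have "(\<integral>\<^sup>+w. ennreal (heat r ((\<lambda>r\<in>{s}. X r w) s + (\<lambda>r\<in>{t}. Y r w) t - a)) \<partial>P)
      = (\<integral>\<^sup>+w. \<integral>\<^sup>+w'. ennreal (heat r ((\<lambda>r\<in>{s}. X r w') s + (\<lambda>r\<in>{t}. Y r w) t - a)) \<partial>P \<partial>P)"
    by (rule P.indep_var_nn_integral)
  then have "(\<integral>\<^sup>+w. heat r (X s w + Y t w - a) \<partial>P) = (\<integral>\<^sup>+w. \<integral>\<^sup>+w'. heat r (X s w' + Y t w - a) \<partial>P \<partial>P)"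
    by simp
  then show "(\<integral>\<^sup>+w. heat r (X s w + Y t w - a) \<partial>P) = heat (r + s + t) a"
    using 1 by simp
qed

text \<open>For fixed \<open>Y\<close>, the kernel at \<open>s'\<close> is averaged over the
  increment of \<open>X\<close> after \<open>s\<close> and becomes at most a kernel at the origin
  with variance \<open>s' - s\<close>. What is left is a one-point moment. The order of
  \<open>t\<close> and \<open>t'\<close> is arbitrary.\<close>

lemma pair_moment_aux:
  fixes X Y :: "real \<Rightarrow> 'w \<Rightarrow> real ^ 'd::finite"
  assumes BX: "brownian_motion P X" and BY: "brownian_motion P Y" and ind: "indep_processes P X Y"
    and s: "0 \<le> s" "s < s'" and t: "0 \<le> t" "0 \<le> t'" and r: "0 < r"
  shows "(\<integral>\<^sup>+w. ennreal (heat r (X s w + Y t w - a)) * heat r (X s' w + Y t' w - a) \<partial>P)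
    \<le> ennreal (heat (s' - s) (0 :: real ^ 'd)) * heat (r + s + t) a"
proof -
  interpret P: prob_space P by (rule brownian_motionD[OF BX])
  have s': "0 \<le> s'" using s by simp
  have [measurable]: "X s \<in> borel_measurable P" "X s' \<in> borel_measurable P" "Y t \<in> borel_measurable P" "Y t' \<in> borel_measurable P"
    using s t s' brownian_motionD(2)[OF BX] brownian_motionD(2)[OF BY] by auto
  let ?C = "ennreal (heat (s' - s) (0 :: real ^ 'd))"
  have inner: "(\<integral>\<^sup>+w. ennreal (heat r (X s w + y - a)) * heat r (X s' w + y' - a) \<partial>P)
    \<le> ?C * (\<integral>\<^sup>+w. heat r (X s w + y - a) \<partial>P)" for y y'
  proof -
    have indX: "P.indep_var (paths {0}) (\<lambda>w. \<lambda>r\<in>{0}. X r w - X s w) (paths {s'}) (\<lambda>w. \<lambda>r\<in>{s'}. X r w - X s w)"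
      using s by (intro brownian_increments_indep[OF BX]) auto
    have h1: "(\<lambda>(u, v). ennreal (heat r (- u 0 + y - a)) * ennreal (heat r ((- u 0 + y' - a) + v s')))
      \<in> borel_measurable (paths {0} \<Otimes>\<^sub>M paths {s'})"
      unfolding split_beta
      by (intro measurable_intros) simp_all
    have "(\<integral>\<^sup>+w. ennreal (heat r (X s w + y - a)) * heat r (X s' w + y' - a) \<partial>P)
      = (\<integral>\<^sup>+w. ennreal (heat r (- (X 0 w - X s w) + y - a)) * heat r ((- (X 0 w - X s w) + y' - a) + (X s' w - X s w)) \<partial>P)"
      by (intro nn_integral_cong) (simp add: brownian_motionD(3)[OF BX] algebra_simps)
    also have "\<dots> = (\<integral>\<^sup>+w. \<integral>\<^sup>+w'. ennreal (heat r (- (X 0 w - X s w) + y - a)) * heat r ((- (X 0 w - X s w) + y' - a) + (X s' w' - X s w')) \<partial>P \<partial>P)"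
      using P.indep_var_nn_integral[OF indX h1] by simp
    also have "\<dots> \<le> (\<integral>\<^sup>+w. ?C * heat r (X s w + y - a) \<partial>P)"
    proof (rule nn_integral_mono)
      fix w assume w: "w \<in> space P"
      let ?z = "- (X 0 w - X s w) + y' - a" and ?b = "ennreal (heat r (- (X 0 w - X s w) + y - a))"
      have "(\<integral>\<^sup>+w'. ?b * heat r (?z + (X s' w' - X s w')) \<partial>P) = ?b * heat (r + \<bar>s' - s\<bar>) ?z"
        using brownian_heat[OF BX s(1) s' r, of ?z] by (simp add: nn_integral_cmult)
      also have "\<dots> \<le> ?b * ?C"
        using s r by (intro mult_left_mono ennreal_leI heat_le_heat_zero) auto
      also have "\<dots> = ?C * heat r (X s w + y - a)"
        using w by (simp add: brownian_motionD(3)[OF BX] mult.commute)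
      finally show "(\<integral>\<^sup>+w'. ?b * heat r (?z + (X s' w' - X s w')) \<partial>P) \<le> ?C * heat r (X s w + y - a)" .
    qed
    also have "\<dots> = ?C * (\<integral>\<^sup>+w. heat r (X s w + y - a) \<partial>P)"
      by (rule nn_integral_cmult) measurable
    finally show ?thesis .
  qed
  have indXY: "P.indep_var (paths {t, t'}) (\<lambda>w. \<lambda>r\<in>{t, t'}. Y r w) (paths {s, s'}) (\<lambda>w. \<lambda>r\<in>{s, s'}. X r w)"
    using s s' t by (intro indep_processes_restrict[OF indep_processes_sym[OF P.prob_space_axioms ind] _ _ P.prob_space_axioms]) auto
  have h2: "(\<lambda>(v, u). ennreal (heat r (u s + v t - a)) * ennreal (heat r (u s' + v t' - a)))
      \<in> borel_measurable (paths {t, t'} \<Otimes>\<^sub>M paths {s, s'})"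
    unfolding split_beta
    by (intro measurable_intros) simp_all
  have "(\<integral>\<^sup>+w. ennreal (heat r (X s w + Y t w - a)) * heat r (X s' w + Y t' w - a) \<partial>P)
    = (\<integral>\<^sup>+w. \<integral>\<^sup>+w'. ennreal (heat r (X s w' + Y t w - a)) * heat r (X s' w' + Y t' w - a) \<partial>P \<partial>P)"
    using P.indep_var_nn_integral[OF indXY h2] by simp
  also have "\<dots> \<le> (\<integral>\<^sup>+w. ?C * (\<integral>\<^sup>+w'. heat r (X s w' + Y t w - a) \<partial>P) \<partial>P)"
    by (intro nn_integral_mono inner)
  also have "\<dots> = ?C * (\<integral>\<^sup>+w. \<integral>\<^sup>+w'. heat r (X s w' + Y t w - a) \<partial>P \<partial>P)"
    by (rule nn_integral_cmult) measurable
  finally show ?thesis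
    using brownian_sum_heat(1)[OF BX BY ind s(1) t(1) r, of a] by simp
qed

text \<open>The maximum norm of \<open>p - q\<close> is attained in one coordinate. The increment in
  this coordinate has variance \<open>u\<close>, and the point that is earlier in it supplies the
  one-point moment, bounded by \<open>heat m 0\<close> because its coordinates sum to at least
  \<open>m\<close>. The power of \<open>2 * pi\<close> comes from \<open>heat u 0\<close>.
  Exchanging \<open>X\<close> with \<open>Y\<close> or \<open>p\<close> with \<open>q\<close> covers
  the four cases; on the diagonal the Riesz kernel is infinite.\<close>

lemma pair_moment:
  fixes X Y :: "real \<Rightarrow> 'w \<Rightarrow> real ^ 'd::finite" and p q :: "real \<times> real"
  assumes BX: "brownian_motion P X" and BY: "brownian_motion P Y" and ind: "indep_processes P X Y"
    and p: "p \<in> {0..} \<times> {0..}" "m \<le> infnorm p" and q: "q \<in> {0..} \<times> {0..}" "m \<le> infnorm q"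
    and m: "0 < m" and r: "0 < r"
  shows "(\<integral>\<^sup>+w. ennreal (heat r (additive_process X Y p w - a)) * heat r (additive_process X Y q w - a) \<partial>P)
    \<le> ennreal (1 / (2 * pi) powr (real CARD('d) / 2) * heat m (0 :: real ^ 'd)) * riesz (real CARD('d) / 2) (p - q)"
proof (cases "p = q")
  case True
  have "heat m (0 :: real ^ 'd) > 0" by (rule heat_pos[OF m])
  then have "ennreal (1 / (2 * pi) powr (real CARD('d) / 2) * heat m (0 :: real ^ 'd)) * riesz (real CARD('d) / 2) (p - q) = top"
    using True by (simp add: riesz_def infnorm_0 ennreal_mult_top ennreal_eq_0_iff not_le)
  then show ?thesis by simp
next
  case False
  define \<beta> where "\<beta> = real CARD('d) / 2"
  define u where "u = infnorm (p - q)"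
  have u: "0 < u"
    using False infnorm_pos_le[of "p - q"] infnorm_eq_0[of "p - q"] by (simp add: u_def less_le)
  have C: "ennreal (1 / (2 * pi) powr \<beta> * heat m (0 :: real ^ 'd)) * riesz \<beta> (p - q) = ennreal (heat u (0 :: real ^ 'd)) * heat m (0 :: real ^ 'd)"
  proof -
    have "riesz \<beta> (p - q) = ennreal (1 / u powr \<beta>)"
      using u by (simp add: riesz_def u_def[symmetric] inverse_ennreal inverse_eq_divide)
    moreover have "heat u (0 :: real ^ 'd) = 1 / (2 * pi) powr \<beta> * (1 / u powr \<beta>)"
      using heat_zero_powr[OF u, where 'd = 'd] u by (simp add: \<beta>_def powr_mult)
    ultimately show ?thesis by (simp add: ennreal_mult mult_ac flip: ennreal_mult)
  qed
  have *: "(\<integral>\<^sup>+w. ennreal (heat r (X s w + Y t w - a)) * heat r (X s' w + Y t' w - a) \<partial>P)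
      \<le> ennreal (heat u (0 :: real ^ 'd)) * heat m (0 :: real ^ 'd)"
    if "brownian_motion P X" "brownian_motion P Y" "indep_processes P X Y"
      "0 \<le> s" "0 \<le> t" "0 \<le> t'" "s' - s = u" "m \<le> s + t" for X Y :: "real \<Rightarrow> 'w \<Rightarrow> real ^ 'd" and s s' t t'
  proof -
    have "(\<integral>\<^sup>+w. ennreal (heat r (X s w + Y t w - a)) * heat r (X s' w + Y t' w - a) \<partial>P)
      \<le> ennreal (heat (s' - s) (0 :: real ^ 'd)) * heat (r + s + t) a"
      using that u r by (intro pair_moment_aux) auto
    also have "\<dots> \<le> ennreal (heat u (0 :: real ^ 'd)) * heat m (0 :: real ^ 'd)"
      using that m r u by (intro mult_mono ennreal_leI heat_le_heat_zero) auto
    finally show ?thesis .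
  qed
  obtain s t s' t' where pq: "p = (s, t)" "q = (s', t')" by (metis surj_pair)
  have pos: "0 \<le> s" "0 \<le> t" "0 \<le> s'" "0 \<le> t'" "m \<le> s + t" "m \<le> s' + t'" "m \<le> t + s" "m \<le> t' + s'"
    using p q by (auto simp: pq infnorm_real_prod max_def split: if_splits)
  have ind': "indep_processes P Y X"
    by (rule indep_processes_sym[OF brownian_motionD(1)[OF BX] ind])
  have "u = max \<bar>s - s'\<bar> \<bar>t - t'\<bar>"
    by (simp add: u_def pq infnorm_real_prod)
  then consider "s' - s = u" | "s - s' = u" | "t' - t = u" | "t - t' = u" by linarith
  then have "(\<integral>\<^sup>+w. ennreal (heat r (X s w + Y t w - a)) * heat r (X s' w + Y t' w - a) \<partial>P)
      \<le> ennreal (heat u (0 :: real ^ 'd)) * heat m (0 :: real ^ 'd)"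
  proof cases
    case 1
    then show ?thesis using *[OF BX BY ind pos(1,2,4) 1 pos(5)] by simp
  next
    case 2
    then show ?thesis using *[OF BX BY ind pos(3,4,2) 2 pos(6)] by (simp add: mult.commute)
  next
    case 3
    then show ?thesis using *[OF BY BX ind' pos(2,1,3) 3 pos(7)] by (simp add: add.commute)
  next
    case 4
    then show ?thesis using *[OF BY BX ind' pos(4,3,1) 4 pos(8)] by (simp add: mult.commute add.commute)
  qed
  then show ?thesis
    unfolding \<beta>_def[symmetric] C by (simp add: pq additive_process_def)
qed

text \<open>Required for Fubini between \<sigma> and \<open>P\<close>. Rounded times take countably
  many values and remain nonnegative; continuity of the paths passes to the limit.\<close>

lemma brownian_joint_measurable:
  fixes X :: "real \<Rightarrow> 'w \<Rightarrow> real ^ 'd::finite"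
  assumes BX: "brownian_motion P X" and \<tau>: "\<tau> \<in> borel_measurable N" and pos: "\<And>q. q \<in> space N \<Longrightarrow> 0 \<le> \<tau> q"
  shows "(\<lambda>z. X (\<tau> (fst z)) (snd z)) \<in> borel_measurable (N \<Otimes>\<^sub>M P)"
proof (rule borel_measurable_LIMSEQ_metric)
  fix n
  let ?I = "round_down 0 n ` {0..}"
  have count: "countable ?I"
  proof (rule countable_subset)
    show "?I \<subseteq> range (\<lambda>k::int. 0 + of_int k / real (Suc n))"
      by (auto simp: round_down_def)
  qed simp
  have meas: "(\<lambda>z. round_down 0 n (\<tau> (fst z))) \<in> borel_measurable (N \<Otimes>\<^sub>M P)"
    using \<tau> by measurable
  have "(\<lambda>z. round_down 0 n (\<tau> (fst z))) \<in> measurable (N \<Otimes>\<^sub>M P) (count_space ?I)"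
    unfolding measurable_count_space_eq_countable[OF count]
    using measurable_sets[OF meas] pos by (auto simp: space_pair_measure)
  then show "(\<lambda>z. X (round_down 0 n (\<tau> (fst z))) (snd z)) \<in> borel_measurable (N \<Otimes>\<^sub>M P)"
  proof (rule measurable_compose_countable'[where f = "\<lambda>s z. X s (snd z)" and I = ?I, rotated])
    fix s assume "s \<in> ?I"
    then have "0 \<le> s" by (auto simp: round_down_ge)
    then show "(\<lambda>z. X s (snd z)) \<in> borel_measurable (N \<Otimes>\<^sub>M P)"
      by (intro measurable_compose[OF measurable_snd] brownian_motionD(2)[OF BX])
  qed (rule count)
next
  fix z assume "z \<in> space (N \<Otimes>\<^sub>M P)"
  then have z: "0 \<le> \<tau> (fst z)" "snd z \<in> space P" using pos by (auto simp: space_pair_measure)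
  show "(\<lambda>n. X (round_down 0 n (\<tau> (fst z))) (snd z)) \<longlonglongrightarrow> X (\<tau> (fst z)) (snd z)"
    using z by (intro continuous_on_tendsto_compose[OF brownian_motionD(4)[OF BX] round_down_tendsto])
      (auto intro!: always_eventually round_down_ge)
qed

lemma heat_eq_exp:
  fixes x :: "real ^ 'd::finite"
  assumes "0 < r"
  shows "heat r x = heat r (0 :: real ^ 'd) * exp (- (norm x)\<^sup>2 / (2 * r))"
proof -
  have "(norm x)\<^sup>2 = (\<Sum>i\<in>UNIV. (x $ i)\<^sup>2)"
    unfolding dot_square_norm[symmetric] inner_vec_def by (simp add: power2_eq_square)
  then have "exp (- (norm x)\<^sup>2 / (2 * r)) = (\<Prod>i\<in>UNIV. exp (- (x $ i)\<^sup>2 / (2 * r)))"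
    by (simp add: exp_sum[symmetric] sum_negf sum_divide_distrib)
  then show ?thesis
    using assms unfolding heat_def by (simp add: normal_density_def prod_dividef power_one_over)
qed

text \<open>At distance \<open>\<eta>\<close> from the origin the exponential factor beats the peak
  of the kernel, which grows at most like \<open>real (Suc n)\<close> to the power
  \<open>d\<close>.\<close>

lemma heat_tendsto_zero:
  assumes "0 < \<eta>"
  shows "(\<lambda>n. heat (1 / real (Suc n)) (0 :: real ^ 'd::finite) * exp (- \<eta>\<^sup>2 / (2 * (1 / real (Suc n))))) \<longlonglongrightarrow> 0"
proof -
  let ?d = "CARD('d)"
  define c where "c = \<eta>\<^sup>2 / 2"
  have c: "0 < c" using assms by (simp add: c_def)
  have "filterlim (\<lambda>n. c * real (Suc n)) at_top sequentially"
    by (intro filterlim_tendsto_pos_mult_at_top[OF tendsto_const c]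
        filterlim_compose[OF filterlim_real_sequentially filterlim_Suc])
  from filterlim_compose[OF tendsto_power_div_exp_0 this, of ?d]
  have "(\<lambda>n. (1 / c) ^ ?d * ((c * real (Suc n)) ^ ?d / exp (c * real (Suc n)))) \<longlonglongrightarrow> (1 / c) ^ ?d * 0"
    by (intro tendsto_mult tendsto_const)
  then have lim: "(\<lambda>n. real (Suc n) ^ ?d * exp (- (c * real (Suc n)))) \<longlonglongrightarrow> 0"
    using c by (simp add: power_mult_distrib power_one_over exp_minus divide_inverse mult_ac del: of_nat_Suc)
  show ?thesis
  proof (rule tendsto_sandwich[OF _ _ tendsto_const lim])
    show "\<forall>\<^sub>F n in sequentially. heat (1 / real (Suc n)) (0 :: real ^ 'd) * exp (- \<eta>\<^sup>2 / (2 * (1 / real (Suc n))))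
        \<le> real (Suc n) ^ ?d * exp (- (c * real (Suc n)))"
    proof (intro always_eventually allI)
      fix n
      have N: "1 \<le> real (Suc n)" by simp
      have "1 / real (Suc n) = sqrt ((1 / real (Suc n))\<^sup>2)" using N by simp
      also have "(1 / real (Suc n))\<^sup>2 \<le> 1 * (1 / real (Suc n))"
        unfolding power2_eq_square using N by (intro mult_right_mono) auto
      also have "1 * (1 / real (Suc n)) \<le> (2 * pi) * (1 / real (Suc n))"
        using pi_ge_two by (intro mult_right_mono) auto
      finally have "1 / real (Suc n) \<le> sqrt (2 * pi * (1 / real (Suc n)))" by simp
      then have "(1 / real (Suc n)) ^ ?d \<le> sqrt (2 * pi * (1 / real (Suc n))) ^ ?d"
        by (intro power_mono) auto
      then have "1 / sqrt (2 * pi * (1 / real (Suc n))) ^ ?d \<le> 1 / (1 / real (Suc n)) ^ ?d"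
        by (intro divide_left_mono) auto
      then have "heat (1 / real (Suc n)) (0 :: real ^ 'd) \<le> real (Suc n) ^ ?d"
        using heat_zero[of "1 / real (Suc n)", where 'd = 'd] by (simp add: power_one_over)
      moreover have "- \<eta>\<^sup>2 / (2 * (1 / real (Suc n))) = - (c * real (Suc n))"
        by (simp add: c_def)
      ultimately show "heat (1 / real (Suc n)) (0 :: real ^ 'd) * exp (- \<eta>\<^sup>2 / (2 * (1 / real (Suc n))))
        \<le> real (Suc n) ^ ?d * exp (- (c * real (Suc n)))"
        by (simp only:) (intro mult_right_mono; simp)
    qed
  qed (auto intro!: always_eventually)
qed

text \<open>The smoothed occupation \<open>J n\<close> is at least \<open>k / 2\<close> with a
  probability bounded below by its two moments. Since the kernels have positive width, a large
  \<open>J n\<close> does not yet mean a hit; but without a hit, \<open>a\<close> keeps a positive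
  distance from the compact image of \<open>E\<close>, and \<open>J n\<close> tends to 0.\<close>

lemma hitting_lower:
  fixes X Y :: "real \<Rightarrow> 'w \<Rightarrow> real ^ 'd::finite" and \<sigma> :: "(real \<times> real) measure"
  assumes BX: "brownian_motion P X" and BY: "brownian_motion P Y" and ind: "indep_processes P X Y"
    and m: "0 < m" and E: "compact E" "E \<subseteq> {0..} \<times> {0..}"
    and mL: "\<And>p. p \<in> E \<Longrightarrow> m \<le> infnorm p" "\<And>p. p \<in> E \<Longrightarrow> infnorm p \<le> L"
    and a: "\<And>i. \<bar>a $ i\<bar> \<le> M" and \<sigma>: "\<sigma> \<in> prob_measures_on E"
    and k_def: "k = (1 / sqrt (2 * pi * (2 * L + 1)) * exp (- M\<^sup>2 / (2 * m))) ^ CARD('d)"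
    and C_def: "C = 1 / (2 * pi) powr (real CARD('d) / 2) * heat m (0 :: real ^ 'd)"
  shows "ennreal (k\<^sup>2 / (4 * C)) * inverse (energy (real CARD('d) / 2) \<sigma>)
    \<le> emeasure P {w\<in>space P. a \<in> (\<lambda>p. additive_process X Y p w) ` E}"
proof -
  interpret P: prob_space P by (rule brownian_motionD[OF BX])
  interpret continuous_field P E "additive_process X Y" a
    by (rule additive_brownian_field[OF BX BY E])
  have sets_\<sigma>: "sets \<sigma> = sets (restrict_space borel E)" and "prob_space \<sigma>"
    using \<sigma> by (auto simp: prob_measures_on_def)
  interpret \<sigma>: prob_space \<sigma> by fact
  interpret \<sigma>P: pair_sigma_finite \<sigma> P ..
  have space_\<sigma>: "space \<sigma> = E"
    using sets_eq_imp_space_eq[OF sets_\<sigma>] by (simp add: space_restrict_space)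
  obtain e0 where e0: "e0 \<in> E" using \<sigma>.not_empty space_\<sigma> by auto
  have L: "0 < L" using mL[OF e0] m by linarith
  define \<beta> where "\<beta> = real CARD('d) / 2"
  define H where "H = {w\<in>space P. a \<in> (\<lambda>p. additive_process X Y p w) ` E}"
  have H [measurable]: "H \<in> sets P" unfolding H_def by (rule measurable_hit_event)
  have C: "0 < C" unfolding C_def using heat_pos[OF m, of "0 :: real ^ 'd"] by simp
  have k: "0 < k" unfolding k_def using L by (intro zero_less_power mult_pos_pos) auto
  let ?Z = "additive_process X Y"
  have id: "(\<lambda>q. q) \<in> borel_measurable \<sigma>"
    unfolding measurable_cong_sets[OF sets_\<sigma> refl] by (rule measurable_restrict_space1) simp
  have Z [measurable]: "(\<lambda>z. ?Z (fst z) (snd z)) \<in> borel_measurable (\<sigma> \<Otimes>\<^sub>M P)"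
    unfolding additive_process_def split_beta
    by (intro borel_measurable_add brownian_joint_measurable[OF BX] brownian_joint_measurable[OF BY]
        borel_measurable_fst_snd[OF id]) (use E(2) space_\<sigma> in auto)
  define g where "g n q w = ennreal (heat (1 / real (Suc n)) (?Z q w - a))" for n q w
  have g [measurable]: "(\<lambda>z. g n (u z) (v z)) \<in> borel_measurable N"
    if "u \<in> measurable N \<sigma>" "v \<in> measurable N P" for n u v and N :: "'x measure"
  proof -
    have "(\<lambda>z. ?Z (u z) (v z)) \<in> borel_measurable N"
      using measurable_compose[OF measurable_Pair[OF that] Z] by simp
    then show ?thesis unfolding g_def by measurable
  qed
  have g1 [measurable]: "g n q \<in> borel_measurable P" if "q \<in> space \<sigma>" for n q
    using g[of "\<lambda>_. q" P "\<lambda>w. w" n] that by simp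
  define J where "J n w = (\<integral>\<^sup>+q. g n q w \<partial>\<sigma>)" for n w
  have J [measurable]: "J n \<in> borel_measurable P" for n
    unfolding J_def[abs_def] by measurable
  have first: "ennreal k \<le> (\<integral>\<^sup>+w. J n w \<partial>P)" for n
  proof -
    have "ennreal k = (\<integral>\<^sup>+q. ennreal k \<partial>\<sigma>)" by (simp add: \<sigma>.emeasure_space_1)
    also have "\<dots> \<le> (\<integral>\<^sup>+q. \<integral>\<^sup>+w. g n q w \<partial>P \<partial>\<sigma>)"
    proof (rule nn_integral_mono)
      fix q assume "q \<in> space \<sigma>"
      then have q: "q \<in> E" by (simp add: space_\<sigma>)
      obtain s t where st: "q = (s, t)" by (metis surj_pair)
      have pos: "0 \<le> s" "0 \<le> t" "m \<le> s + t" "s + t \<le> 2 * L"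
        using q E(2) mL[OF q] by (auto simp: st infnorm_real_prod max_def split: if_splits)
      \<comment> \<open>The smoothing is at most 1 and \<open>s + t\<close> lies between
        \<open>m\<close> and \<open>2 * L\<close>; hence \<open>2 * L + 1\<close> in
        \<open>k\<close>.\<close>
      have n: "1 / real (Suc n) \<le> 1" "0 < 1 / real (Suc n)" by simp_all
      have "m \<le> 1 / real (Suc n) + s + t" "1 / real (Suc n) + s + t \<le> 2 * L + 1"
        using n pos by linarith+
      then have "k \<le> heat (1 / real (Suc n) + s + t) a"
        unfolding k_def by (rule heat_ge[OF m _ _ a])
      then show "ennreal k \<le> (\<integral>\<^sup>+w. g n q w \<partial>P)"
        using brownian_sum_heat(2)[OF BX BY ind pos(1,2), of "1 / real (Suc n)" a]
        by (simp add: g_def st additive_process_def ennreal_leI)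
    qed
    also have "\<dots> = (\<integral>\<^sup>+w. J n w \<partial>P)"
      unfolding J_def by (rule \<sigma>P.Fubini'[symmetric]) (unfold split_beta, measurable)
    finally show ?thesis .
  qed
  define e where "e = energy \<beta> \<sigma>"
  have second: "(\<integral>\<^sup>+w. (J n w)\<^sup>2 \<partial>P) \<le> ennreal C * e" for n
  proof -
    have "(\<integral>\<^sup>+w. (J n w)\<^sup>2 \<partial>P) = (\<integral>\<^sup>+w. \<integral>\<^sup>+q. \<integral>\<^sup>+q'. g n q w * g n q' w \<partial>\<sigma> \<partial>\<sigma> \<partial>P)"
    proof (rule nn_integral_cong)
      fix w assume [measurable]: "w \<in> space P"
      have "(J n w)\<^sup>2 = (\<integral>\<^sup>+q. g n q w * J n w \<partial>\<sigma>)"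
        by (subst nn_integral_multc) (auto simp: power2_eq_square J_def)
      also have "\<dots> = (\<integral>\<^sup>+q. \<integral>\<^sup>+q'. g n q w * g n q' w \<partial>\<sigma> \<partial>\<sigma>)"
        unfolding J_def by (intro nn_integral_cong nn_integral_cmult[symmetric]) measurable
      finally show "(J n w)\<^sup>2 = (\<integral>\<^sup>+q. \<integral>\<^sup>+q'. g n q w * g n q' w \<partial>\<sigma> \<partial>\<sigma>)" .
    qed
    also have "\<dots> = (\<integral>\<^sup>+q. \<integral>\<^sup>+w. \<integral>\<^sup>+q'. g n q w * g n q' w \<partial>\<sigma> \<partial>P \<partial>\<sigma>)"
      by (rule \<sigma>P.Fubini') (unfold split_beta, measurable)
    also have "\<dots> = (\<integral>\<^sup>+q. \<integral>\<^sup>+q'. \<integral>\<^sup>+w. g n q w * g n q' w \<partial>P \<partial>\<sigma> \<partial>\<sigma>)"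
      by (rule nn_integral_cong, rule \<sigma>P.Fubini') (unfold split_beta, measurable)
    also have "\<dots> \<le> (\<integral>\<^sup>+q. \<integral>\<^sup>+q'. ennreal C * riesz \<beta> (q - q') \<partial>\<sigma> \<partial>\<sigma>)"
    proof (intro nn_integral_mono)
      fix q q' assume "q \<in> space \<sigma>" "q' \<in> space \<sigma>"
      then have "q \<in> E" "q' \<in> E" by (simp_all add: space_\<sigma>)
      then show "(\<integral>\<^sup>+w. g n q w * g n q' w \<partial>P) \<le> ennreal C * riesz \<beta> (q - q')"
        unfolding g_def C_def \<beta>_def using E(2) mL by (intro pair_moment[OF BX BY ind _ _ _ _ m]) auto
    qed
    also have "\<dots> = ennreal C * e"
    proof -
      have r2: "(\<lambda>z. riesz \<beta> (fst z - snd z)) \<in> borel_measurable (\<sigma> \<Otimes>\<^sub>M \<sigma>)"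
        using id by measurable
      have r1: "(\<lambda>q'. riesz \<beta> (q - q')) \<in> borel_measurable \<sigma>" for q
        using id by measurable
      show ?thesis
        unfolding e_def energy_riesz using \<sigma>.borel_measurable_nn_integral_fst[OF r2] r1
        by (simp add: nn_integral_cmult)
    qed
    finally show ?thesis .
  qed
  define A where "A n = {w\<in>space P. ennreal (k / 2) \<le> J n w}" for n
  have A [measurable]: "A n \<in> sets P" for n unfolding A_def by measurable
  \<comment> \<open>Paley-Zygmund: outcomes outside \<open>A n\<close> contribute at most
    \<open>k / 2\<close> to the mean, and Cauchy-Schwarz bounds the contribution of
    \<open>A n\<close>.\<close>
  have PZ: "ennreal ((k / 2)\<^sup>2) \<le> ennreal C * e * emeasure P (A n)" for n
  proof -
    let ?u = "\<integral>\<^sup>+w. J n w * indicator (A n) w \<partial>P"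
    have "ennreal k \<le> (\<integral>\<^sup>+w. J n w * indicator (A n) w + ennreal (k / 2) \<partial>P)"
      by (rule order_trans[OF first[of n]], rule nn_integral_mono) (auto simp: A_def indicator_def)
    also have "\<dots> = ?u + ennreal (k / 2)"
      by (subst nn_integral_add) (auto simp: P.emeasure_space_1)
    finally have "ennreal (k / 2) + ennreal (k / 2) \<le> ?u + ennreal (k / 2)"
      using k by (simp flip: ennreal_plus)
    then have "ennreal (k / 2) \<le> ?u"
      by (subst (asm) (1 2) add.commute) (simp add: ennreal_add_left_cancel_le)
    then have "(ennreal (k / 2))\<^sup>2 \<le> ?u\<^sup>2"
      by (rule power_mono_ennreal)
    also have "\<dots> \<le> (\<integral>\<^sup>+w. (J n w)\<^sup>2 \<partial>P) * (\<integral>\<^sup>+w. (indicator (A n) w)\<^sup>2 \<partial>P)"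
      by (rule Cauchy_Schwarz_nn_integral) measurable
    also have "(\<integral>\<^sup>+w. (indicator (A n) w :: ennreal)\<^sup>2 \<partial>P) = (\<integral>\<^sup>+w. indicator (A n) w \<partial>P)"
      by (intro nn_integral_cong) (auto simp: indicator_def)
    also have "\<dots> = emeasure P (A n)" by simp
    also have "(\<integral>\<^sup>+w. (J n w)\<^sup>2 \<partial>P) * emeasure P (A n) \<le> ennreal C * e * emeasure P (A n)"
      by (rule mult_right_mono[OF second]) simp
    finally show ?thesis using k by (simp add: ennreal_power)
  qed
  \<comment> \<open>Outcomes with large \<open>J n\<close> but no hit disappear in the
    limit.\<close>
  have "(\<lambda>n. \<integral>\<^sup>+w. indicator (A n - H) w \<partial>P) \<longlonglongrightarrow> (\<integral>\<^sup>+w. 0 \<partial>P)"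
  proof (rule nn_integral_dominated_convergence[where w = "\<lambda>_. 1"])
    show "AE w in P. (\<lambda>n. indicator (A n - H) w :: ennreal) \<longlonglongrightarrow> 0"
    proof (rule AE_I2)
      fix w assume w: "w \<in> space P"
      show "(\<lambda>n. indicator (A n - H) w :: ennreal) \<longlonglongrightarrow> 0"
      proof (cases "w \<in> H")
        case False
        have "closed ((\<lambda>p. ?Z p w) ` E)"
          by (intro compact_imp_closed compact_continuous_image continuous_f[OF w] E(1))
        moreover have "a \<notin> (\<lambda>p. ?Z p w) ` E" using False w by (auto simp: H_def)
        ultimately obtain \<eta> where \<eta>: "0 < \<eta>" "\<And>x. x \<in> (\<lambda>p. ?Z p w) ` E \<Longrightarrow> \<eta> \<le> dist a x"
          using separate_point_closed[of "(\<lambda>p. ?Z p w) ` E" a] by blast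
        let ?K = "\<lambda>n. heat (1 / real (Suc n)) (0 :: real ^ 'd) * exp (- \<eta>\<^sup>2 / (2 * (1 / real (Suc n))))"
        have J_le: "J n w \<le> ennreal (?K n)" for n
        proof -
          have "J n w \<le> (\<integral>\<^sup>+q. ennreal (?K n) \<partial>\<sigma>)"
            unfolding J_def
          proof (rule nn_integral_mono)
            fix q assume "q \<in> space \<sigma>"
            then have "\<eta> \<le> norm (?Z q w - a)"
              using \<eta>(2)[of "?Z q w"] by (auto simp: space_\<sigma> dist_norm norm_minus_commute)
            then have "\<eta>\<^sup>2 \<le> (norm (?Z q w - a))\<^sup>2" using \<eta>(1) by (intro power_mono) auto
            then have "exp (- (norm (?Z q w - a))\<^sup>2 / (2 * (1 / real (Suc n)))) \<le> exp (- \<eta>\<^sup>2 / (2 * (1 / real (Suc n))))"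
              by (intro exp_mono divide_right_mono) auto
            then have "heat (1 / real (Suc n)) (?Z q w - a) \<le> ?K n"
              by (subst heat_eq_exp) (auto intro: mult_left_mono)
            then show "g n q w \<le> ennreal (?K n)" unfolding g_def by (rule ennreal_leI)
          qed
          then show ?thesis by (simp add: \<sigma>.emeasure_space_1)
        qed
        have "\<forall>\<^sub>F n in sequentially. ?K n < k / 2"
          using k by (intro order_tendstoD(2)[OF heat_tendsto_zero[OF \<eta>(1)]]) simp
        then have "\<forall>\<^sub>F n in sequentially. (indicator (A n - H) w :: ennreal) = 0"
        proof eventually_elim
          case (elim n)
          have "J n w < ennreal (k / 2)"
            using elim by (intro le_less_trans[OF J_le] ennreal_lessI) (use k in simp_all)
          then show ?case by (auto simp: A_def indicator_def)
        qed
        then show ?thesis by (rule tendsto_eventually)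
      qed simp
    qed
  qed (auto simp: P.emeasure_space_1 indicator_def)
  then have lim0: "(\<lambda>n. emeasure P (A n - H)) \<longlonglongrightarrow> 0" by simp
  have "ennreal (k\<^sup>2 / (4 * C)) * inverse e \<le> emeasure P H"
  proof (cases "e = top")
    case True
    then show ?thesis by simp
  next
    case False
    have e_fin: "e < top"
      using False top.not_eq_extremum by blast
    then have fin: "ennreal C * e < top"
      by (simp add: ennreal_mult_less_top)
    have "(\<lambda>n. ennreal C * e * (emeasure P H + emeasure P (A n - H))) \<longlonglongrightarrow> ennreal C * e * (emeasure P H + 0)"
      by (intro ennreal_tendsto_cmult fin tendsto_add tendsto_const lim0)
    moreover have "ennreal ((k / 2)\<^sup>2) \<le> ennreal C * e * (emeasure P H + emeasure P (A n - H))" for n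
    proof -
      have "emeasure P (A n) \<le> emeasure P (H \<union> (A n - H))" by (intro emeasure_mono) auto
      also have "\<dots> \<le> emeasure P H + emeasure P (A n - H)" by (intro emeasure_subadditive) auto
      finally show ?thesis by (intro order_trans[OF PZ[of n]] mult_left_mono) auto
    qed
    ultimately have le: "ennreal ((k / 2)\<^sup>2) \<le> ennreal C * e * emeasure P H"
      by (intro LIMSEQ_le_const[where x = "ennreal C * e * emeasure P H"]) auto
    have "e \<noteq> 0" using le k by (auto simp: ennreal_eq_0_iff not_le)
    have Ce: "ennreal C * inverse (ennreal C) = 1" "e * inverse e = 1"
      using ennreal_divide_self[of "ennreal C"] ennreal_divide_self[of e] C e_fin \<open>e \<noteq> 0\<close>
      by (simp_all add: divide_ennreal_def)
    have "k\<^sup>2 / (4 * C) = (k / 2)\<^sup>2 * inverse C"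
      using C by (simp add: field_simps power2_eq_square)
    then have "ennreal (k\<^sup>2 / (4 * C)) * inverse e = ennreal ((k / 2)\<^sup>2) * (inverse (ennreal C) * inverse e)"
      using C by (simp add: ennreal_mult inverse_ennreal mult.assoc)
    also have "\<dots> \<le> ennreal C * e * emeasure P H * (inverse (ennreal C) * inverse e)"
      by (rule mult_right_mono[OF le]) simp
    also have "\<dots> = (ennreal C * inverse (ennreal C)) * (e * inverse e) * emeasure P H"
      by (simp only: mult_ac)
    finally show ?thesis using Ce by simp
  qed
  then show ?thesis by (simp add: e_def \<beta>_def H_def)
qed

section \<open>From single measures to capacity, and the final constants\<close>

lemma inverse_inverse_ennreal: "inverse (inverse x) = (x :: ennreal)"
proof (cases x)
  case (real r)
  then show ?thesis by (cases "r = 0") (simp_all add: inverse_ennreal)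
qed simp

text \<open>The infimum in the capacity is not assumed to be attained, so the bounds for single
  measures are inverted, collected under the infimum, and inverted back.\<close>

lemma mult_inverse_INF_le:
  fixes h A :: ennreal
  assumes A: "0 < A" "A < top" and le: "\<And>i. i \<in> I \<Longrightarrow> A * inverse (f i) \<le> h"
  shows "A * inverse (INF i\<in>I. f i) \<le> h"
proof -
  have AA: "A * inverse A = 1"
    using A ennreal_divide_self[of A] by (simp add: divide_ennreal_def)
  have inv: "inverse (A * inverse x) = inverse A * x" for x
    using A by (subst ennreal_inverse_mult') (auto simp: inverse_inverse_ennreal)
  have "A * inverse h \<le> f i" if "i \<in> I" for i
  proof -
    have "inverse h \<le> inverse A * f i"
      using inverse_antimono_ennreal[OF le[OF that]] by (simp add: inv)
    then have "A * inverse h \<le> A * (inverse A * f i)"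
      by (rule mult_left_mono) simp
    then show ?thesis by (simp add: mult.assoc[symmetric] AA)
  qed
  then have "A * inverse h \<le> (INF i\<in>I. f i)" by (rule INF_greatest)
  from inverse_antimono_ennreal[OF this] have "inverse (INF i\<in>I. f i) \<le> inverse A * h"
    by (simp add: inv)
  then have "A * inverse (INF i\<in>I. f i) \<le> A * (inverse A * h)"
    by (rule mult_left_mono) simp
  then show ?thesis by (simp add: mult.assoc[symmetric] AA)
qed

lemma capacity_empty: "capacity \<beta> {} = 0"
proof -
  have "prob_measures_on ({} :: 'a::euclidean_space set) = {}"
  proof (rule ccontr)
    assume "prob_measures_on ({} :: 'a set) \<noteq> {}"
    then obtain \<sigma> :: "'a measure" where "sets \<sigma> = sets (restrict_space borel {})" "prob_space \<sigma>"
      by (auto simp: prob_measures_on_def)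
    then show False
      using sets_eq_imp_space_eq[of \<sigma>] prob_space.not_empty[of \<sigma>] by (auto simp: space_restrict_space)
  qed
  then show ?thesis by (simp add: capacity_def)
qed

text \<open>A point of norm at least \<open>m\<close> has a coordinate that is at least
  \<open>m\<close>. The part of \<open>E\<close> with \<open>s \<ge> m\<close> is treated directly;
  the part with \<open>t \<ge> m\<close> is reflected and the two motions exchange roles. The two
  contributions give the factor 2.\<close>

lemma hitting_upper_two_sided:
  fixes X Y :: "real \<Rightarrow> 'w \<Rightarrow> real ^ 'd::finite"
  assumes BX: "brownian_motion P X" and BY: "brownian_motion P Y" and ind: "indep_processes P X Y"
    and m: "0 < m" and E: "compact E" "E \<subseteq> {0..} \<times> {0..}" and mE: "\<And>p. p \<in> E \<Longrightarrow> m \<le> infnorm p"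
  shows "emeasure P {w\<in>space P. a \<in> (\<lambda>p. additive_process X Y p w) ` E}
    \<le> ennreal (2 * ((4 * pi) powr (real CARD('d) / 2) * (256 * heat m (0 :: real ^ 'd)))) * capacity (real CARD('d) / 2) E"
proof -
  define \<beta> where "\<beta> = real CARD('d) / 2"
  define K where "K = (4 * pi) powr \<beta> * (256 * heat m (0 :: real ^ 'd))"
  define hit where "hit X Y E = {w\<in>space P. a \<in> (\<lambda>p. additive_process X Y p w) ` E}" for X Y :: "real \<Rightarrow> 'w \<Rightarrow> real ^ 'd" and E
  define E1 where "E1 = E \<inter> {m..} \<times> UNIV"
  define E2 where "E2 = prod.swap ` (E \<inter> UNIV \<times> {m..})"
  have ind': "indep_processes P Y X"
    by (rule indep_processes_sym[OF brownian_motionD(1)[OF BX] ind])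
  have E1: "compact E1" "E1 \<subseteq> {m..} \<times> {0..}"
    using E by (auto simp: E1_def intro!: compact_Int_closed closed_Times)
  have E2: "compact E2" "E2 \<subseteq> {m..} \<times> {0..}"
    using E by (auto simp: E2_def intro!: compact_continuous_image compact_Int_closed closed_Times continuous_on_swap)
  have E1': "E1 \<subseteq> {0..} \<times> {0..}" and E2': "E2 \<subseteq> {0..} \<times> {0..}"
    using E1(2) E2(2) m by force+
  interpret F1: continuous_field P E1 "additive_process X Y" a
    by (rule additive_brownian_field[OF BX BY E1(1) E1'])
  interpret F2: continuous_field P E2 "additive_process Y X" a
    by (rule additive_brownian_field[OF BY BX E2(1) E2'])
  have [measurable]: "hit X Y E1 \<in> sets P" "hit Y X E2 \<in> sets P"
    unfolding hit_def by (rule F1.measurable_hit_event, rule F2.measurable_hit_event)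
  have borel: "E \<in> sets borel" "E1 \<in> sets borel" "E2 \<in> sets borel"
    using E(1) E1(1) E2(1) by (simp_all add: borel_compact)
  have cap1: "capacity \<beta> E1 \<le> capacity \<beta> E"
    by (rule capacity_mono_isometry[where f = "\<lambda>p. p"]) (use borel in \<open>auto simp: E1_def\<close>)
  have cap2: "capacity \<beta> E2 \<le> capacity \<beta> E"
  proof (rule capacity_mono_isometry[where f = prod.swap])
    show "prod.swap \<in> borel_measurable (borel :: (real \<times> real) measure)"
      by (intro borel_measurable_continuous_onI continuous_on_swap)
  qed (use borel in \<open>auto simp: E2_def infnorm_real_prod max.commute\<close>)
  have "hit X Y E \<subseteq> hit X Y E1 \<union> hit Y X E2"
  proof
    fix w assume "w \<in> hit X Y E"
    then obtain s t where w: "w \<in> space P" and st: "(s, t) \<in> E" "X s w + Y t w = a"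
      by (auto simp: hit_def additive_process_def)
    have "m \<le> s \<or> m \<le> t"
      using mE[OF st(1)] st(1) E(2) by (auto simp: infnorm_real_prod max_def split: if_splits)
    then show "w \<in> hit X Y E1 \<union> hit Y X E2"
    proof
      assume "m \<le> s"
      then have "(s, t) \<in> E1" using st by (auto simp: E1_def)
      then show ?thesis using w st by (force simp: hit_def additive_process_def)
    next
      assume "m \<le> t"
      then have "(t, s) \<in> E2" using st by (force simp: E2_def)
      then show ?thesis using w st by (force simp: hit_def additive_process_def add.commute)
    qed
  qed
  then have "emeasure P (hit X Y E) \<le> emeasure P (hit X Y E1 \<union> hit Y X E2)"
    by (rule emeasure_mono) measurable
  also have "\<dots> \<le> emeasure P (hit X Y E1) + emeasure P (hit Y X E2)"
    by (rule emeasure_subadditive) measurable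
  also have "\<dots> \<le> ennreal K * capacity \<beta> E1 + ennreal K * capacity \<beta> E2"
    unfolding K_def \<beta>_def hit_def by (intro add_mono hitting_upper[OF BX BY ind m E1] hitting_upper[OF BY BX ind' m E2])
  also have "\<dots> \<le> ennreal K * capacity \<beta> E + ennreal K * capacity \<beta> E"
    by (intro add_mono mult_left_mono cap1 cap2) auto
  also have "\<dots> = ennreal (2 * K) * capacity \<beta> E"
  proof -
    have "0 \<le> K" by (simp add: K_def)
    then have "ennreal (2 * K) = 2 * ennreal K" by (simp add: ennreal_mult)
    then show ?thesis by (simp only: mult.assoc mult_2 distrib_right)
  qed
  finally show ?thesis
    by (simp add: hit_def K_def \<beta>_def)
qed

theorem theorem8p2:
  shows "\<exists>A5 A6 :: ennreal \<Rightarrow> ennreal \<Rightarrow> real \<Rightarrow> real.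
    \<forall>(P :: 'w measure) (X :: real \<Rightarrow> 'w \<Rightarrow> real ^ 'd::finite) (Y :: real \<Rightarrow> 'w \<Rightarrow> real ^ 'd)
       (M :: real) (E :: (real \<times> real) set) (a :: real ^ 'd).
      brownian_motion P X \<longrightarrow> brownian_motion P Y \<longrightarrow> indep_processes P X Y \<longrightarrow>
      M > 0 \<longrightarrow> compact E \<longrightarrow> E \<subseteq> {0..} \<times> {0..} \<longrightarrow> c1 E > 0 \<longrightarrow> (\<forall>i. a $ i \<in> {-M..M}) \<longrightarrow>
      A5 (c1 E) (c2 E) M > 0 \<and> A6 (c1 E) (c2 E) M > 0 \<and>
      ennreal (A5 (c1 E) (c2 E) M) * capacity (real CARD('d) / 2) E
        \<le> emeasure P {\<omega> \<in> space P. a \<in> (\<lambda>p. additive_process X Y p \<omega>) ` E} \<and>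
      emeasure P {\<omega> \<in> space P. a \<in> (\<lambda>p. additive_process X Y p \<omega>) ` E}
        \<le> ennreal (A6 (c1 E) (c2 E) M) * capacity (real CARD('d) / 2) E"
proof -
  define \<beta> where "\<beta> = real CARD('d) / 2"
  define h where "h m = heat m (0 :: real ^ 'd)" for m
  define k where "k m L M = (1 / sqrt (2 * pi * (2 * L + 1)) * exp (- M\<^sup>2 / (2 * m))) ^ CARD('d)" for m L M :: real
  define C where "C m = 1 / (2 * pi) powr \<beta> * h m" for m
  \<comment> \<open>For empty \<open>E\<close> the value \<open>c1 E\<close> is infinite, so its
    \<open>enn2real\<close> is 0 and the positive default 1 applies; hitting probability and
    capacity are both 0 then.\<close>
  define A5 where "A5 u v M = (if 0 < enn2real u then (k (enn2real u) (enn2real v) M)\<^sup>2 / (4 * C (enn2real u)) else 1)"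
    for u v :: ennreal and M
  define A6 where "A6 u v M = (if 0 < enn2real u then 2 * ((4 * pi) powr \<beta> * (256 * h (enn2real u))) else 1)"
    for u v :: ennreal and M :: real
  have h_pos: "0 < h m" if "0 < m" for m
    using that unfolding h_def by (rule heat_pos)
  have C_pos: "0 < C m" if "0 < m" for m
    using h_pos[OF that] by (simp add: C_def)
  have k_pos: "0 < k m (enn2real v) M" for m v M
  proof -
    have "0 < 2 * enn2real v + 1" using enn2real_nonneg[of v] by linarith
    then show ?thesis unfolding k_def by (intro zero_less_power mult_pos_pos) auto
  qed
  have A5_pos: "0 < A5 u v M" for u v M
    using k_pos[of "enn2real u" v M] C_pos[of "enn2real u"] by (simp add: A5_def)
  have A6_pos: "0 < A6 u v M" for u v M
    using h_pos by (auto simp: A6_def)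
  show ?thesis
  proof (rule exI[of _ A5], rule exI[of _ A6], intro allI impI, intro conjI A5_pos A6_pos)
    fix P :: "'w measure" and X Y :: "real \<Rightarrow> 'w \<Rightarrow> real ^ 'd" and M :: real and E :: "(real \<times> real) set" and a :: "real ^ 'd"
    assume BX: "brownian_motion P X" and BY: "brownian_motion P Y" and ind: "indep_processes P X Y"
      and M: "M > 0" and E: "compact E" "E \<subseteq> {0..} \<times> {0..}" and c1: "c1 E > 0" and a: "\<forall>i. a $ i \<in> {-M..M}"
    let ?hit = "emeasure P {\<omega>\<in>space P. a \<in> (\<lambda>p. additive_process X Y p \<omega>) ` E}"
    have "ennreal (A5 (c1 E) (c2 E) M) * capacity \<beta> E \<le> ?hit \<and> ?hit \<le> ennreal (A6 (c1 E) (c2 E) M) * capacity \<beta> E"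
    proof (cases "E = {}")
      case True
      then show ?thesis by (simp add: capacity_empty)
    next
      case False
      then obtain e where e: "e \<in> E" by auto
      define m where "m = enn2real (c1 E)"
      define L where "L = enn2real (c2 E)"
      have "c1 E \<le> ennreal (infnorm e)"
        unfolding c1_def by (rule INF_lower[OF e])
      then have c1_fin: "c1 E < top" by (rule le_less_trans) simp
      then have c1_eq: "c1 E = ennreal m" and m: "0 < m"
        using c1 by (simp_all add: m_def enn2real_positive_iff)
      have m_le: "m \<le> infnorm p" if "p \<in> E" for p
      proof -
        have "ennreal m \<le> ennreal (infnorm p)"
          unfolding c1_eq[symmetric] c1_def by (rule INF_lower[OF that])
        then show ?thesis using infnorm_pos_le[of p] by (simp add: ennreal_le_iff)
      qed
      obtain B where B: "\<And>p. p \<in> E \<Longrightarrow> norm p \<le> B"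
        using compact_imp_bounded[OF E(1)] by (auto simp: bounded_iff)
      have "c2 E \<le> ennreal B"
        unfolding c2_def by (rule SUP_least, rule ennreal_leI, rule order_trans[OF infnorm_le_norm B])
      then have "c2 E < top" by (rule le_less_trans) simp
      then have c2_eq: "c2 E = ennreal L" by (simp add: L_def)
      have le_L: "infnorm p \<le> L" if "p \<in> E" for p
      proof -
        have "ennreal (infnorm p) \<le> ennreal L"
          unfolding c2_eq[symmetric] c2_def by (rule SUP_upper[OF that])
        then show ?thesis by (simp add: L_def)
      qed
      have aM: "\<bar>a $ i\<bar> \<le> M" for i
        using a by (auto simp: abs_le_iff minus_le_iff)
      have A5: "A5 (c1 E) (c2 E) M = (k m L M)\<^sup>2 / (4 * C m)"
        using m by (simp add: A5_def m_def L_def)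
      have A6: "A6 (c1 E) (c2 E) M = 2 * ((4 * pi) powr \<beta> * (256 * h m))"
        using m by (simp add: A6_def m_def)
      have "ennreal (A5 (c1 E) (c2 E) M) * inverse (energy \<beta> \<sigma>) \<le> ?hit" if "\<sigma> \<in> prob_measures_on E" for \<sigma>
        unfolding A5 \<beta>_def
        by (rule hitting_lower[OF BX BY ind m E m_le le_L aM that k_def C_def[unfolded \<beta>_def h_def]])
      then have "ennreal (A5 (c1 E) (c2 E) M) * capacity \<beta> E \<le> ?hit"
        unfolding capacity_def using A5_pos[of "c1 E" "c2 E" M] by (intro mult_inverse_INF_le) auto
      moreover have "?hit \<le> ennreal (A6 (c1 E) (c2 E) M) * capacity \<beta> E"
        unfolding A6 \<beta>_def h_def by (rule hitting_upper_two_sided[OF BX BY ind m E m_le])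
      ultimately show ?thesis ..
    qed
    then show "ennreal (A5 (c1 E) (c2 E) M) * capacity (real CARD('d) / 2) E \<le> ?hit"
      "?hit \<le> ennreal (A6 (c1 E) (c2 E) M) * capacity (real CARD('d) / 2) E"
      by (simp_all add: \<beta>_def)
  qed
qed

end
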